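(* Let $\mathfrak{L}=\mathfrak{sl}_2\otimes_{\mathbb{C}}\mathbb{C}[t]/(t^2)$ be the Takiff Lie algebra of $\mathfrak{sl}_2$, with central elements $C,\overline{C}\in U(\mathfrak{L})$ and ideals $I(\chi,\theta)$, $\mathfrak{I}(\mu)$, $\mathfrak{F}(n)$ of $U(\mathfrak{L})$ as defined in the context. Let $V$ be a simple $\mathfrak{L}$-module such that $C$ acts on $V$ as the scalar $\theta$ and $\overline{C}$ acts on $V$ as the scalar $\chi$, for some $\theta,\chi\in\mathbb{C}$. (a) If $\theta\neq 0$ or $\chi\neq 0$, then $\mathrm{Ann}_{U(\mathfrak{L})}V=I(\chi,\theta)$. (b) If $\theta=\chi=0$ and $V$ is simple as an $\mathfrak{sl}_2$-module, then $\mathrm{Ann}_{U(\mathfrak{L})}V$ is either $\mathfrak{I}(\mu)$, for some $\mu\in\mathbb{C}$, or $\mathfrak{F}(n)$, for some $n\in\mathbb{Z}_{+}$. (c) $I(0,0)$ is a primitive ideal of $U(\mathfrak{L})$.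
   Context: All vector spaces, algebras and modules are over $\mathbb{C}$; $\mathbb{Z}_+$ is the set of non-negative integers. $\mathfrak{sl}_2$ has standard basis $e,h,f$ with $[e,f]=h$, $[h,e]=2e$, $[h,f]=-2f$. The Takiff Lie algebra is $\mathfrak{L}=\mathfrak{sl}_2\otimes_{\mathbb{C}}D$, $D=\mathbb{C}[t]/(t^2)$, with bracket $[x\otimes t^i,y\otimes t^j]=[x,y]\otimes t^{i+j}$. We identify $\mathfrak{sl}_2$ with $\mathfrak{sl}_2\otimes 1$ and set $\overline{e}=e\otimes t$, $\overline{f}=f\otimes t$, $\overline{h}=h\otimes t$; $\overline{\mathfrak{g}}$ is the ideal of $\mathfrak{L}$ spanned by $\overline{e},\overline{f},\overline{h}$. The center of $U(\mathfrak{L})$ is the polynomial algebra in the two central elements $$C=\overline{h}h+2\overline{f}e+2\overline{e}f,\qquad \overline{C}=\overline{h}^2+4\overline{f}\,\overline{e}.$$ Let $\mathtt{C}=(h+1)^2+4fe\in U(\mathfrak{sl}_2)$ be the Casimir element of $\mathfrak{sl}_2$. For $n\in\mathbb{Z}_+$, $L(n)$ is the simple finite dimensional $\mathfrak{sl}_2$-module with highest weight $n$, and $J_n=\mathrm{Ann}_{U(\mathfrak{sl}_2)}L(n)$. The following are two-sided ideals of $U(\mathfrak{L})$: - $I(\chi,\theta)$, for $\chi,\theta\in\mathbb{C}$: generated by $C-\theta$ and $\overline{C}-\chi$; - $\mathfrak{I}(\mu)$, for $\mu\in\mathbb{C}$: generated by $\mathtt{C}-(\mu+1)^2$ and $\overline{\mathfrak{g}}$;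 - $\mathfrak{F}(n)$, for $n\in\mathbb{Z}_+$: generated by $J_n$ and $\overline{\mathfrak{g}}$. For an algebra $A$ and an $A$-module $M$, $\mathrm{Ann}_A(M)=\{a\in A: a\cdot m=0\text{ for all }m\in M\}$. An ideal $I$ of $A$ is primitive if $I=\mathrm{Ann}_A(V)$ for some simple $A$-module $V$. *)

theory Defs
  imports
    "HOL-Library.Poly_Mapping"
    "HOL-Computational_Algebra.Polynomial"
    Complex_Main
begin

section \<open>Complex vector spaces, algebras and Lie algebras\<close>

class complex_vector = ab_group_add +
  fixes scaleC :: "complex \<Rightarrow> 'a \<Rightarrow> 'a"  (infixr \<open>*\<^sub>C\<close> 75)
  assumes scaleC_add_right: "c *\<^sub>C (x + y) = c *\<^sub>C x + c *\<^sub>C y"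
    and scaleC_add_left: "(c + d) *\<^sub>C x = c *\<^sub>C x + d *\<^sub>C x"
    and scaleC_scaleC: "c *\<^sub>C d *\<^sub>C x = (c * d) *\<^sub>C x"
    and scaleC_one: "1 *\<^sub>C x = x"

global_interpretation complex_vector: vector_space "scaleC :: complex \<Rightarrow> 'a \<Rightarrow> 'a::complex_vector"
  by unfold_locales (rule scaleC_add_right scaleC_add_left scaleC_scaleC scaleC_one)+

class complex_algebra_1 = complex_vector + ring_1 +
  assumes mult_scaleC_left: "(c *\<^sub>C x) * y = c *\<^sub>C (x * y)"
    and mult_scaleC_right: "x * (c *\<^sub>C y) = c *\<^sub>C (x * y)"

class complex_lie_algebra = complex_vector +
  fixes lie_bracket :: "'a \<Rightarrow> 'a \<Rightarrow> 'a"
  assumes lie_bracket_add_left: "lie_bracket (x + y) z = lie_bracket x z + lie_bracket y z"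
    and lie_bracket_scaleC_left: "lie_bracket (c *\<^sub>C x) z = c *\<^sub>C lie_bracket x z"
    and lie_bracket_add_right: "lie_bracket z (x + y) = lie_bracket z x + lie_bracket z y"
    and lie_bracket_scaleC_right: "lie_bracket z (c *\<^sub>C x) = c *\<^sub>C lie_bracket z x"
    and lie_bracket_self: "lie_bracket x x = 0"
    and lie_bracket_jacobi:
      "lie_bracket x (lie_bracket y z) + lie_bracket y (lie_bracket z x)
         + lie_bracket z (lie_bracket x y) = 0"

definition two_sided_ideal :: "'a::ring_1 set \<Rightarrow> bool" where
  "two_sided_ideal I \<longleftrightarrow>
     0 \<in> I \<and> (\<forall>a\<in>I. \<forall>b\<in>I. a + b \<in> I) \<and> (\<forall>a\<in>I. \<forall>r. r * a \<in> I \<and> a * r \<in> I)"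

definition ideal_generated :: "'a::ring_1 set \<Rightarrow> 'a set" where
  "ideal_generated S = \<Inter>{I. two_sided_ideal I \<and> S \<subseteq> I}"


section \<open>Modules\<close>

text \<open>
  A module has a carrier \<^term>\<open>V\<close> inside some ambient abelian group; the action is only
  relevant on \<^term>\<open>V\<close>.  For a module over a unital complex algebra the complex scalars act
  through the unit, so that submodules are automatically complex subspaces.
\<close>

locale left_module =
  fixes act :: "'a::ring_1 \<Rightarrow> 'v::ab_group_add \<Rightarrow> 'v" and V :: "'v set"
  assumes zero_closed: "0 \<in> V"
    and add_closed: "v \<in> V \<Longrightarrow> w \<in> V \<Longrightarrow> v + w \<in> V"
    and uminus_closed: "v \<in> V \<Longrightarrow> - v \<in> V"
    and act_closed: "v \<in> V \<Longrightarrow> act a v \<in> V"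
    and act_add_right: "v \<in> V \<Longrightarrow> w \<in> V \<Longrightarrow> act a (v + w) = act a v + act a w"
    and act_add_left: "v \<in> V \<Longrightarrow> act (a + b) v = act a v + act b v"
    and act_mult: "v \<in> V \<Longrightarrow> act (a * b) v = act a (act b v)"
    and act_one: "v \<in> V \<Longrightarrow> act 1 v = v"

locale simple_left_module = left_module +
  assumes nonzero: "V \<noteq> {0}"
    and simple: "W \<subseteq> V \<Longrightarrow> 0 \<in> W \<Longrightarrow> (\<And>v w. v \<in> W \<Longrightarrow> w \<in> W \<Longrightarrow> v + w \<in> W) \<Longrightarrow>
      (\<And>a v. v \<in> W \<Longrightarrow> act a v \<in> W) \<Longrightarrow> W = {0} \<or> W = V"

definition annihilator :: "('a \<Rightarrow> 'v::ab_group_add \<Rightarrow> 'v) \<Rightarrow> 'v set \<Rightarrow> 'a set" where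
  "annihilator act V = {a. \<forall>v\<in>V. act a v = 0}"

text \<open>
  The simple module in the definition of a primitive ideal is required to have its carrier in
  the type of the algebra.  This is no restriction: a simple module is \<open>A/M\<close> for a left ideal
  \<open>M\<close>, and can be realised on a linear complement of \<open>M\<close> in \<open>A\<close>;
  see \<open>primitive_ideal_annihilator\<close> below.
\<close>

definition primitive_ideal :: "'a::complex_algebra_1 set \<Rightarrow> bool" where
  "primitive_ideal I \<longleftrightarrow>
     (\<exists>(act :: 'a \<Rightarrow> 'a \<Rightarrow> 'a) V. simple_left_module act V \<and> I = annihilator act V)"

lemma (in left_module) act_zero_left: "v \<in> V \<Longrightarrow> act 0 v = 0"
  using act_add_left[of v 0 0] by simp

lemma (in left_module) act_zero_right: "act a 0 = 0"
  using act_add_right[of 0 0 a] zero_closed by simp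

lemma (in left_module) act_diff_left: "v \<in> V \<Longrightarrow> act (a - b) v = act a v - act b v"
  using act_add_left[of v "a - b" b] by simp

theorem primitive_ideal_annihilator:
  fixes act :: "'a::complex_algebra_1 \<Rightarrow> 'v::ab_group_add \<Rightarrow> 'v"
  assumes "simple_left_module act V"
  shows "primitive_ideal (annihilator act V)"
proof -
  interpret simple_left_module act V by fact
  obtain v0 where v0: "v0 \<in> V" "v0 \<noteq> 0"
    using nonzero zero_closed by blast
  define M where "M = {a. act a v0 = 0}"
  have M_sub: "complex_vector.subspace M"
  proof (rule complex_vector.subspaceI)
    show "0 \<in> M" by (simp add: M_def act_zero_left v0)
    show "x + y \<in> M" if "x \<in> M" "y \<in> M" for x y
      using that by (simp add: M_def act_add_left v0)
    show "c *\<^sub>C x \<in> M" if "x \<in> M" for c x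
    proof -
      have "act ((c *\<^sub>C 1) * x) v0 = 0"
        using that by (simp add: M_def act_mult v0 act_zero_right)
      then show ?thesis by (simp add: M_def mult_scaleC_left)
    qed
  qed
  obtain B where B: "B \<subseteq> M" "complex_vector.independent B" "M \<subseteq> complex_vector.span B"
    using complex_vector.maximal_independent_subset[of M] by metis
  obtain E where E: "B \<subseteq> E" "complex_vector.independent E" "UNIV \<subseteq> complex_vector.span E"
    using complex_vector.maximal_independent_subset_extend[OF subset_UNIV B(2)] by metis
  interpret p: vector_space_pair "scaleC :: complex \<Rightarrow> 'a \<Rightarrow> 'a" "scaleC :: complex \<Rightarrow> 'a \<Rightarrow> 'a"
    by unfold_locales
  define \<pi> where "\<pi> = p.construct E (\<lambda>b. if b \<in> B then 0 else b)"
  have lin: "Vector_Spaces.linear scaleC scaleC \<pi>"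
    unfolding \<pi>_def by (rule p.linear_construct[OF E(2)])
  have \<pi>_basis: "b \<in> E \<Longrightarrow> \<pi> b = (if b \<in> B then 0 else b)" for b
    unfolding \<pi>_def by (rule p.construct_basis[OF E(2)])
  have \<pi>_add: "\<pi> (x + y) = \<pi> x + \<pi> y" for x y using p.linear_add[OF lin] .
  have \<pi>_scale: "\<pi> (c *\<^sub>C x) = c *\<^sub>C \<pi> x" for x c using p.linear_scale[OF lin] .
  have \<pi>_diff: "\<pi> (x - y) = \<pi> x - \<pi> y" for x y using p.linear_diff[OF lin] .
  have \<pi>_0: "\<pi> 0 = 0" using \<pi>_diff[of 0 0] by simp
  have \<pi>_M: "\<pi> m = 0" if "m \<in> M" for m
  proof -
    have "m \<in> complex_vector.span B" using that B(3) by blast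
    then show ?thesis
    proof (induction rule: complex_vector.span_induct_alt)
      case base show ?case by (rule \<pi>_0)
    next
      case (step c x y)
      then show ?case using \<pi>_basis[of x] E(1) by (auto simp: \<pi>_add \<pi>_scale)
    qed
  qed
  have diff_M: "x - \<pi> x \<in> M" for x
  proof -
    have "x \<in> complex_vector.span E" using E(3) by blast
    then show ?thesis
    proof (induction rule: complex_vector.span_induct_alt)
      case base show ?case by (simp add: \<pi>_0 complex_vector.subspace_0[OF M_sub])
    next
      case (step c x y)
      have "x - \<pi> x \<in> M"
        using \<pi>_basis[OF step(1)] B(1) complex_vector.subspace_0[OF M_sub] by auto
      then have "c *\<^sub>C (x - \<pi> x) + (y - \<pi> y) \<in> M"
        using step(2) M_sub complex_vector.subspace_add complex_vector.subspace_scale by metis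
      then show ?case
        by (simp add: \<pi>_add \<pi>_scale complex_vector.scale_right_diff_distrib algebra_simps)
    qed
  qed
  have \<pi>_v0: "act (\<pi> x) v0 = act x v0" for x
    using diff_M[of x] by (simp add: M_def act_diff_left v0)
  have \<pi>_eqI: "\<pi> x = \<pi> y" if "act x v0 = act y v0" for x y
    using \<pi>_M[of "x - y"] that \<pi>_diff by (simp add: M_def act_diff_left v0)
  define W where "W = range \<pi>"
  define act' where "act' = (\<lambda>a w. \<pi> (a * w))"
  have W_\<pi>: "\<pi> w = w" if "w \<in> W" for w
    using that \<pi>_eqI \<pi>_v0 unfolding W_def by blast
  have act'_v0: "act (act' a w) v0 = act a (act w v0)" for a w
    by (simp add: act'_def \<pi>_v0 act_mult v0)
  have W_eqI: "x = y" if "x \<in> W" "y \<in> W" "act x v0 = act y v0" for x y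
    using \<pi>_eqI[OF that(3)] W_\<pi> that by simp
  have W_add: "x + y \<in> W" if "x \<in> W" "y \<in> W" for x y
    using that W_\<pi> \<pi>_add unfolding W_def by (metis rangeI)
  have act'_W: "act' a w \<in> W" for a w
    by (simp add: act'_def W_def)
  have gen: "range (\<lambda>a. act a v0) = V"
  proof -
    have "range (\<lambda>a. act a v0) = {0} \<or> range (\<lambda>a. act a v0) = V"
    proof (rule simple)
      show "range (\<lambda>a. act a v0) \<subseteq> V" using act_closed v0 by blast
      show "0 \<in> range (\<lambda>a. act a v0)" using act_zero_left[OF v0(1)] by (metis rangeI)
      show "v + w \<in> range (\<lambda>a. act a v0)"
        if "v \<in> range (\<lambda>a. act a v0)" "w \<in> range (\<lambda>a. act a v0)" for v w
        using that by (auto simp flip: act_add_left[OF v0(1)])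
      show "act a v \<in> range (\<lambda>a. act a v0)" if "v \<in> range (\<lambda>a. act a v0)" for a v
        using that by (auto simp flip: act_mult[OF v0(1)])
    qed
    moreover have "v0 \<in> range (\<lambda>a. act a v0)" using act_one[OF v0(1)] by (metis rangeI)
    ultimately show ?thesis using v0 by blast
  qed
  have W_surj: "\<exists>w\<in>W. act w v0 = v" if "v \<in> V" for v
    using that \<pi>_v0 unfolding W_def gen[symmetric] by auto
  interpret W: left_module act' W
  proof
    show "0 \<in> W" using \<pi>_0 unfolding W_def by (metis rangeI)
    show "v + w \<in> W" if "v \<in> W" "w \<in> W" for v w using W_add that .
    show "- v \<in> W" if "v \<in> W" for v
      using that W_\<pi>[of v] \<pi>_diff[of 0 v] \<pi>_0 unfolding W_def by (metis diff_0 rangeI)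
    show "act' a v \<in> W" for a v by (rule act'_W)
    show "act' a (v + w) = act' a v + act' a w" for a v w
      by (simp add: act'_def distrib_left \<pi>_add)
    show "act' (a + b) v = act' a v + act' b v" for a b v
      by (simp add: act'_def distrib_right \<pi>_add)
    show "act' (a * b) v = act' a (act' b v)" for a b v
      by (rule W_eqI) (simp_all add: act'_W act'_v0 act_mult v0 act_closed)
    show "act' 1 v = v" if "v \<in> W" for v using that W_\<pi> by (simp add: act'_def)
  qed
  have "simple_left_module act' W"
  proof
    obtain w where "w \<in> W" "act w v0 = v0" using W_surj v0 by blast
    then show "W \<noteq> {0}" using v0 act_zero_left by force
    fix U assume U: "U \<subseteq> W" "0 \<in> U" "\<And>v w. v \<in> U \<Longrightarrow> w \<in> U \<Longrightarrow> v + w \<in> U"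
      "\<And>a v. v \<in> U \<Longrightarrow> act' a v \<in> U"
    have "(\<lambda>w. act w v0) ` U = {0} \<or> (\<lambda>w. act w v0) ` U = V"
    proof (rule simple)
      show "(\<lambda>w. act w v0) ` U \<subseteq> V" using act_closed v0 by blast
      show "0 \<in> (\<lambda>w. act w v0) ` U" using U(2) act_zero_left[OF v0(1)] by force
      show "v + w \<in> (\<lambda>w. act w v0) ` U"
        if "v \<in> (\<lambda>w. act w v0) ` U" "w \<in> (\<lambda>w. act w v0) ` U" for v w
        using that U(3) by (auto simp flip: act_add_left[OF v0(1)])
      show "act a v \<in> (\<lambda>w. act w v0) ` U" if "v \<in> (\<lambda>w. act w v0) ` U" for a v
        using that U(4) by (auto simp flip: act'_v0)
    qed
    then show "U = {0} \<or> U = W"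
    proof
      assume "(\<lambda>w. act w v0) ` U = {0}"
      have "u = 0" if "u \<in> U" for u
      proof (rule W_eqI)
        show "u \<in> W" "0 \<in> W" using that U(1) W.zero_closed by auto
        show "act u v0 = act 0 v0"
          using that \<open>(\<lambda>w. act w v0) ` U = {0}\<close> by (simp add: act_zero_left v0) blast
      qed
      then show ?thesis using U(2) by blast
    next
      assume V: "(\<lambda>w. act w v0) ` U = V"
      have "w \<in> U" if "w \<in> W" for w
      proof -
        have "act w v0 \<in> V" using act_closed v0 by blast
        then obtain u where "u \<in> U" "act u v0 = act w v0" using V by (metis imageE)
        then show ?thesis using W_eqI[of u w] that U(1) by blast
      qed
      then show ?thesis using U(1) by blast
    qed
  qed
  moreover have "annihilator act V = annihilator act' W"
  proof -
    have "(\<forall>v\<in>V. act a v = 0) \<longleftrightarrow> (\<forall>w\<in>W. act' a w = 0)" for a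
    proof
      assume *: "\<forall>v\<in>V. act a v = 0"
      show "\<forall>w\<in>W. act' a w = 0"
      proof
        fix w assume "w \<in> W"
        show "act' a w = 0"
          by (rule W_eqI) (simp_all add: act'_W W.zero_closed act'_v0 * act_closed v0 act_zero_left)
      qed
    next
      assume *: "\<forall>w\<in>W. act' a w = 0"
      show "\<forall>v\<in>V. act a v = 0"
      proof
        fix v assume "v \<in> V"
        then obtain w where "w \<in> W" "act w v0 = v" using W_surj by blast
        then show "act a v = 0" using * act'_v0[of a w] act_zero_left v0 by simp
      qed
    qed
    then show ?thesis by (simp add: annihilator_def)
  qed
  ultimately show ?thesis unfolding primitive_ideal_def by blast
qed

locale lie_module = vector_space scale
  for scale :: "complex \<Rightarrow> 'v::ab_group_add \<Rightarrow> 'v" +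
  fixes \<rho> :: "'g::complex_lie_algebra \<Rightarrow> 'v \<Rightarrow> 'v" and V :: "'v set"
  assumes subspace_V: "subspace V"
    and \<rho>_closed: "v \<in> V \<Longrightarrow> \<rho> x v \<in> V"
    and \<rho>_add_right: "v \<in> V \<Longrightarrow> w \<in> V \<Longrightarrow> \<rho> x (v + w) = \<rho> x v + \<rho> x w"
    and \<rho>_scale_right: "v \<in> V \<Longrightarrow> \<rho> x (scale c v) = scale c (\<rho> x v)"
    and \<rho>_add_left: "v \<in> V \<Longrightarrow> \<rho> (x + y) v = \<rho> x v + \<rho> y v"
    and \<rho>_scale_left: "v \<in> V \<Longrightarrow> \<rho> (c *\<^sub>C x) v = scale c (\<rho> x v)"
    and \<rho>_bracket: "v \<in> V \<Longrightarrow> \<rho> (lie_bracket x y) v = \<rho> x (\<rho> y v) - \<rho> y (\<rho> x v)"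

locale simple_lie_module = lie_module +
  assumes nonzero: "V \<noteq> {0}"
    and simple: "subspace W \<Longrightarrow> W \<subseteq> V \<Longrightarrow> (\<And>x v. v \<in> W \<Longrightarrow> \<rho> x v \<in> W) \<Longrightarrow> W = {0} \<or> W = V"


section \<open>The universal enveloping algebra\<close>

text \<open>
  \<^emph>\<open>U(g)\<close> is the free unital algebra on the underlying set of \<^emph>\<open>g\<close>, i.e. the monoid
  algebra of the words in \<^emph>\<open>g\<close>, modulo the relations making \<^emph>\<open>g \<rightarrow> U(g)\<close> linear
  and turning brackets into commutators.
\<close>

datatype 'g word = Word (letters: "'g list")

instantiation word :: (type) monoid_add
begin

definition zero_word :: "'a word" where "zero_word = Word []"

definition plus_word :: "'a word \<Rightarrow> 'a word \<Rightarrow> 'a word" where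
  "plus_word v w = Word (letters v @ letters w)"

instance by standard (simp_all add: zero_word_def plus_word_def)

end

type_synonym 'g free_algebra = "'g word \<Rightarrow>\<^sub>0 complex"

definition free_gen :: "'g \<Rightarrow> 'g free_algebra" where
  "free_gen x = Poly_Mapping.single (Word [x]) 1"

definition free_scale :: "complex \<Rightarrow> 'g free_algebra \<Rightarrow> 'g free_algebra" where
  "free_scale c p = Poly_Mapping.single 0 c * p"

definition uea_relations :: "'g::complex_lie_algebra free_algebra set" where
  "uea_relations =
     {free_gen (x + y) - (free_gen x + free_gen y) |x y. True} \<union>
     {free_gen (c *\<^sub>C x) - free_scale c (free_gen x) |c x. True} \<union>
     {free_gen x * free_gen y - free_gen y * free_gen x - free_gen (lie_bracket x y) |x y. True}"

definition uea_rel :: "'g::complex_lie_algebra free_algebra \<Rightarrow> 'g free_algebra \<Rightarrow> bool" where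
  "uea_rel p q \<longleftrightarrow> p - q \<in> ideal_generated uea_relations"

text \<open>
  The action of a noncommutative polynomial: a word \<open>x1 \<dots> xn\<close> acts as
  \<open>\<rho> x1 \<circ> \<dots> \<circ> \<rho> xn\<close>.
\<close>

definition free_act ::
  "(complex \<Rightarrow> 'v::ab_group_add \<Rightarrow> 'v) \<Rightarrow> ('g \<Rightarrow> 'v \<Rightarrow> 'v) \<Rightarrow> 'g free_algebra \<Rightarrow> 'v \<Rightarrow> 'v" where
  "free_act scale \<rho> p v =
     (\<Sum>w\<in>Poly_Mapping.keys p. scale (Poly_Mapping.lookup p w) (foldr \<rho> (letters w) v))"


lemma two_sided_ideal_ideal_generated: "two_sided_ideal (ideal_generated S)"
  unfolding two_sided_ideal_def ideal_generated_def by blast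

lemma ideal_generated_superset: "S \<subseteq> ideal_generated S"
  unfolding ideal_generated_def by blast

lemma ideal_generated_minimal: "two_sided_ideal I \<Longrightarrow> S \<subseteq> I \<Longrightarrow> ideal_generated S \<subseteq> I"
  unfolding ideal_generated_def by blast

lemma poly_mapping_sum_single:
  "(\<Sum>w\<in>Poly_Mapping.keys p. Poly_Mapping.single w (Poly_Mapping.lookup p w)) = p"
  by (rule poly_mapping_eqI)
    (auto simp: lookup_sum lookup_single when_def in_keys_iff sum.delta' cong: if_cong)

context lie_module
begin

lemma foldr_closed: "v \<in> V \<Longrightarrow> foldr \<rho> ws v \<in> V"
  by (induction ws) (auto intro: \<rho>_closed)

lemma foldr_add: "v \<in> V \<Longrightarrow> w \<in> V \<Longrightarrow> foldr \<rho> ws (v + w) = foldr \<rho> ws v + foldr \<rho> ws w"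
  by (induction ws) (auto simp: \<rho>_add_right foldr_closed)

lemma foldr_scale: "v \<in> V \<Longrightarrow> foldr \<rho> ws (scale c v) = scale c (foldr \<rho> ws v)"
  by (induction ws) (auto simp: \<rho>_scale_right foldr_closed)

lemma free_act_superset:
  assumes "finite S" "Poly_Mapping.keys p \<subseteq> S"
  shows "free_act scale \<rho> p v = (\<Sum>w\<in>S. scale (Poly_Mapping.lookup p w) (foldr \<rho> (letters w) v))"
  unfolding free_act_def
  by (rule sum.mono_neutral_left) (use assms in \<open>auto simp: in_keys_iff\<close>)

lemma free_act_0: "free_act scale \<rho> 0 v = 0"
  by (simp add: free_act_def)

lemma free_act_single: "free_act scale \<rho> (Poly_Mapping.single w c) v = scale c (foldr \<rho> (letters w) v)"
  by (cases "c = 0") (simp_all add: free_act_def)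

lemma free_act_add: "free_act scale \<rho> (p + q) v = free_act scale \<rho> p v + free_act scale \<rho> q v"
proof -
  let ?S = "Poly_Mapping.keys p \<union> Poly_Mapping.keys q"
  show ?thesis
    by (simp add: free_act_superset[of ?S] Poly_Mapping.keys_add lookup_add scale_left_distrib
        sum.distrib)
qed

lemma free_act_diff: "free_act scale \<rho> (p - q) v = free_act scale \<rho> p v - free_act scale \<rho> q v"
  using free_act_add[of "p - q" q v] by simp

lemma free_act_closed: "v \<in> V \<Longrightarrow> free_act scale \<rho> p v \<in> V"
  unfolding free_act_def by (intro subspace_sum subspace_scale subspace_V foldr_closed)

lemma free_act_add_right:
  "v \<in> V \<Longrightarrow> w \<in> V \<Longrightarrow> free_act scale \<rho> p (v + w) = free_act scale \<rho> p v + free_act scale \<rho> p w"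
  by (simp add: free_act_def foldr_add scale_right_distrib sum.distrib)

lemma free_act_scale_right:
  "v \<in> V \<Longrightarrow> free_act scale \<rho> p (scale c v) = scale c (free_act scale \<rho> p v)"
  by (simp add: free_act_def foldr_scale scale_sum_right mult.commute)

lemma free_act_zero_right: "free_act scale \<rho> p 0 = 0"
  using free_act_add_right[of 0 0 p] subspace_0[OF subspace_V] by simp

lemma free_act_sum: "free_act scale \<rho> (sum f S) v = (\<Sum>i\<in>S. free_act scale \<rho> (f i) v)"
  by (induction S rule: infinite_finite_induct) (simp_all add: free_act_0 free_act_add)

lemma free_act_one: "free_act scale \<rho> 1 v = v"
  using free_act_single[of 0 1 v] by (simp add: zero_word_def flip: single_one)

lemma free_act_mult:
  assumes v: "v \<in> V"
  shows "free_act scale \<rho> (p * q) v = free_act scale \<rho> p (free_act scale \<rho> q v)"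
proof -
  have 1: "free_act scale \<rho> (Poly_Mapping.single a c * Poly_Mapping.single b d) v =
      free_act scale \<rho> (Poly_Mapping.single a c) (free_act scale \<rho> (Poly_Mapping.single b d) v)"
    for a b c d
    using v by (simp add: mult_single free_act_single plus_word_def foldr_scale foldr_closed)
  have 2: "free_act scale \<rho> (p * Poly_Mapping.single b d) v =
      free_act scale \<rho> p (free_act scale \<rho> (Poly_Mapping.single b d) v)" for b d
  proof -
    have "free_act scale \<rho> (sum f S * Poly_Mapping.single b d) v =
        free_act scale \<rho> (sum f S) (free_act scale \<rho> (Poly_Mapping.single b d) v)"
      if "\<And>i. i \<in> S \<Longrightarrow> \<exists>a c. f i = Poly_Mapping.single a c" for f :: "_ \<Rightarrow> _ free_algebra" and S
      unfolding sum_distrib_right free_act_sum by (rule sum.cong) (use that 1 in fastforce)+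
    from this[of "Poly_Mapping.keys p" "\<lambda>w. Poly_Mapping.single w (Poly_Mapping.lookup p w)"]
    show ?thesis unfolding poly_mapping_sum_single by blast
  qed
  have "free_act scale \<rho> (p * sum f S) v = free_act scale \<rho> p (free_act scale \<rho> (sum f S) v)"
    if "\<And>i. i \<in> S \<Longrightarrow> \<exists>a c. f i = Poly_Mapping.single a c" for f :: "_ \<Rightarrow> _ free_algebra" and S
    using that
  proof (induction S rule: infinite_finite_induct)
    case (insert i S)
    then obtain a c where "f i = Poly_Mapping.single a c" by blast
    then show ?case
      using insert v
      by (simp add: distrib_left free_act_add 2 free_act_add_right free_act_closed)
  qed (simp_all add: free_act_0 free_act_zero_right)
  from this[of "Poly_Mapping.keys q" "\<lambda>w. Poly_Mapping.single w (Poly_Mapping.lookup q w)"]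
  show ?thesis unfolding poly_mapping_sum_single by blast
qed

lemma free_act_scale: "free_act scale \<rho> (free_scale c p) v = scale c (free_act scale \<rho> p v)"
  if "v \<in> V"
  using that by (simp add: free_scale_def free_act_mult free_act_single zero_word_def)

lemma free_act_gen: "free_act scale \<rho> (free_gen x) v = \<rho> x v"
  by (simp add: free_gen_def free_act_single)

lemma free_act_ideal:
  assumes "p \<in> ideal_generated uea_relations" "v \<in> V"
  shows "free_act scale \<rho> p v = 0"
proof -
  let ?K = "{p. \<forall>v\<in>V. free_act scale \<rho> p v = 0}"
  have "ideal_generated uea_relations \<subseteq> ?K"
  proof (rule ideal_generated_minimal)
    show "two_sided_ideal ?K"
      by (auto simp: two_sided_ideal_def free_act_0 free_act_add free_act_mult free_act_zero_right
          free_act_closed)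
    show "uea_relations \<subseteq> ?K"
      by (auto simp: uea_relations_def free_act_diff free_act_add free_act_gen free_act_scale
          free_act_mult \<rho>_add_left \<rho>_scale_left \<rho>_bracket)
  qed
  then show ?thesis using assms by blast
qed

end

lemma ideal_uminus: "two_sided_ideal I \<Longrightarrow> a \<in> I \<Longrightarrow> - a \<in> I"
  unfolding two_sided_ideal_def by (metis mult_minus1)

lemma ideal_diff: "two_sided_ideal I \<Longrightarrow> a \<in> I \<Longrightarrow> b \<in> I \<Longrightarrow> a - b \<in> I"
  using ideal_uminus[of I b] unfolding two_sided_ideal_def by (metis diff_conv_add_uminus)

quotient_type (overloaded) 'g uea = "'g::complex_lie_algebra free_algebra" / uea_rel
proof (rule equivpI)
  let ?I = "ideal_generated (uea_relations :: 'g free_algebra set)"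
  note I = two_sided_ideal_ideal_generated[of "uea_relations :: 'g free_algebra set"]
  show "reflp (uea_rel :: 'g free_algebra \<Rightarrow> _)"
    using I by (auto simp: reflp_def uea_rel_def two_sided_ideal_def)
  show "symp (uea_rel :: 'g free_algebra \<Rightarrow> _)"
    using ideal_uminus[OF I] by (fastforce simp: symp_def uea_rel_def)
  show "transp (uea_rel :: 'g free_algebra \<Rightarrow> _)"
  proof (rule transpI)
    fix x y z :: "'g free_algebra"
    assume "uea_rel x y" "uea_rel y z"
    then have "(x - y) + (y - z) \<in> ?I" using I unfolding uea_rel_def two_sided_ideal_def by blast
    then show "uea_rel x z" by (simp add: uea_rel_def)
  qed
qed

instantiation uea :: (complex_lie_algebra) complex_algebra_1
begin

lift_definition zero_uea :: "'a uea" is 0 .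
lift_definition one_uea :: "'a uea" is 1 .

lift_definition plus_uea :: "'a uea \<Rightarrow> 'a uea \<Rightarrow> 'a uea" is "(+)"
proof -
  fix p p' q q' :: "'a free_algebra"
  assume "uea_rel p p'" "uea_rel q q'"
  then have "(p - p') + (q - q') \<in> ideal_generated uea_relations"
    using two_sided_ideal_ideal_generated unfolding uea_rel_def two_sided_ideal_def by blast
  then show "uea_rel (p + q) (p' + q')" by (simp add: uea_rel_def algebra_simps)
qed

lift_definition uminus_uea :: "'a uea \<Rightarrow> 'a uea" is uminus
proof -
  fix p p' :: "'a free_algebra"
  assume "uea_rel p p'"
  then have "- (p - p') \<in> ideal_generated uea_relations"
    unfolding uea_rel_def by (rule ideal_uminus[OF two_sided_ideal_ideal_generated])
  then show "uea_rel (- p) (- p')" by (simp add: uea_rel_def algebra_simps)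
qed

lift_definition minus_uea :: "'a uea \<Rightarrow> 'a uea \<Rightarrow> 'a uea" is "(-)"
proof -
  fix p p' q q' :: "'a free_algebra"
  assume "uea_rel p p'" "uea_rel q q'"
  then have "(p - p') - (q - q') \<in> ideal_generated uea_relations"
    unfolding uea_rel_def by (rule ideal_diff[OF two_sided_ideal_ideal_generated])
  then show "uea_rel (p - q) (p' - q')" by (simp add: uea_rel_def algebra_simps)
qed

lift_definition times_uea :: "'a uea \<Rightarrow> 'a uea \<Rightarrow> 'a uea" is "(*)"
proof -
  fix p p' q q' :: "'a free_algebra"
  assume "uea_rel p p'" "uea_rel q q'"
  then have "p * (q - q') + (p - p') * q' \<in> ideal_generated uea_relations"
    using two_sided_ideal_ideal_generated unfolding uea_rel_def two_sided_ideal_def by blast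
  then show "uea_rel (p * q) (p' * q')" by (simp add: uea_rel_def algebra_simps)
qed

lift_definition scaleC_uea :: "complex \<Rightarrow> 'a uea \<Rightarrow> 'a uea" is free_scale
proof -
  fix p p' :: "'a free_algebra" and c
  assume "uea_rel p p'"
  then have "free_scale c (p - p') \<in> ideal_generated uea_relations"
    using two_sided_ideal_ideal_generated
    unfolding uea_rel_def two_sided_ideal_def free_scale_def by blast
  then show "uea_rel (free_scale c p) (free_scale c p')"
    by (simp add: uea_rel_def free_scale_def algebra_simps)
qed

instance
proof
  have refl: "p = q \<Longrightarrow> uea_rel p q" for p q :: "'a free_algebra"
    using two_sided_ideal_ideal_generated[of "uea_relations :: 'a free_algebra set"]
    by (simp add: uea_rel_def two_sided_ideal_def)
  have central: "p * Poly_Mapping.single 0 c = Poly_Mapping.single 0 c * p"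
    for p :: "'a free_algebra" and c
  proof -
    have "sum f S * Poly_Mapping.single 0 c = Poly_Mapping.single 0 c * sum f S"
      if "\<And>i. i \<in> S \<Longrightarrow> \<exists>a d. f i = Poly_Mapping.single a d"
      for f :: "_ \<Rightarrow> 'a free_algebra" and S
      unfolding sum_distrib_right sum_distrib_left
      by (rule sum.cong) (use that in \<open>fastforce simp: mult_single mult.commute\<close>)+
    from this[of "Poly_Mapping.keys p" "\<lambda>w. Poly_Mapping.single w (Poly_Mapping.lookup p w)"]
    show ?thesis unfolding poly_mapping_sum_single by blast
  qed
  fix a b c :: "'a uea" and r s :: complex
  show "a + b + c = a + (b + c)" by transfer (rule refl, simp add: algebra_simps)
  show "a + b = b + a" by transfer (rule refl, simp add: algebra_simps)
  show "0 + a = a" by transfer (rule refl, simp)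
  show "- a + a = 0" by transfer (rule refl, simp)
  show "a - b = a + - b" by transfer (rule refl, simp)
  show "a * b * c = a * (b * c)" by transfer (rule refl, simp add: mult.assoc)
  show "(a + b) * c = a * c + b * c" by transfer (rule refl, simp add: distrib_right)
  show "a * (b + c) = a * b + a * c" by transfer (rule refl, simp add: distrib_left)
  show "1 * a = a" by transfer (rule refl, simp)
  show "a * 1 = a" by transfer (rule refl, simp)
  show "r *\<^sub>C (a + b) = r *\<^sub>C a + r *\<^sub>C b"
    by transfer (rule refl, simp add: free_scale_def distrib_left)
  show "(r + s) *\<^sub>C a = r *\<^sub>C a + s *\<^sub>C a"
    by transfer (rule refl, simp add: free_scale_def single_add distrib_right)
  show "r *\<^sub>C s *\<^sub>C a = (r * s) *\<^sub>C a"
    by transfer (rule refl, simp add: free_scale_def mult_single flip: mult.assoc)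
  show "1 *\<^sub>C a = a" by transfer (rule refl, simp add: free_scale_def)
  show "(r *\<^sub>C a) * b = r *\<^sub>C (a * b)"
    by transfer (rule refl, simp add: free_scale_def mult.assoc)
  show "a * (r *\<^sub>C b) = r *\<^sub>C (a * b)"
  proof (transfer, rule refl)
    fix a b :: "'a free_algebra" and r
    show "a * free_scale r b = free_scale r (a * b)"
      using central[of a r] by (simp add: free_scale_def mult.assoc flip: central)
  qed
  show "(0 :: 'a uea) \<noteq> 1"
  proof (transfer, rule notI)
    assume "uea_rel (0 :: 'a free_algebra) 1"
    then have *: "(0 - 1 :: 'a free_algebra) \<in> ideal_generated uea_relations"
      by (simp add: uea_rel_def)
    interpret c: vector_space "(*) :: complex \<Rightarrow> complex \<Rightarrow> complex"
      by unfold_locales (simp_all add: algebra_simps)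
    interpret triv: lie_module "(*)" "\<lambda>(x::'a) (v::complex). 0" UNIV
      by unfold_locales simp_all
    show False
      using triv.free_act_ideal[OF *, of 1] by (simp only: triv.free_act_diff) (simp add: triv.free_act_0 triv.free_act_one)
  qed
qed

end

lift_definition uea_gen :: "'g::complex_lie_algebra \<Rightarrow> 'g uea" is free_gen .

lemma uea_gen_relations:
  shows uea_gen_add: "uea_gen (x + y) = uea_gen x + uea_gen y"
    and uea_gen_scaleC: "uea_gen (c *\<^sub>C x) = c *\<^sub>C uea_gen x"
    and uea_gen_bracket: "uea_gen (lie_bracket x y) = uea_gen x * uea_gen y - uea_gen y * uea_gen x"
proof -
  have I: "p \<in> ideal_generated uea_relations" if "p \<in> uea_relations" for p :: "'a free_algebra"
    using that ideal_generated_superset by blast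
  show "uea_gen (x + y) = uea_gen x + uea_gen y"
    by transfer (unfold uea_rel_def, rule I, unfold uea_relations_def, blast)
  show "uea_gen (c *\<^sub>C x) = c *\<^sub>C uea_gen x"
    by transfer (unfold uea_rel_def, rule I, unfold uea_relations_def, blast)
  show "uea_gen (lie_bracket x y) = uea_gen x * uea_gen y - uea_gen y * uea_gen x"
  proof transfer
    fix x y :: 'a
    have "- (free_gen x * free_gen y - free_gen y * free_gen x - free_gen (lie_bracket x y))
        \<in> ideal_generated uea_relations"
      by (rule ideal_uminus[OF two_sided_ideal_ideal_generated])
        (rule I, unfold uea_relations_def, blast)
    then show "uea_rel (free_gen (lie_bracket x y)) (free_gen x * free_gen y - free_gen y * free_gen x)"
      by (simp add: uea_rel_def)
  qed
qed

text \<open>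
  The \<^emph>\<open>U(g)\<close>-action on a \<^emph>\<open>g\<close>-module, and the algebra homomorphism on
  \<^emph>\<open>U(g)\<close> extending a Lie algebra homomorphism into an associative algebra.  Evaluation
  at the representative \<open>rep_uea u\<close> is harmless: on a \<^emph>\<open>g\<close>-module the result
  does not depend on it, see \<open>uea_act_abs\<close>.
\<close>

definition uea_act ::
  "(complex \<Rightarrow> 'v::ab_group_add \<Rightarrow> 'v) \<Rightarrow> ('g::complex_lie_algebra \<Rightarrow> 'v \<Rightarrow> 'v) \<Rightarrow> 'g uea \<Rightarrow> 'v \<Rightarrow> 'v" where
  "uea_act scale \<rho> u v = free_act scale \<rho> (rep_uea u) v"

definition uea_lift :: "('g::complex_lie_algebra \<Rightarrow> 'a::complex_algebra_1) \<Rightarrow> 'g uea \<Rightarrow> 'a" where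
  "uea_lift \<phi> u = uea_act scaleC (\<lambda>x a. \<phi> x * a) u 1"

context lie_module
begin

lemma uea_act_abs:
  assumes "v \<in> V"
  shows "uea_act scale \<rho> (abs_uea p) v = free_act scale \<rho> p v"
proof -
  have "uea_rel (rep_uea (abs_uea p)) p"
    by (rule Quotient3_rep_abs[OF Quotient3_uea]) 
      (use two_sided_ideal_ideal_generated in \<open>auto simp: uea_rel_def two_sided_ideal_def\<close>)
  then have "free_act scale \<rho> (rep_uea (abs_uea p) - p) v = 0"
    unfolding uea_rel_def using free_act_ideal assms by blast
  then show ?thesis by (simp add: uea_act_def free_act_diff)
qed

lemma uea_act_gen: "v \<in> V \<Longrightarrow> uea_act scale \<rho> (uea_gen x) v = \<rho> x v"
  by (simp add: uea_gen.abs_eq uea_act_abs free_act_gen)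

lemma uea_act_scaleC: "v \<in> V \<Longrightarrow> uea_act scale \<rho> (c *\<^sub>C u) v = scale c (uea_act scale \<rho> u v)"
  by (induction u rule: uea.abs_induct) (simp add: scaleC_uea.abs_eq uea_act_abs free_act_scale)

sublocale uea: left_module "uea_act scale \<rho>" V
proof
  show "0 \<in> V" by (rule subspace_0[OF subspace_V])
  show "v + w \<in> V" if "v \<in> V" "w \<in> V" for v w using that by (rule subspace_add[OF subspace_V])
  show "- v \<in> V" if "v \<in> V" for v using that by (rule subspace_neg[OF subspace_V])
  show "uea_act scale \<rho> a v \<in> V" if "v \<in> V" for a v
    using that by (simp add: uea_act_def free_act_closed)
  show "uea_act scale \<rho> a (v + w) = uea_act scale \<rho> a v + uea_act scale \<rho> a w"
    if "v \<in> V" "w \<in> V" for a v w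
    using that by (simp add: uea_act_def free_act_add_right)
  show "uea_act scale \<rho> (a + b) v = uea_act scale \<rho> a v + uea_act scale \<rho> b v" if "v \<in> V" for a b v
    using that
    by (induction a rule: uea.abs_induct; induction b rule: uea.abs_induct)
      (simp add: plus_uea.abs_eq uea_act_abs free_act_add)
  show "uea_act scale \<rho> (a * b) v = uea_act scale \<rho> a (uea_act scale \<rho> b v)" if "v \<in> V" for a b v
    using that
    by (induction a rule: uea.abs_induct; induction b rule: uea.abs_induct)
      (simp add: times_uea.abs_eq uea_act_abs free_act_mult free_act_closed)
  show "uea_act scale \<rho> 1 v = v" if "v \<in> V" for v
    using that by (simp add: one_uea.abs_eq uea_act_abs free_act_one)
qed

end

lemma (in simple_lie_module) simple_uea_module: "simple_left_module (uea_act scale \<rho>) V"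
proof
  show "V \<noteq> {0}" by (rule nonzero)
  fix W assume W: "W \<subseteq> V" "0 \<in> W" "\<And>v w. v \<in> W \<Longrightarrow> w \<in> W \<Longrightarrow> v + w \<in> W"
    "\<And>a v. v \<in> W \<Longrightarrow> uea_act scale \<rho> a v \<in> W"
  show "W = {0} \<or> W = V"
  proof (rule simple)
    show "subspace W"
    proof (rule subspaceI)
      show "scale c v \<in> W" if "v \<in> W" for c v
        using W(1) W(4)[OF that, of "c *\<^sub>C 1"] that uea_act_scaleC[of v c 1] uea.act_one[of v]
        by auto
    qed (use W in auto)
    show "\<rho> x v \<in> W" if "v \<in> W" for x v
      using W(1) W(4)[OF that, of "uea_gen x"] that uea_act_gen[of v x] by auto
  qed (rule W(1))
qed

lemma uea_lift_hom:
  fixes \<phi> :: "'g::complex_lie_algebra \<Rightarrow> 'a::complex_algebra_1"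
  assumes "\<And>x y. \<phi> (x + y) = \<phi> x + \<phi> y" "\<And>c x. \<phi> (c *\<^sub>C x) = c *\<^sub>C \<phi> x"
    and "\<And>x y. \<phi> (lie_bracket x y) = \<phi> x * \<phi> y - \<phi> y * \<phi> x"
  shows "uea_lift \<phi> (uea_gen x) = \<phi> x"
    and "uea_lift \<phi> 1 = 1"
    and "uea_lift \<phi> (u + v) = uea_lift \<phi> u + uea_lift \<phi> v"
    and "uea_lift \<phi> (c *\<^sub>C u) = c *\<^sub>C uea_lift \<phi> u"
    and "uea_lift \<phi> (u * v) = uea_lift \<phi> u * uea_lift \<phi> v"
proof -
  interpret lie_module scaleC "\<lambda>x (a::'a). \<phi> x * a" UNIV
    by unfold_locales
      (simp_all add: assms algebra_simps mult_scaleC_left mult_scaleC_right)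
  have assoc: "free_act scaleC (\<lambda>x a. \<phi> x * a) p (a * b) = free_act scaleC (\<lambda>x a. \<phi> x * a) p a * b" for p a b
  proof -
    have "foldr (\<lambda>x a. \<phi> x * a) ws (a * b) = foldr (\<lambda>x a. \<phi> x * a) ws a * b" for ws
      by (induction ws) (simp_all add: mult.assoc)
    then show ?thesis by (simp add: free_act_def sum_distrib_right mult_scaleC_left)
  qed
  show "uea_lift \<phi> (uea_gen x) = \<phi> x" by (simp add: uea_lift_def uea_act_gen)
  show "uea_lift \<phi> 1 = 1" by (simp add: uea_lift_def uea.act_one)
  show "uea_lift \<phi> (u + v) = uea_lift \<phi> u + uea_lift \<phi> v" by (simp add: uea_lift_def uea.act_add_left)
  show "uea_lift \<phi> (c *\<^sub>C u) = c *\<^sub>C uea_lift \<phi> u" by (simp add: uea_lift_def uea_act_scaleC)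
  show "uea_lift \<phi> (u * v) = uea_lift \<phi> u * uea_lift \<phi> v"
  proof -
    let ?\<rho> = "\<lambda>x a. \<phi> x * a"
    have "uea_lift \<phi> (u * v) = uea_act scaleC ?\<rho> u (uea_act scaleC ?\<rho> v 1)"
      unfolding uea_lift_def by (rule uea.act_mult) simp
    also have "\<dots> = free_act scaleC ?\<rho> (rep_uea u) (1 * uea_lift \<phi> v)"
      unfolding uea_act_def[of _ _ u] uea_lift_def by simp
    also have "\<dots> = free_act scaleC ?\<rho> (rep_uea u) 1 * uea_lift \<phi> v" by (rule assoc)
    also have "\<dots> = uea_lift \<phi> u * uea_lift \<phi> v"
      unfolding uea_lift_def[of _ u] uea_act_def[of _ _ u] ..
    finally show ?thesis .
  qed
qed


section \<open>The Takiff Lie algebra of \<open>sl2\<close>\<close>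

text \<open>Coordinates with respect to the standard basis: \<open>Sl2 a b c\<close> is \<open>a e + b h + c f\<close>.\<close>

datatype sl2 = Sl2 (coeff_e: complex) (coeff_h: complex) (coeff_f: complex)

definition sl2_e :: sl2 where "sl2_e = Sl2 1 0 0"
definition sl2_h :: sl2 where "sl2_h = Sl2 0 1 0"
definition sl2_f :: sl2 where "sl2_f = Sl2 0 0 1"

instantiation sl2 :: complex_lie_algebra
begin

definition "0 = Sl2 0 0 0"
definition "x + y = Sl2 (coeff_e x + coeff_e y) (coeff_h x + coeff_h y) (coeff_f x + coeff_f y)"
definition "- x = Sl2 (- coeff_e x) (- coeff_h x) (- coeff_f x)"
definition "x - y = Sl2 (coeff_e x - coeff_e y) (coeff_h x - coeff_h y) (coeff_f x - coeff_f y)"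
definition "c *\<^sub>C x = Sl2 (c * coeff_e x) (c * coeff_h x) (c * coeff_f x)"
definition "lie_bracket x y =
  Sl2 (2 * (coeff_h x * coeff_e y - coeff_e x * coeff_h y))
      (coeff_e x * coeff_f y - coeff_f x * coeff_e y)
      (2 * (coeff_f x * coeff_h y - coeff_h x * coeff_f y))"

instance
  by standard
    (auto simp: zero_sl2_def plus_sl2_def uminus_sl2_def minus_sl2_def scaleC_sl2_def
      lie_bracket_sl2_def algebra_simps intro: sl2.expand)

end

lemmas sl2_simps = zero_sl2_def plus_sl2_def uminus_sl2_def minus_sl2_def scaleC_sl2_def
  lie_bracket_sl2_def

lemma sl2_basis: "x = coeff_e x *\<^sub>C sl2_e + coeff_h x *\<^sub>C sl2_h + coeff_f x *\<^sub>C sl2_f"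
  by (cases x) (simp add: sl2_simps sl2_e_def sl2_h_def sl2_f_def)

lemma sl2_brackets:
  "lie_bracket sl2_e sl2_f = sl2_h"
  "lie_bracket sl2_h sl2_e = 2 *\<^sub>C sl2_e"
  "lie_bracket sl2_h sl2_f = - (2 *\<^sub>C sl2_f)"
  by (simp_all add: sl2_simps sl2_e_def sl2_h_def sl2_f_def)

text \<open>
  As \<open>1, t\<close> is a basis of \<open>D = \<complex>[t]/(t\<^sup>2)\<close>, elements of \<open>g \<otimes> D\<close> have the unique
  form \<open>x \<otimes> 1 + y \<otimes> t\<close>, which is written \<open>Takiff x y\<close>.
\<close>

datatype 'g takiff = Takiff (part_1: 'g) (part_t: 'g)

instantiation takiff :: (complex_lie_algebra) complex_lie_algebra
begin

definition "0 = Takiff 0 0"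
definition "x + y = Takiff (part_1 x + part_1 y) (part_t x + part_t y)"
definition "- x = Takiff (- part_1 x) (- part_t x)"
definition "x - y = Takiff (part_1 x - part_1 y) (part_t x - part_t y)"
definition "c *\<^sub>C x = Takiff (c *\<^sub>C part_1 x) (c *\<^sub>C part_t x)"
definition "lie_bracket x y =
  Takiff (lie_bracket (part_1 x) (part_1 y))
    (lie_bracket (part_1 x) (part_t y) + lie_bracket (part_t x) (part_1 y))"

lemmas takiff_simps = zero_takiff_def plus_takiff_def uminus_takiff_def minus_takiff_def
  scaleC_takiff_def lie_bracket_takiff_def

lemma lie_bracket_antisym: "lie_bracket x y = - lie_bracket y (x::'g::complex_lie_algebra)"
proof -
  have "0 = lie_bracket (x + y) (x + y)" by (simp only: lie_bracket_self)
  also have "\<dots> = lie_bracket x y + lie_bracket y x"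
    by (simp only: lie_bracket_add_left lie_bracket_add_right) (simp add: lie_bracket_self)
  finally show ?thesis by (metis eq_neg_iff_add_eq_0)
qed

instance
proof
  fix x y z :: "'a takiff"
  show "lie_bracket x x = 0"
    using lie_bracket_antisym[of "part_1 x" "part_t x"] by (simp add: takiff_simps lie_bracket_self)
  let ?J = "\<lambda>x y z :: 'a. lie_bracket x (lie_bracket y z) + lie_bracket y (lie_bracket z x)
      + lie_bracket z (lie_bracket x y)"
  have "lie_bracket x (lie_bracket y z) + lie_bracket y (lie_bracket z x)
      + lie_bracket z (lie_bracket x y) =
    Takiff (?J (part_1 x) (part_1 y) (part_1 z))
      (?J (part_t x) (part_1 y) (part_1 z) + ?J (part_1 x) (part_t y) (part_1 z)
        + ?J (part_1 x) (part_1 y) (part_t z))"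
    by (simp only: takiff_simps takiff.sel lie_bracket_add_right takiff.inject ac_simps)
  then show "lie_bracket x (lie_bracket y z) + lie_bracket y (lie_bracket z x)
      + lie_bracket z (lie_bracket x y) = 0"
    by (simp only: lie_bracket_jacobi) (simp add: takiff_simps)
qed (auto simp: takiff_simps algebra_simps scaleC_add_left scaleC_add_right scaleC_scaleC scaleC_one
      lie_bracket_add_left lie_bracket_add_right lie_bracket_scaleC_left lie_bracket_scaleC_right)

end

type_synonym takiff_sl2 = "sl2 takiff"

text \<open>\<open>tensor_t_power x i\<close> is \<open>x \<otimes> t\<^sup>i\<close>.\<close>

definition tensor_t_power :: "'g::complex_lie_algebra \<Rightarrow> nat \<Rightarrow> 'g takiff" where
  "tensor_t_power x i = (if i = 0 then Takiff x 0 else if i = 1 then Takiff 0 x else 0)"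

lemma lie_bracket_tensor_t_power:
  "lie_bracket (tensor_t_power x i) (tensor_t_power y j) = tensor_t_power (lie_bracket x y) (i + j)"
proof -
  have "lie_bracket 0 z = 0" "lie_bracket z 0 = 0" for z :: 'a
    using lie_bracket_add_left[of 0 0 z] lie_bracket_add_right[of z 0 0] by simp_all
  then show ?thesis by (auto simp: tensor_t_power_def takiff_simps)
qed

text \<open>Generators of \<open>U(g \<otimes> D)\<close>: \<open>\<iota> x\<close> is \<open>x \<otimes> 1\<close> and \<open>\<iota>\<^sub>t x\<close> is \<open>x \<otimes> t\<close>.\<close>

abbreviation gen_1 :: "'g::complex_lie_algebra \<Rightarrow> 'g takiff uea"  (\<open>\<iota>\<close>) where
  "\<iota> x \<equiv> uea_gen (Takiff x 0)"

abbreviation gen_t :: "'g::complex_lie_algebra \<Rightarrow> 'g takiff uea"  (\<open>\<iota>\<^sub>t\<close>) where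
  "\<iota>\<^sub>t x \<equiv> uea_gen (Takiff 0 x)"

definition uea_incl :: "'g::complex_lie_algebra uea \<Rightarrow> 'g takiff uea" where
  "uea_incl = uea_lift \<iota>"

lemma uea_incl_hom:
  fixes x :: "'a::complex_lie_algebra" and u v :: "'a uea"
  shows "uea_incl (uea_gen x) = \<iota> x"
    and "uea_incl (1 :: 'a uea) = 1"
    and "uea_incl (u + v) = uea_incl u + uea_incl v"
    and "uea_incl (c *\<^sub>C u) = c *\<^sub>C uea_incl u"
    and "uea_incl (u * v) = uea_incl u * uea_incl v"
proof -
  have 0: "lie_bracket 0 z = 0" "lie_bracket z 0 = 0" for z :: 'a
    using lie_bracket_add_left[of 0 0 z] lie_bracket_add_right[of z 0 0] by simp_all
  have 1: "\<iota> (x + y) = \<iota> x + \<iota> y" for x y :: 'a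
    by (simp add: takiff_simps flip: uea_gen_add)
  have 2: "\<iota> (c *\<^sub>C x) = c *\<^sub>C \<iota> x" for c and x :: 'a
    by (simp add: takiff_simps flip: uea_gen_scaleC)
  have 3: "\<iota> (lie_bracket x y) = \<iota> x * \<iota> y - \<iota> y * \<iota> x" for x y :: 'a
    by (simp add: takiff_simps 0 flip: uea_gen_bracket)
  note hom = uea_lift_hom[of "\<iota> :: 'a \<Rightarrow> _", OF 1 2 3, folded uea_incl_def]
  show "uea_incl (uea_gen x) = \<iota> x" "uea_incl (1 :: 'a uea) = 1"
    "uea_incl (u + v) = uea_incl u + uea_incl v" "uea_incl (c *\<^sub>C u) = c *\<^sub>C uea_incl u"
    "uea_incl (u * v) = uea_incl u * uea_incl v"
    by (rule hom)+
qed

definition takiff_C :: "takiff_sl2 uea" where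
  "takiff_C = \<iota>\<^sub>t sl2_h * \<iota> sl2_h + 2 * \<iota>\<^sub>t sl2_f * \<iota> sl2_e + 2 * \<iota>\<^sub>t sl2_e * \<iota> sl2_f"

definition takiff_C_bar :: "takiff_sl2 uea" where
  "takiff_C_bar = (\<iota>\<^sub>t sl2_h)\<^sup>2 + 4 * \<iota>\<^sub>t sl2_f * \<iota>\<^sub>t sl2_e"

definition sl2_casimir :: "sl2 uea" where
  "sl2_casimir = (uea_gen sl2_h + 1)\<^sup>2 + 4 * uea_gen sl2_f * uea_gen sl2_e"


section \<open>Finite-dimensional simple modules and the ideals\<close>

text \<open>
  \<open>L(n)\<close> is realised on the polynomials \<open>p\<close> of degree at most \<open>n\<close> (dehomogenised binary forms),
  with \<open>e p = p'\<close>, \<open>h p = n p - 2 X p'\<close>, \<open>f p = n X p - X\<^sup>2 p'\<close>; the highest weight vector is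
  the constant \<open>1\<close>.
\<close>

definition L_carrier :: "nat \<Rightarrow> complex poly set" where
  "L_carrier n = {p. degree p \<le> n}"

definition L_act :: "nat \<Rightarrow> sl2 \<Rightarrow> complex poly \<Rightarrow> complex poly" where
  "L_act n x p =
     smult (coeff_e x) (pderiv p) +
     smult (coeff_h x) (of_nat n * p - 2 * [:0, 1:] * pderiv p) +
     smult (coeff_f x) (of_nat n * [:0, 1:] * p - [:0, 1:]\<^sup>2 * pderiv p)"


lemma L_act_basis:
  "L_act n sl2_e p = pderiv p"
  "L_act n sl2_h p = of_nat n * p - 2 * [:0, 1:] * pderiv p"
  "L_act n sl2_f p = of_nat n * [:0, 1:] * p - [:0, 1:]\<^sup>2 * pderiv p"
  by (simp_all add: L_act_def sl2_e_def sl2_h_def sl2_f_def)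

lemma L_highest_weight: "L_act n sl2_e 1 = 0" "L_act n sl2_h 1 = smult (of_nat n) 1"
  by (simp_all add: L_act_basis pderiv_1 of_nat_poly)

lemma coeff_L_act:
  "coeff (L_act n x p) i =
     coeff_e x * (of_nat (Suc i) * coeff p (Suc i)) +
     coeff_h x * ((of_nat n - 2 * of_nat i) * coeff p i) +
     coeff_f x * (case i of 0 \<Rightarrow> 0 | Suc j \<Rightarrow> (of_nat n - of_nat j) * coeff p j)"
proof -
  have "L_act n x p = smult (coeff_e x) (pderiv p)
      + smult (coeff_h x) (smult (of_nat n) p - smult 2 (pCons 0 (pderiv p)))
      + smult (coeff_f x) (smult (of_nat n) (pCons 0 p) - pCons 0 (pCons 0 (pderiv p)))"
    by (simp add: L_act_def power2_eq_square numeral_poly of_nat_poly)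
  then show ?thesis
    by (auto simp: coeff_pCons coeff_pderiv algebra_simps split: nat.split)
qed

lemma vector_space_smult: "vector_space (smult :: complex \<Rightarrow> complex poly \<Rightarrow> complex poly)"
  by unfold_locales (simp_all add: smult_add_right smult_add_left)

lemma simple_lie_module_L: "simple_lie_module smult (L_act n) (L_carrier n)"
proof -
  interpret vector_space "smult :: complex \<Rightarrow> complex poly \<Rightarrow> complex poly"
    by (rule vector_space_smult)
  have L_iff: "p \<in> L_carrier n \<longleftrightarrow> (\<forall>i>n. coeff p i = 0)" for p
    by (auto simp: L_carrier_def coeff_eq_0 intro: degree_le)
  interpret lie_module smult "L_act n" "L_carrier n"
  proof
    show "subspace (L_carrier n)"
      by (rule subspaceI) (auto simp: L_iff)
    show "L_act n x p \<in> L_carrier n" if "p \<in> L_carrier n" for x p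
      using that unfolding L_iff by (auto simp: coeff_L_act split: nat.split) (metis not_less_less_Suc_eq right_minus_eq)
    show "L_act n x (p + q) = L_act n x p + L_act n x q" for x p q
      by (rule poly_eqI) (simp add: coeff_L_act algebra_simps split: nat.split)
    show "L_act n x (smult c p) = smult c (L_act n x p)" for x p c
      by (rule poly_eqI) (simp add: coeff_L_act algebra_simps split: nat.split)
    show "L_act n (x + y) p = L_act n x p + L_act n y p" for x y p
      by (rule poly_eqI) (simp add: coeff_L_act sl2_simps algebra_simps)
    show "L_act n (c *\<^sub>C x) p = smult c (L_act n x p)" for x p c
      by (rule poly_eqI) (simp add: coeff_L_act sl2_simps algebra_simps)
    show "L_act n (lie_bracket x y) p = L_act n x (L_act n y p) - L_act n y (L_act n x p)" for x y p
    proof (rule poly_eqI)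
      fix i
      consider "i = 0" | "i = 1" | k where "i = Suc (Suc k)"
        by (metis One_nat_def not0_implies_Suc)
      then show "coeff (L_act n (lie_bracket x y) p) i =
          coeff (L_act n x (L_act n y p) - L_act n y (L_act n x p)) i"
        by cases (simp_all add: coeff_L_act sl2_simps algebra_simps)
    qed
  qed
  show ?thesis
  proof
    have "1 \<in> L_carrier n" by (simp add: L_carrier_def)
    then show "L_carrier n \<noteq> {0}" by auto
    fix W assume W: "subspace W" "W \<subseteq> L_carrier n" "\<And>x v. v \<in> W \<Longrightarrow> L_act n x v \<in> W"
    show "W = {0} \<or> W = L_carrier n"
    proof (cases "W = {0}")
      case False
      then obtain p where p: "p \<in> W" "p \<noteq> 0" using subspace_0[OF W(1)] by blast
      have "\<exists>q\<in>W. q \<noteq> 0 \<and> degree q = 0"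
        using p
      proof (induction "degree p" arbitrary: p)
        case (Suc d)
        have "pderiv p \<in> W" using W(3)[OF Suc(3), of sl2_e] by (simp add: L_act_basis)
        moreover have "degree (pderiv p) = d" using Suc(2) by (simp add: degree_pderiv)
        moreover have "pderiv p \<noteq> 0" using Suc(2) by (simp add: pderiv_eq_0_iff)
        ultimately show ?case using Suc(1)[of "pderiv p"] by simp
      qed auto
      then obtain c where c: "[:c:] \<in> W" "c \<noteq> 0" by (metis degree_eq_zeroE pCons_0_0)
      have X: "monom 1 i \<in> W" if "i \<le> n" for i
        using that
      proof (induction i)
        case 0
        have "smult (1 / c) [:c:] \<in> W" using c W(1) by (intro subspace_scale)
        then show ?case using c by (simp add: monom_0)
      next
        case (Suc i)
        have "L_act n sl2_f (monom 1 i) = smult (of_nat n - of_nat i) (monom 1 (Suc i))"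
          by (rule poly_eqI) (auto simp: coeff_L_act sl2_f_def split: nat.split)
        then have "smult (of_nat n - of_nat i) (monom 1 (Suc i)) \<in> W"
          using W(3)[of "monom 1 i" sl2_f] Suc by simp
        moreover define d where "d = (of_nat n - of_nat i :: complex)"
        ultimately have "smult (1 / d) (smult d (monom 1 (Suc i))) \<in> W"
          using subspace_scale[OF W(1), of "smult d (monom 1 (Suc i))" "1 / d"] by blast
        moreover have "d \<noteq> 0" using Suc by (simp add: d_def)
        ultimately show ?case by simp
      qed
      have "q \<in> W" if "q \<in> L_carrier n" for q
      proof -
        have "(\<Sum>i\<le>degree q. smult (coeff q i) (monom 1 i)) \<in> W"
          using that X W(1) by (intro subspace_sum subspace_scale) (auto simp: L_carrier_def)
        then show ?thesis using poly_as_sum_of_monoms[of q] by (simp add: smult_monom)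
      qed
      then show ?thesis using W(2) by blast
    qed simp
  qed
qed

definition ann_L :: "nat \<Rightarrow> sl2 uea set" where
  "ann_L n = annihilator (uea_act smult (L_act n)) (L_carrier n)"

definition ideal_I :: "complex \<Rightarrow> complex \<Rightarrow> takiff_sl2 uea set" where
  "ideal_I \<chi> \<theta> = ideal_generated {takiff_C - \<theta> *\<^sub>C 1, takiff_C_bar - \<chi> *\<^sub>C 1}"

definition ideal_fI :: "complex \<Rightarrow> takiff_sl2 uea set" where
  "ideal_fI \<mu> = ideal_generated (insert (uea_incl sl2_casimir - (\<mu> + 1)\<^sup>2 *\<^sub>C 1) (range \<iota>\<^sub>t))"

definition ideal_fF :: "nat \<Rightarrow> takiff_sl2 uea set" where
  "ideal_fF n = ideal_generated (uea_incl ` ann_L n \<union> range \<iota>\<^sub>t)"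

end

theory Submission
  imports Defs "HOL-Library.Function_Algebras" "HOL-Analysis.Continuum_Not_Denumerable"
    "HOL-Computational_Algebra.Fundamental_Theorem_Algebra"
begin

text \<open>
  Write \<open>E, H, F\<close> for \<open>e \<otimes> t, h \<otimes> t, f \<otimes> t\<close>.  All three parts rest on the two-sided ideals \<open>J\<close> that
  contain \<open>I = I(\<chi>, \<theta>)\<close> properly.  Filter the enveloping algebra by the number of factors \<open>e, h, f\<close>.
  Commutators with \<open>E\<close> and \<open>H\<close> lower this number, and for \<open>u\<close> of degree \<open>d\<close> the combination
  \<open>[H, u] e - [E, u] h\<close> equals \<open>2 d E u\<close> modulo \<open>I\<close> and lower terms (\<open>euler_degree\<close>).  Hence an element
  of \<open>J - I\<close> of least degree either is a polynomial in \<open>E, H, F\<close>, or satisfies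
  \<open>E u, H u, F u \<in> I\<close> (\<open>ideal_dichotomy\<close>).  In the first case weights under \<open>ad h\<close> and commutators
  with \<open>e\<close> produce a power of \<open>E\<close> in \<open>J\<close> (\<open>level_1_power_in_ideal\<close>).

  If \<open>\<chi>\<close> or \<open>\<theta>\<close> is non-zero, the second case is impossible because \<open>\<chi> u\<close> and \<open>\<theta> u\<close> lie in \<open>I\<close>
  (\<open>bar_annihilated\<close>), and in the first case commutators with \<open>f\<close> lower the power of \<open>E\<close> down to
  \<open>1 \<in> J\<close> (\<open>E_power_descent\<close>).  So \<open>I\<close> is a maximal ideal, and (a) follows.

  For \<open>\<chi> = \<theta> = 0\<close> the quotient by \<open>I(0, 0)\<close> acts faithfully on Laurent series in two variables,
  with \<open>E, H, F\<close> multiplication by \<open>x\<^sup>2, - 2 x y, - y\<^sup>2\<close> (\<open>annihilator_laurent\<close>: a spanning set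
  of the quotient acts linearly independently).  As \<open>E\<close> is invertible there, the second
  case is impossible again, and every ideal strictly above \<open>I(0, 0)\<close> contains a power of \<open>E\<close>
  (\<open>above_ideal_I_00\<close>).  For (c) it is therefore enough to have a simple submodule of the Laurent
  series on which \<open>E\<close> is not nilpotent: the submodule generated by a delta function at \<open>x = 1\<close>
  (\<open>simple_delta_module\<close>).

  For (b), the Casimir element of \<open>sl2\<close> acts on \<open>V\<close> by a scalar \<open>(\<mu> + 1)\<^sup>2\<close>
  (\<open>central_acts_by_scalar\<close>), which does not happen modulo \<open>I(0, 0)\<close>.  So a power of \<open>E\<close> kills \<open>V\<close>,
  and then \<open>E, H, F\<close> kill \<open>V\<close> (\<open>bar_acts_by_zero\<close>), since the vectors killed by them form a non-zero
  submodule.  If the annihilator is larger than the ideal of \<open>\<mu>\<close>, then the weight argument, applied to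
  \<open>e, h, f\<close>, puts a power of \<open>e\<close> into it (\<open>above_ideal_fI\<close>); hence \<open>V\<close> has a highest weight vector of
  weight \<open>n \<in> \<nat>\<close>, and the annihilator is that of \<open>L(n)\<close>.
\<close>

section \<open>Two-sided ideals and polynomials in an element\<close>

lemma ideal_zero: "two_sided_ideal J \<Longrightarrow> 0 \<in> J"
  and ideal_add: "two_sided_ideal J \<Longrightarrow> a \<in> J \<Longrightarrow> b \<in> J \<Longrightarrow> a + b \<in> J"
  and ideal_lmult: "two_sided_ideal J \<Longrightarrow> a \<in> J \<Longrightarrow> r * a \<in> J"
  and ideal_rmult: "two_sided_ideal J \<Longrightarrow> a \<in> J \<Longrightarrow> a * r \<in> J"
  unfolding two_sided_ideal_def by blast+

lemma ideal_scaleC: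
  fixes J :: "'a::complex_algebra_1 set"
  assumes "two_sided_ideal J" "a \<in> J"
  shows "c *\<^sub>C a \<in> J"
  using ideal_lmult[OF assms, of "c *\<^sub>C 1"] by (simp add: mult_scaleC_left)

lemma ideal_scaleC_iff:
  fixes J :: "'a::complex_algebra_1 set"
  assumes "two_sided_ideal J" "c \<noteq> 0"
  shows "c *\<^sub>C a \<in> J \<longleftrightarrow> a \<in> J"
  using ideal_scaleC[OF assms(1), of "c *\<^sub>C a" "1 / c"] ideal_scaleC[OF assms(1)] assms(2)
  by (auto simp: scaleC_scaleC scaleC_one)

lemma ideal_sum: "two_sided_ideal J \<Longrightarrow> (\<And>k. k \<in> K \<Longrightarrow> u k \<in> J) \<Longrightarrow> sum u K \<in> J"
  by (induction K rule: infinite_finite_induct) (auto intro: ideal_zero ideal_add)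

lemma ideal_commutator: "two_sided_ideal J \<Longrightarrow> a \<in> J \<Longrightarrow> r * a - a * r \<in> J"
  by (intro ideal_diff ideal_lmult ideal_rmult)

lemma ideal_cong: "two_sided_ideal J \<Longrightarrow> a - b \<in> J \<Longrightarrow> a \<in> J \<longleftrightarrow> b \<in> J"
  using ideal_add[of J "a - b" b] ideal_diff[of J a "a - b"] by auto

lemma ideal_trans: "two_sided_ideal J \<Longrightarrow> a - b \<in> J \<Longrightarrow> b - c \<in> J \<Longrightarrow> a - c \<in> J"
  using ideal_add[of J "a - b" "b - c"] by simp

lemma ideal_cong_mult:
  "two_sided_ideal J \<Longrightarrow> a - b \<in> J \<Longrightarrow> l * a * r - l * b * r \<in> J"
  using ideal_rmult[OF _ ideal_lmult, of J "a - b" l r] by (simp add: algebra_simps)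

lemma numeral_scaleC: "numeral n * (a :: 'a::complex_algebra_1) = numeral n *\<^sub>C a"
proof (induction n)
  case One show ?case by (simp add: scaleC_one)
next
  case (Bit0 n) then show ?case by (simp only: numeral_Bit0 distrib_right scaleC_add_left)
next
  case (Bit1 n)
  then show ?case
    by (simp only: numeral_Bit1 distrib_right scaleC_add_left scaleC_one mult_1_left)
qed

lemma minus_scaleC: "(- c) *\<^sub>C (a :: 'a::complex_vector) = - (c *\<^sub>C a)"
  by (rule complex_vector.scale_minus_left)

definition poly_at :: "complex poly \<Rightarrow> 'a::complex_algebra_1 \<Rightarrow> 'a" where
  "poly_at p z = fold_coeffs (\<lambda>a r. a *\<^sub>C 1 + z * r) p 0"

lemma poly_at_0: "poly_at 0 z = 0"
  by (simp add: poly_at_def)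

lemma poly_at_pCons: "poly_at (pCons a p) z = a *\<^sub>C 1 + z * poly_at p z"
  by (cases "p = 0 \<and> a = 0") (auto simp: poly_at_def)

lemma poly_at_1: "poly_at 1 z = 1"
  by (simp add: one_pCons poly_at_pCons poly_at_0 scaleC_one)

lemma poly_at_const: "poly_at [:c:] z = c *\<^sub>C 1"
  by (simp add: poly_at_pCons poly_at_0)

lemma poly_at_add: "poly_at (p + q) z = poly_at p z + poly_at q z"
  by (induction p q rule: poly_induct2)
    (simp_all add: poly_at_0 poly_at_pCons scaleC_add_left algebra_simps)

lemma poly_at_smult: "poly_at (smult c p) z = c *\<^sub>C poly_at p z"
  by (induction p) (simp_all add: poly_at_0 poly_at_pCons scaleC_add_right scaleC_scaleC mult_scaleC_right)

lemma poly_at_diff: "poly_at (p - q) z = poly_at p z - poly_at q z"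
  using poly_at_add[of "p - q" q z] by simp

lemma poly_at_mult: "poly_at (p * q) z = poly_at p z * poly_at q z"
  by (induction p)
    (simp_all add: poly_at_0 poly_at_pCons poly_at_add poly_at_smult algebra_simps
      mult_scaleC_left scaleC_one)

lemma poly_at_commute: "a * z = z * a \<Longrightarrow> a * poly_at p z = poly_at p z * a"
  by (induction p)
    (simp_all add: poly_at_0 poly_at_pCons distrib_left distrib_right mult_scaleC_left
      mult_scaleC_right mult.assoc, metis mult.assoc)

lemma poly_at_shift:
  assumes "z * x - x * z = s *\<^sub>C x"
  shows "poly_at p z * x = x * poly_at (pcompose p [:s, 1:]) z"
proof (induction p)
  case (pCons a p)
  have zx: "z * x = x * z + s *\<^sub>C x"
    using assms by (simp add: algebra_simps)
  have "z * poly_at p z * x = z * x * poly_at (pcompose p [:s, 1:]) z"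
    by (simp add: mult.assoc pCons)
  then show ?case
    by (simp add: poly_at_pCons pcompose_pCons poly_at_add poly_at_mult poly_at_const poly_at_1 zx
        poly_at_smult poly_at_0 distrib_left distrib_right mult_scaleC_left mult_scaleC_right mult.assoc)
qed (simp add: poly_at_0)

text \<open>Subtracting \<open>c m\<close> times the sum from its image under \<open>ad D\<close> removes the component \<open>u m\<close> and
  rescales the others by non-zero factors, which allows an induction on their number.\<close>

lemma ideal_eigencomponents:
  fixes J :: "'a::complex_algebra_1 set"
  assumes J: "two_sided_ideal J" and "finite K" "inj_on c K"
    and "\<And>k. k \<in> K \<Longrightarrow> D * u k - u k * D = c k *\<^sub>C u k"
    and "sum u K \<in> J" "k \<in> K"
  shows "u k \<in> J"
  using assms(2-)
proof (induction K arbitrary: u k rule: finite_induct)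
  case (insert m K)
  let ?w = "\<lambda>k. (c k - c m) *\<^sub>C u k"
  have "D * sum u (insert m K) - sum u (insert m K) * D - c m *\<^sub>C sum u (insert m K) \<in> J"
    by (intro ideal_diff[OF J] ideal_scaleC[OF J] ideal_lmult[OF J] ideal_rmult[OF J] insert.prems)
  also have "D * sum u (insert m K) - sum u (insert m K) * D - c m *\<^sub>C sum u (insert m K)
      = (\<Sum>k\<in>insert m K. (D * u k - u k * D) - c m *\<^sub>C u k)"
    by (simp only: sum_distrib_left sum_distrib_right sum_subtractf complex_vector.scale_sum_right)
  also have "\<dots> = sum ?w (insert m K)"
    using insert.prems(2) by (intro sum.cong) (auto simp: complex_vector.scale_left_diff_distrib)
  also have "\<dots> = sum ?w K"
    using insert.hyps by simp
  finally have w: "sum ?w K \<in> J" .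
  have "?w k \<in> J" if "k \<in> K" for k
  proof (rule insert.IH[OF _ _ w that])
    show "inj_on c K" using insert.prems by (meson inj_on_subset subset_insertI)
    show "D * ?w l - ?w l * D = c l *\<^sub>C ?w l" if "l \<in> K" for l
      using insert.prems(2)[of l] that
      by (simp add: mult_scaleC_left mult_scaleC_right scaleC_scaleC mult.commute
          flip: complex_vector.scale_right_diff_distrib)
  qed
  moreover have "c k \<noteq> c m" if "k \<in> K" for k
    using that insert.prems(1) insert.hyps by (auto simp: inj_on_def)
  ultimately have in_J: "u k \<in> J" if "k \<in> K" for k
    using that ideal_scaleC_iff[OF J, of "c k - c m" "u k"] by auto
  have "sum u (insert m K) - sum u K \<in> J"
    by (intro ideal_diff[OF J insert.prems(3)] ideal_sum[OF J] in_J)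
  then show ?case using in_J insert.prems(4) insert.hyps by auto
qed simp


section \<open>Weight vectors in ideals of generalised Weyl algebras\<close>

text \<open>
  The subalgebra generated by \<open>E, H, F\<close> and the algebra \<open>U(sl2)\<close> both become, modulo a Casimir
  relation, generalised Weyl algebras: \<open>x\<close> and \<open>y\<close> shift a polynomial in \<open>z\<close>, and \<open>x y\<close>, \<open>y x\<close> are
  themselves polynomials in \<open>z\<close>.  The element \<open>D\<close> is \<open>h\<close> in both cases; it provides a
  grading also when \<open>s = 0\<close>, as for \<open>x, z, y = E, H, F\<close>.
\<close>

locale weyl_generators =
  fixes I :: "'a::complex_algebra_1 set" and x y z D :: 'a and s :: complex and q q' :: "complex poly"
  assumes ideal_I: "two_sided_ideal I"
    and zx: "z * x - x * z = s *\<^sub>C x"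
    and zy: "z * y - y * z = (- s) *\<^sub>C y"
    and xy: "x * y - poly_at q z \<in> I"
    and yx: "y * x - poly_at q' z \<in> I"
    and q_nonzero: "q \<noteq> 0"
    and Dx: "D * x - x * D = 2 *\<^sub>C x"
    and Dy: "D * y - y * D = (- 2) *\<^sub>C y"
    and Dz: "D * z = z * D"
begin

definition x_power :: "int \<Rightarrow> 'a" where
  "x_power k = (if k \<ge> 0 then x ^ nat k else y ^ nat (- k))"

lemma x_power_of_nat: "x_power (int n) = x ^ n" "x_power (- int n) = y ^ n"
  by (auto simp: x_power_def)

lemma x_power_step:
  shows "k \<ge> 0 \<Longrightarrow> x_power (k + 1) = x_power k * x"
    and "k \<le> 0 \<Longrightarrow> x_power (k - 1) = x_power k * y"
proof -
  assume "k \<ge> 0"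
  then obtain n where n: "k = int n" by (metis nonneg_int_cases)
  have "int n + 1 = int (Suc n)" by simp
  then show "x_power (k + 1) = x_power k * x"
    unfolding n by (simp only: x_power_of_nat power_Suc2)
next
  assume "k \<le> 0"
  then obtain n where n: "k = - int n" by (metis nonpos_int_cases)
  have "- int n - 1 = - int (Suc n)" by simp
  then show "x_power (k - 1) = x_power k * y"
    unfolding n by (simp only: x_power_of_nat power_Suc2)
qed

definition graded_forms :: "'a set" where
  "graded_forms = complex_vector.span (I \<union> {x_power k * poly_at p z |k p. True})"

lemma graded_formsI: "u - v \<in> I \<Longrightarrow> v \<in> graded_forms \<Longrightarrow> u \<in> graded_forms"
  unfolding graded_forms_def
  using complex_vector.span_add[OF complex_vector.span_base[of "u - v"], of _ v] by auto

lemma x_power_in: "x_power k * poly_at p z \<in> graded_forms"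
  unfolding graded_forms_def by (rule complex_vector.span_base) blast

lemma one_in_graded_forms: "1 \<in> graded_forms"
  using x_power_in[of 0 1] by (simp add: x_power_def poly_at_1)

lemma graded_forms_add: "u \<in> graded_forms \<Longrightarrow> v \<in> graded_forms \<Longrightarrow> u + v \<in> graded_forms"
  and graded_forms_scaleC: "u \<in> graded_forms \<Longrightarrow> c *\<^sub>C u \<in> graded_forms"
  and ideal_in_graded_forms: "u \<in> I \<Longrightarrow> u \<in> graded_forms"
  unfolding graded_forms_def
  by (auto intro: complex_vector.span_add complex_vector.span_scale complex_vector.span_base)

lemma graded_forms_multI:
  assumes "\<And>k p. x_power k * poly_at p z * a \<in> graded_forms" "u \<in> graded_forms"
  shows "u * a \<in> graded_forms"
  using assms(2) unfolding graded_forms_def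
proof (induction rule: complex_vector.span_induct_alt)
  case base show ?case by (simp add: complex_vector.span_zero)
next
  case (step c v w)
  have "v * a \<in> graded_forms"
    using step(1) assms(1) ideal_in_graded_forms ideal_rmult[OF ideal_I] by blast
  then show ?case
    using graded_forms_add[OF graded_forms_scaleC] step(2)
    by (simp add: distrib_right mult_scaleC_left graded_forms_def)
qed

lemma graded_forms_mult_z: "u \<in> graded_forms \<Longrightarrow> u * z \<in> graded_forms"
proof (rule graded_forms_multI)
  fix k p
  have "poly_at p z * z = poly_at (p * [:0, 1:]) z"
    using poly_at_commute[of z z p] by (simp add: poly_at_pCons scaleC_one)
  then show "x_power k * poly_at p z * z \<in> graded_forms"
    using x_power_in by (simp add: mult.assoc)
qed

lemma graded_forms_mult_x: "u \<in> graded_forms \<Longrightarrow> u * x \<in> graded_forms"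
proof (rule graded_forms_multI)
  fix k p
  let ?p = "pcompose p [:s, 1:]"
  have *: "x_power k * poly_at p z * x = x_power k * x * poly_at ?p z"
    by (simp add: mult.assoc poly_at_shift[OF zx])
  show "x_power k * poly_at p z * x \<in> graded_forms"
  proof (cases "k \<ge> 0")
    case True
    then have "x_power k * x = x_power (k + 1)" by (simp add: x_power_step)
    then show ?thesis using * x_power_in by simp
  next
    case False
    then have k: "x_power k = x_power (k + 1) * y" using x_power_step(2)[of "k + 1"] by simp
    have "x_power (k + 1) * (y * x) * poly_at ?p z - x_power (k + 1) * poly_at q' z * poly_at ?p z \<in> I"
      by (rule ideal_cong_mult[OF ideal_I yx])
    then show ?thesis unfolding * unfolding k
      by (intro graded_formsI[OF _ x_power_in[of "k + 1" "q' * ?p"]]) (simp only: poly_at_mult mult.assoc)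
  qed
qed

lemma graded_forms_mult_y: "u \<in> graded_forms \<Longrightarrow> u * y \<in> graded_forms"
proof (rule graded_forms_multI)
  fix k p
  let ?p = "pcompose p [:- s, 1:]"
  have *: "x_power k * poly_at p z * y = x_power k * y * poly_at ?p z"
    by (simp add: mult.assoc poly_at_shift[OF zy])
  show "x_power k * poly_at p z * y \<in> graded_forms"
  proof (cases "k \<le> 0")
    case True
    then have "x_power k * y = x_power (k - 1)" by (simp add: x_power_step)
    then show ?thesis using * x_power_in by simp
  next
    case False
    then have k: "x_power k = x_power (k - 1) * x" using x_power_step(1)[of "k - 1"] by simp
    have "x_power (k - 1) * (x * y) * poly_at ?p z - x_power (k - 1) * poly_at q z * poly_at ?p z \<in> I"
      by (rule ideal_cong_mult[OF ideal_I xy])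
    then show ?thesis unfolding * unfolding k
      by (intro graded_formsI[OF _ x_power_in[of "k - 1" "q * ?p"]]) (simp only: poly_at_mult mult.assoc)
  qed
qed

lemma graded_forms_decomposition:
  assumes "u \<in> graded_forms"
  shows "\<exists>K p. finite K \<and> u - (\<Sum>k\<in>K. x_power k * poly_at (p k) z) \<in> I"
  using assms unfolding graded_forms_def
proof (induction rule: complex_vector.span_induct_alt)
  case base
  show ?case by (rule exI[of _ "{}"]) (simp add: ideal_zero[OF ideal_I])
next
  case (step c v w)
  then obtain K p where K: "finite K" and w: "w - (\<Sum>k\<in>K. x_power k * poly_at (p k) z) \<in> I"
    by blast
  show ?case
  proof (cases "v \<in> I")
    case True
    have "c *\<^sub>C v + (w - (\<Sum>k\<in>K. x_power k * poly_at (p k) z)) \<in> I"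
      by (intro ideal_add[OF ideal_I] ideal_scaleC[OF ideal_I] True w)
    then show ?thesis using K by (auto simp: add_diff_eq)
  next
    case False
    then obtain m r where v: "v = x_power m * poly_at r z" using step(1) by blast
    define p' where "p' = (\<lambda>k. if k \<in> K then p k else 0)"
    have "(\<Sum>k\<in>K. x_power k * poly_at (p k) z) = (\<Sum>k\<in>insert m K. x_power k * poly_at (p' k) z)"
      using K by (intro sum.mono_neutral_cong_left) (auto simp: p'_def poly_at_0)
    moreover have "c *\<^sub>C v = (\<Sum>k\<in>insert m K. x_power k * poly_at (if k = m then smult c r else 0) z)"
    proof -
      have "(\<Sum>k\<in>insert m K. x_power k * poly_at (if k = m then smult c r else 0) z)
          = (\<Sum>k\<in>insert m K. if k = m then c *\<^sub>C v else 0)"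
        by (intro sum.cong) (auto simp: v poly_at_smult mult_scaleC_right poly_at_0)
      then show ?thesis using K by simp
    qed
    ultimately have eq: "c *\<^sub>C v + w
        - (\<Sum>k\<in>insert m K. x_power k * poly_at ((if k = m then smult c r else 0) + p' k) z)
      = w - (\<Sum>k\<in>K. x_power k * poly_at (p k) z)"
      by (simp only: poly_at_add distrib_left sum.distrib) simp
    show ?thesis
      by (rule exI[of _ "insert m K"], rule exI[of _ "\<lambda>k. (if k = m then smult c r else 0) + p' k"])
        (unfold eq, use K w in simp)
  qed
qed

lemma x_power_weight: "D * x_power k - x_power k * D = (2 * of_int k) *\<^sub>C x_power k"
proof -
  have pow: "D * a ^ n - a ^ n * D = (of_nat n * c) *\<^sub>C a ^ n"
    if a: "D * a - a * D = c *\<^sub>C a" for a c n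
  proof (induction n)
    case (Suc n)
    have "D * a ^ Suc n - a ^ Suc n * D = (D * a - a * D) * a ^ n + a * (D * a ^ n - a ^ n * D)"
      by (simp add: algebra_simps)
    also have "\<dots> = (of_nat (Suc n) * c) *\<^sub>C a ^ Suc n"
      unfolding a Suc by (simp add: mult_scaleC_left mult_scaleC_right distrib_right scaleC_add_left)
    finally show ?case .
  qed simp
  show ?thesis
  proof (cases "k \<ge> 0")
    case True then show ?thesis using pow[OF Dx, of "nat k"] by (simp add: x_power_def mult.commute)
  next
    case False then show ?thesis using pow[OF Dy, of "nat (- k)"] by (simp add: x_power_def mult.commute)
  qed
qed

lemma x_y_power: "\<exists>r. r \<noteq> 0 \<and> x ^ n * y ^ n - poly_at r z \<in> I"
proof (induction n)
  case 0
  show ?case by (intro exI[of _ 1]) (simp add: poly_at_1 ideal_zero[OF ideal_I])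
next
  case (Suc n)
  then obtain r where r: "r \<noteq> 0" "x ^ n * y ^ n - poly_at r z \<in> I" by blast
  let ?r = "pcompose r [:- s, 1:]"
  have "?r \<noteq> 0" using pcompose_eq_0[of r "[:- s, 1:]"] r(1) by auto
  have "x * (x ^ n * y ^ n) * y - x * poly_at r z * y \<in> I"
    by (rule ideal_cong_mult[OF ideal_I r(2)])
  moreover have "x * y * poly_at ?r z - poly_at q z * poly_at ?r z \<in> I"
    using ideal_cong_mult[OF ideal_I xy, of 1] by simp
  ultimately have "x ^ Suc n * y ^ Suc n - poly_at (q * ?r) z \<in> I"
    using ideal_trans[OF ideal_I, of "x ^ Suc n * y ^ Suc n" "x * poly_at r z * y"]
    by (simp add: mult.assoc poly_at_shift[OF zy] poly_at_mult power_commutes)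
  then show ?case using \<open>?r \<noteq> 0\<close> q_nonzero by (intro exI[of _ "q * ?r"]) simp
qed

text \<open>
  Eigencomponents isolate a single term \<open>x_power k * p(z)\<close>; if \<open>k < 0\<close>, multiplication by
  \<open>x\<^bsup>-k\<^esup>\<close> turns it into a non-zero polynomial in \<open>z\<close>.
\<close>

lemma weight_vector_in_ideal:
  assumes J: "two_sided_ideal J" "I \<subseteq> J" and u: "u \<in> graded_forms" "u \<in> J" "u \<notin> I"
  shows "\<exists>k p. p \<noteq> 0 \<and> x ^ k * poly_at p z \<in> J"
proof -
  obtain K p where K: "finite K" and p: "u - (\<Sum>k\<in>K. x_power k * poly_at (p k) z) \<in> I"
    using graded_forms_decomposition[OF u(1)] by blast
  have "(\<Sum>k\<in>K. x_power k * poly_at (p k) z) \<in> J"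
    using p u(2) J ideal_cong[OF J(1)] by blast
  moreover have "D * (x_power k * poly_at (p k) z) - x_power k * poly_at (p k) z * D
      = (2 * of_int k) *\<^sub>C (x_power k * poly_at (p k) z)" for k
  proof -
    have "D * (x_power k * poly_at (p k) z) - x_power k * poly_at (p k) z * D
        = (D * x_power k - x_power k * D) * poly_at (p k) z"
      using poly_at_commute[OF Dz, of "p k"] by (simp add: algebra_simps)
    then show ?thesis by (simp add: x_power_weight mult_scaleC_left)
  qed
  moreover have "inj_on (\<lambda>k. 2 * of_int k :: complex) K"
    by (simp add: inj_on_def)
  ultimately have in_J: "x_power k * poly_at (p k) z \<in> J" if "k \<in> K" for k
    using ideal_eigencomponents[OF J(1) K, of "\<lambda>k. 2 * of_int k" D
        "\<lambda>k. x_power k * poly_at (p k) z" k] that by blast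
  have "(\<Sum>k\<in>K. x_power k * poly_at (p k) z) \<notin> I"
    using p u(3) ideal_cong[OF ideal_I p] by simp
  then obtain k where k: "k \<in> K" "x_power k * poly_at (p k) z \<notin> I"
    using ideal_sum[OF ideal_I, of K "\<lambda>k. x_power k * poly_at (p k) z"] by auto
  then have p0: "p k \<noteq> 0" using ideal_zero[OF ideal_I] by (auto simp: poly_at_0)
  show ?thesis
  proof (cases "k \<ge> 0")
    case True
    then show ?thesis using in_J[OF k(1)] p0 by (auto simp: x_power_def)
  next
    case False
    then obtain n where n: "x_power k = y ^ n" by (simp add: x_power_def)
    obtain r where r: "r \<noteq> 0" "x ^ n * y ^ n - poly_at r z \<in> I" using x_y_power by blast
    have "x ^ n * y ^ n * poly_at (p k) z - poly_at r z * poly_at (p k) z \<in> I"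
      using ideal_cong_mult[OF ideal_I r(2), of 1] by simp
    moreover have "x ^ n * y ^ n * poly_at (p k) z \<in> J"
      using ideal_lmult[OF J(1) in_J[OF k(1)], of "x ^ n"] by (simp add: n mult.assoc)
    ultimately have "poly_at (r * p k) z \<in> J"
      using J ideal_cong[OF J(1)] by (auto simp: poly_at_mult)
    then show ?thesis using r(1) p0 by (intro exI[of _ 0] exI[of _ "r * p k"]) simp
  qed
qed

end

text \<open>In the applications the hypothesis comes from commutators with \<open>e\<close>, which raise the exponent of
  \<open>x\<close> and lower the degree of \<open>p\<close>; they stop at a constant.\<close>

lemma power_in_ideal:
  fixes x z :: "'a::complex_algebra_1"
  assumes J: "two_sided_ideal J"
    and lower: "\<And>k p. degree p > 0 \<Longrightarrow> x ^ k * poly_at p z \<in> J \<Longrightarrow>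
      \<exists>k' p'. p' \<noteq> 0 \<and> degree p' < degree p \<and> x ^ k' * poly_at p' z \<in> J"
    and "p \<noteq> 0" "x ^ k * poly_at p z \<in> J"
  shows "\<exists>j. x ^ j \<in> J"
  using assms(3,4)
proof (induction "degree p" arbitrary: p k rule: less_induct)
  case less
  show ?case
  proof (cases "degree p > 0")
    case True
    then show ?thesis using lower[OF True less.prems(2)] less.hyps by blast
  next
    case False
    then obtain c where "p = [:c:]" by (metis degree_eq_zeroE gr0I)
    then show ?thesis
      using less.prems ideal_scaleC_iff[OF J, of c "x ^ k"]
      by (auto simp: poly_at_const mult_scaleC_right)
  qed
qed


section \<open>Algebras generated by a Takiff \<open>sl2\<close>-triple\<close>

locale takiff_algebra =
  fixes e h f E H F :: "'a::complex_algebra_1"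
  assumes comm_ef: "e * f - f * e = h" and comm_he: "h * e - e * h = 2 * e"
    and comm_hf: "h * f - f * h = - (2 * f)"
    and comm_eF: "e * F - F * e = H" and comm_Ef: "E * f - f * E = H"
    and comm_hE: "h * E - E * h = 2 * E" and comm_hF: "h * F - F * h = - (2 * F)"
    and comm_He: "H * e - e * H = 2 * E" and comm_Hf: "H * f - f * H = - (2 * F)"
    and comm_eE: "e * E = E * e" and comm_hH: "h * H = H * h" and comm_fF: "f * F = F * f"
    and comm_EF: "F * E = E * F" and comm_EH: "H * E = E * H" and comm_FH: "H * F = F * H"
    and generated: "\<lbrakk>P 1; \<And>u v. P u \<Longrightarrow> P v \<Longrightarrow> P (u + v); \<And>c u. P u \<Longrightarrow> P (c *\<^sub>C u);
      \<And>u g. P u \<Longrightarrow> g \<in> {e, h, f, E, H, F} \<Longrightarrow> P (u * g)\<rbrakk> \<Longrightarrow> P u"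
begin

text \<open>Rewriting rules towards the order \<open>E, F, H, e, h, f\<close>.\<close>

lemma reorder:
  "e * E = E * e" "e * F = F * e + H" "e * H = H * e - 2 * E"
  "h * E = E * h + 2 * E" "h * F = F * h - 2 * F" "h * H = H * h"
  "f * E = E * f - H" "f * F = F * f" "f * H = H * f + 2 * F"
  "F * E = E * F" "H * E = E * H" "H * F = F * H"
  "h * e = e * h + 2 * e" "f * e = e * f - h" "f * h = h * f + 2 * f"
  using comm_ef comm_he comm_hf comm_eF comm_Ef comm_hE comm_hF comm_He comm_Hf
    comm_eE comm_hH comm_fF comm_EF comm_EH comm_FH
  by (simp_all add: algebra_simps)

lemma reorder_left:
  "e * (E * u) = E * (e * u)" "e * (F * u) = F * (e * u) + H * u"
  "e * (H * u) = H * (e * u) - 2 * (E * u)"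
  "h * (E * u) = E * (h * u) + 2 * (E * u)" "h * (F * u) = F * (h * u) - 2 * (F * u)"
  "h * (H * u) = H * (h * u)"
  "f * (E * u) = E * (f * u) - H * u" "f * (F * u) = F * (f * u)"
  "f * (H * u) = H * (f * u) + 2 * (F * u)"
  "F * (E * u) = E * (F * u)" "H * (E * u) = E * (H * u)" "H * (F * u) = F * (H * u)"
  "h * (e * u) = e * (h * u) + 2 * (e * u)" "f * (e * u) = e * (f * u) - h * u"
  "f * (h * u) = h * (f * u) + 2 * (f * u)"
  by (simp_all only: reorder distrib_right left_diff_distrib flip: mult.assoc)

lemmas reorder_simps = reorder reorder_left mult.assoc distrib_left distrib_right
  left_diff_distrib right_diff_distrib mult_2 mult_2_right

definition casimir :: 'a where "casimir = H * h + 2 * F * e + 2 * E * f"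
definition casimir_bar :: 'a where "casimir_bar = H\<^sup>2 + 4 * F * E"

text \<open>The index bounds the number of factors \<open>e, h, f\<close>, increased by one, so that level \<open>0\<close> is zero and
  level \<open>1\<close> is the subalgebra generated by \<open>E, H, F\<close>.\<close>

inductive level :: "nat \<Rightarrow> 'a \<Rightarrow> bool" where
  zero: "level d 0"
| one: "level (Suc d) 1"
| add: "level d u \<Longrightarrow> level d v \<Longrightarrow> level d (u + v)"
| scale: "level d u \<Longrightarrow> level d (c *\<^sub>C u)"
| bar: "level d u \<Longrightarrow> z \<in> {E, H, F} \<Longrightarrow> level d (z * u)"
| right: "level d u \<Longrightarrow> x \<in> {e, h, f} \<Longrightarrow> level (Suc d) (u * x)"
| weaken: "level d u \<Longrightarrow> level (Suc d) u"

lemma level_uminus: "level d u \<Longrightarrow> level d (- u)"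
  using level.scale[of d u "- 1"] by (simp add: minus_scaleC scaleC_one)

lemma level_diff: "level d u \<Longrightarrow> level d v \<Longrightarrow> level d (u - v)"
  using level.add[OF _ level_uminus, of d u v] by simp

lemma level_0: "level d u \<Longrightarrow> d = 0 \<Longrightarrow> u = 0"
  by (induction rule: level.induct) auto

lemma level_pred: "level (d - 1) u \<Longrightarrow> level d u"
  by (cases d) (auto intro: level.weaken)

lemma commutator_bar:
  assumes "x \<in> {e, h, f}" "z \<in> {E, H, F}"
  obtains c y where "y \<in> {E, H, F}" "x * z - z * x = c *\<^sub>C y"
proof -
  have "\<exists>c y. y \<in> {E, H, F} \<and> x * z - z * x = c *\<^sub>C y"
    using assms
  proof (elim insertE; simp)
  qed (simp_all add: reorder numeral_scaleC,
      (metis scaleC_one minus_scaleC complex_vector.scale_zero_left)+)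
  then show ?thesis using that by blast
qed


lemma commutator_sl2:
  assumes "x \<in> {e, h, f}" "y \<in> {e, h, f}"
  obtains c w where "w \<in> {e, h, f}" "x * y - y * x = c *\<^sub>C w"
proof -
  have "\<exists>c w. w \<in> {e, h, f} \<and> x * y - y * x = c *\<^sub>C w"
    using assms
  proof (elim insertE; simp)
  qed (simp_all add: reorder numeral_scaleC,
      (metis scaleC_one minus_scaleC complex_vector.scale_zero_left)+)
  then show ?thesis using that by blast
qed

lemma level_mult_bar: "level d u \<Longrightarrow> z \<in> {E, H, F} \<Longrightarrow> level d (u * z)"
proof (induction arbitrary: z rule: level.induct)
  case (one d)
  show ?case using level.bar[OF level.one one] by simp
next
  case (bar d u y)
  then show ?case using level.bar[of d "u * z" y] by (simp only: mult.assoc)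
next
  case (right d u x)
  obtain c y where y: "y \<in> {E, H, F}" "x * z - z * x = c *\<^sub>C y"
    using right.hyps(2) right.prems by (rule commutator_bar)
  have "level (Suc d) (u * z * x + c *\<^sub>C (u * y))"
    by (intro level.add level.right level.weaken level.scale right y(1))
  moreover have "u * z * x + c *\<^sub>C (u * y) = u * x * z"
    by (simp add: algebra_simps mult_scaleC_right flip: y(2) mult_scaleC_right[of u c y])
  ultimately show ?case by simp
qed (auto intro: level.intros simp: distrib_right mult_scaleC_left)

lemma level_commutator_bar: "level d u \<Longrightarrow> z \<in> {E, H, F} \<Longrightarrow> level (d - 1) (z * u - u * z)"
proof (induction arbitrary: z rule: level.induct)
  case (add d u v)
  then show ?case using level.add[of "d - 1" "z * u - u * z" "z * v - v * z"]
    by (simp add: algebra_simps)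
next
  case (scale d u c)
  then show ?case using level.scale[of "d - 1" "z * u - u * z" c]
    by (simp add: mult_scaleC_left mult_scaleC_right complex_vector.scale_right_diff_distrib)
next
  case (bar d u y)
  have "z * y = y * z" using bar.prems bar.hyps(2) by (auto simp: reorder)
  then have "z * (y * u) - y * u * z = y * (z * u - u * z)"
    by (simp add: algebra_simps) (simp flip: mult.assoc)
  then show ?case using level.bar[OF bar.IH[OF bar.prems] bar.hyps(2)] by simp
next
  case (right d u x)
  show ?case
  proof (cases d)
    case 0
    then show ?thesis using level_0[OF right.hyps(1)] by (simp add: level.zero)
  next
    case (Suc d')
    obtain c y where y: "y \<in> {E, H, F}" "x * z - z * x = c *\<^sub>C y"
      using right.hyps(2) right.prems by (rule commutator_bar)
    have "level d (z * u - u * z)" using right.IH[OF right.prems] by (rule level_pred)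
    then have "level (Suc (d - 1)) ((z * u - u * z) * x)"
      using level.right[OF right.IH[OF right.prems] right.hyps(2)] by simp
    then have "level d ((z * u - u * z) * x - c *\<^sub>C (u * y))"
      using Suc level_mult_bar[OF right.hyps(1) y(1)] by (intro level_diff level.scale) simp_all
    moreover have "(z * u - u * z) * x - c *\<^sub>C (u * y) = z * (u * x) - u * x * z"
      by (simp add: algebra_simps flip: y(2) mult_scaleC_right[of u c y])
    ultimately show ?thesis by simp
  qed
next
  case (weaken d u)
  then show ?case using level_pred by simp
qed (auto intro: level.zero)

lemma level_commutator: "level d u \<Longrightarrow> x \<in> {e, h, f} \<Longrightarrow> level d (x * u - u * x)"
proof (induction arbitrary: x rule: level.induct)
  case (add d u v)
  then show ?case using level.add[of d "x * u - u * x" "x * v - v * x"]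
    by (simp add: algebra_simps)
next
  case (scale d u c)
  then show ?case using level.scale[of d "x * u - u * x" c]
    by (simp add: mult_scaleC_left mult_scaleC_right complex_vector.scale_right_diff_distrib)
next
  case (bar d u z)
  obtain c y where y: "y \<in> {E, H, F}" "x * z - z * x = c *\<^sub>C y"
    using bar.prems bar.hyps(2) by (rule commutator_bar)
  have "level d (c *\<^sub>C (y * u) + z * (x * u - u * x))"
    by (intro level.add level.scale level.bar bar y(1))
  moreover have "c *\<^sub>C (y * u) + z * (x * u - u * x) = x * (z * u) - z * u * x"
    by (simp add: algebra_simps flip: y(2) mult_scaleC_left[of c y u])
  ultimately show ?case by simp
next
  case (right d u y)
  obtain c w where w: "w \<in> {e, h, f}" "x * y - y * x = c *\<^sub>C w"
    using right.prems right.hyps(2) by (rule commutator_sl2)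
  have "level (Suc d) ((x * u - u * x) * y + c *\<^sub>C (u * w))"
    unfolding mult_scaleC_right[symmetric]
    by (simp add: mult_scaleC_right, intro level.add level.right level.scale right w(1))
  moreover have "(x * u - u * x) * y + c *\<^sub>C (u * w) = x * (u * y) - u * y * x"
    by (simp add: algebra_simps flip: w(2) mult_scaleC_right[of u c w])
  ultimately show ?case by simp
qed (auto intro: level.intros)

lemma level_exhausts: "\<exists>d. level d u"
proof (induction u rule: generated)
  case 1 show ?case using level.one by blast
next
  case (2 u v)
  then obtain c d where cd: "level c u" "level d v" by blast
  have mono: "level n w \<Longrightarrow> level (n + m) w" for n m w
    by (induction m) (auto intro: level.weaken)
  show ?case using level.add[OF mono[OF cd(1), of d] mono[OF cd(2), of c, unfolded add.commute[of d]]]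
    by blast
next
  case (3 c u) then show ?case using level.scale by blast
next
  case (4 u g) then show ?case using level.right level_mult_bar by blast
qed

end

locale takiff_central_ideal = takiff_algebra +
  fixes I :: "'a set" and \<theta> \<chi> :: complex
  assumes ideal_I: "two_sided_ideal I"
    and casimir_in: "casimir - \<theta> *\<^sub>C 1 \<in> I"
    and casimir_bar_in: "casimir_bar - \<chi> *\<^sub>C 1 \<in> I"
begin

text \<open>
  On symbols, \<open>u \<mapsto> {H, u} e - {E, u} h\<close> is the vector field
  \<open>2 E (e \<partial>\<^sub>e + h \<partial>\<^sub>h) - (2 F e + H h) \<partial>\<^sub>f\<close>.  The first Casimir relation
  replaces \<open>2 F e + H h\<close> by \<open>- 2 E f\<close> up to a scalar, so that it becomes \<open>2 E\<close> times the Euler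
  field, which multiplies by the degree.
\<close>

definition euler :: "'a \<Rightarrow> 'a" where
  "euler u = (H * u - u * H) * e - (E * u - u * E) * h"

definition level_mod :: "nat \<Rightarrow> 'a \<Rightarrow> bool" where
  "level_mod d u \<longleftrightarrow> (\<exists>w. level d w \<and> u - w \<in> I)"

lemma level_modI: "level d u \<Longrightarrow> level_mod d u"
  using ideal_zero[OF ideal_I] by (auto simp: level_mod_def)

lemma level_mod_add: "level_mod d u \<Longrightarrow> level_mod d v \<Longrightarrow> level_mod d (u + v)"
proof -
  assume "level_mod d u" "level_mod d v"
  then obtain w w' where "level d w" "u - w \<in> I" "level d w'" "v - w' \<in> I"
    by (auto simp: level_mod_def)
  then show ?thesis
    using level.add[of d w w'] ideal_add[OF ideal_I, of "u - w" "v - w'"]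
    by (auto simp: level_mod_def algebra_simps)
qed

lemma level_mod_scale: "level_mod d u \<Longrightarrow> level_mod d (c *\<^sub>C u)"
  unfolding level_mod_def using level.scale ideal_scaleC[OF ideal_I]
  by (metis complex_vector.scale_right_diff_distrib)

lemma level_mod_bar: "level_mod d u \<Longrightarrow> z \<in> {E, H, F} \<Longrightarrow> level_mod d (z * u)"
  unfolding level_mod_def using level.bar ideal_lmult[OF ideal_I]
  by (metis right_diff_distrib)

lemma level_mod_right: "level_mod d u \<Longrightarrow> x \<in> {e, h, f} \<Longrightarrow> level_mod (Suc d) (u * x)"
  unfolding level_mod_def using level.right ideal_rmult[OF ideal_I]
  by (metis left_diff_distrib)

lemma level_mod_ideal: "u \<in> I \<Longrightarrow> level_mod d u"
  unfolding level_mod_def using level.zero by force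

lemma euler_right:
  "euler (u * x) = euler u * x + (H * u - u * H) * (x * e - e * x)
    - (E * u - u * E) * (x * h - h * x) + u * ((H * x - x * H) * e - (E * x - x * E) * h)"
  unfolding euler_def by (simp add: algebra_simps)

lemma euler_degree: "level d u \<Longrightarrow> level_mod (d - 1) (euler u - (2 * of_nat (d - 1)) *\<^sub>C (E * u))"
proof (induction rule: level.induct)
  case (zero d)
  then show ?case by (simp add: euler_def level_modI level.zero)
next
  case (one d)
  have "level d ((- 2 * of_nat d) *\<^sub>C E)"
    using level.scale[OF level.bar[OF level.one, of E]] by (cases d) (auto intro: level.zero)
  then show ?case by (simp add: euler_def level_modI minus_scaleC)
next
  case (add d u v)
  have "euler (u + v) = euler u + euler v" by (simp add: euler_def algebra_simps)
  then show ?case using level_mod_add[OF add.IH]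
    by (simp add: distrib_left scaleC_add_right algebra_simps)
next
  case (scale d u c)
  have "euler (c *\<^sub>C u) = c *\<^sub>C euler u"
    by (simp add: euler_def mult_scaleC_left mult_scaleC_right left_diff_distrib
        complex_vector.scale_right_diff_distrib)
  then show ?case using level_mod_scale[OF scale.IH, of c]
    by (simp add: mult_scaleC_right scaleC_scaleC mult.commute mult.left_commute
        complex_vector.scale_right_diff_distrib)
next
  case (bar d u z)
  have *: "H * z = z * H" "E * z = z * E" using bar.hyps(2) by (auto simp: reorder)
  have "H * (z * u) = z * (H * u)" "E * (z * u) = z * (E * u)"
    using * by (simp_all flip: mult.assoc)
  then have "euler (z * u) = z * euler u" "E * (z * u) = z * (E * u)"
    by (simp_all add: euler_def algebra_simps)
  then show ?case using level_mod_bar[OF bar.IH bar.hyps(2)]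
    by (simp add: right_diff_distrib mult_scaleC_right)
next
  case (right d u x)
  show ?case
  proof (cases d)
    case 0
    then show ?thesis using level_0[OF right.hyps(1)]
      by (simp add: euler_def level_modI level.zero)
  next
    case (Suc d')
    have low: "level d' (H * u - u * H)" "level d' (E * u - u * E)"
      using level_commutator_bar[OF right.hyps(1)] Suc by auto
    let ?A = "(H * u - u * H) * (x * e - e * x) - (E * u - u * E) * (x * h - h * x)"
    let ?B = "u * ((H * x - x * H) * e - (E * x - x * E) * h)"
    have A: "level_mod d ?A"
    proof -
      have step: "level d (w * (x * y - y * x))" if "level d' w" "y \<in> {e, h, f}" for w y
        using commutator_sl2[OF right.hyps(2) that(2)] that(1) level.right level.scale Suc
        by (metis mult_scaleC_right)
      show ?thesis
        by (intro level_modI level_diff step low) auto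
    qed
    have "level_mod d (euler u * x - (2 * of_nat d') *\<^sub>C (E * u) * x)"
      using level_mod_right[OF right.IH right.hyps(2)] Suc by (simp add: left_diff_distrib)
    moreover have "level_mod d (?B - 2 *\<^sub>C (E * u * x))"
    proof -
      have E: "level d (u * E - E * u)"
        using level_pred[OF level_uminus[OF level_commutator_bar[OF right.hyps(1), of E]]] by simp
      have uE: "level_mod d (2 *\<^sub>C ((u * E - E * u) * x))"
        using level.right[OF level_uminus[OF low(2)] right.hyps(2)] Suc
        by (intro level_mod_scale level_modI) simp
      consider "x = e" | "x = h" | "x = f" using right.hyps(2) by blast
      then show ?thesis
      proof cases
        case 1
        have "?B - 2 *\<^sub>C (E * u * x) = 2 *\<^sub>C ((u * E - E * u) * x)"
          unfolding 1 by (simp add: reorder_simps flip: numeral_scaleC)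
        then show ?thesis using uE by simp
      next
        case 2
        have "?B - 2 *\<^sub>C (E * u * x) = 2 *\<^sub>C ((u * E - E * u) * x)"
          unfolding 2 by (simp add: reorder_simps flip: numeral_scaleC)
        then show ?thesis using uE by simp
      next
        case 3
        have "?B - 2 *\<^sub>C (E * u * x)
            = 2 *\<^sub>C ((u * E - E * u) * x) + (- \<theta>) *\<^sub>C u + (- 1) *\<^sub>C (u * (casimir - \<theta> *\<^sub>C 1))"
          unfolding 3 casimir_def
          by (simp add: reorder_simps mult_scaleC_right minus_scaleC scaleC_one flip: numeral_scaleC)
        moreover have "level_mod d (u * (casimir - \<theta> *\<^sub>C 1))"
          by (intro level_mod_ideal ideal_lmult[OF ideal_I] casimir_in)
        ultimately show ?thesis
          using level_mod_add[OF level_mod_add[OF uE level_mod_scale[OF level_modI[OF right.hyps(1)]]]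
              level_mod_scale]
          by (simp only:)
      qed
    qed
    ultimately have "level_mod d ((euler u * x - (2 * of_nat d') *\<^sub>C (E * u) * x) + ?A
        + (?B - 2 *\<^sub>C (E * u * x)))"
      using A by (intro level_mod_add)
    moreover have "(euler u * x - (2 * of_nat d') *\<^sub>C (E * u) * x) + ?A + (?B - 2 *\<^sub>C (E * u * x))
        = euler (u * x) - (2 * of_nat d) *\<^sub>C (E * (u * x))"
      using Suc by (simp add: euler_right scaleC_add_left distrib_left mult_scaleC_left mult.assoc)
    ultimately show ?thesis by simp
  qed
next
  case (weaken d u)
  show ?case
  proof (cases d)
    case 0
    then show ?thesis using level_0[OF weaken.hyps]
      by (simp add: euler_def level_modI level.zero)
  next
    case (Suc d')
    have "level_mod d (euler u - (2 * of_nat d') *\<^sub>C (E * u) + (- 2) *\<^sub>C (E * u))"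
    proof (intro level_mod_add level_mod_scale)
      obtain w where "level d' w" "euler u - (2 * of_nat d') *\<^sub>C (E * u) - w \<in> I"
        using weaken.IH Suc by (auto simp: level_mod_def)
      then show "level_mod d (euler u - (2 * of_nat d') *\<^sub>C (E * u))"
        using Suc level.weaken by (auto simp: level_mod_def)
      show "level_mod d (E * u)"
        using weaken.hyps by (intro level_modI level.bar) simp_all
    qed
    then show ?thesis using Suc
      by (simp add: scaleC_add_left distrib_left minus_scaleC algebra_simps)
  qed
qed

end


section \<open>Ideals above a central character\<close>

context takiff_central_ideal
begin

text \<open>
  Take an element of \<open>J - I\<close> of minimal level.  Commutators with \<open>E, H\<close> lower the level, so they
  lie in \<open>I\<close>; by the Euler formula so does the product with \<open>E\<close>, unless the level is that of the
  subalgebra generated by \<open>E, H, F\<close>.  Commutators with \<open>f\<close> preserve the level and turn \<open>E u\<close> into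
  \<open>H u\<close> and \<open>H u\<close> into \<open>F u\<close>.
\<close>

lemma ideal_dichotomy:
  assumes J: "two_sided_ideal J" "I \<subseteq> J" "J \<noteq> I"
  shows "(\<exists>u\<in>J - I. E * u \<in> I \<and> H * u \<in> I \<and> F * u \<in> I) \<or> (\<exists>u\<in>J - I. level 1 u)"
proof -
  define d where "d = (LEAST d. \<exists>u\<in>J - I. level d u)"
  obtain u0 where "u0 \<in> J - I" using J by blast
  then have "\<exists>d. \<exists>u\<in>J - I. level d u" using level_exhausts by blast
  from LeastI_ex[OF this] have "\<exists>u\<in>J - I. level d u" unfolding d_def .
  then obtain u where u: "u \<in> J" "u \<notin> I" "level d u" by blast
  have min: "w \<in> I" if "c < d" "level c w" "w \<in> J" for c w
    using not_less_Least[of c "\<lambda>d. \<exists>u\<in>J - I. level d u"] that unfolding d_def by blast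
  have "d \<noteq> 0" using u level_0 ideal_zero[OF ideal_I] by blast
  then consider "d = 1" | d' where "d = Suc (Suc d')" by (metis One_nat_def not0_implies_Suc)
  then show ?thesis
  proof cases
    case 1 then show ?thesis using u by blast
  next
    case 2
    have Ev: "E * v \<in> I" if v: "v \<in> J" "level d v" for v
    proof -
      have comm: "z * v - v * z \<in> I" if "z \<in> {E, H, F}" for z
        using level_commutator_bar[OF v(2) that] ideal_commutator[OF J(1) v(1)] 2
        by (intro min[of "d - 1"]) auto
      have "euler v \<in> I" unfolding euler_def
        by (rule ideal_diff[OF ideal_I ideal_rmult[OF ideal_I comm] ideal_rmult[OF ideal_I comm]])
          simp_all
      obtain w where w: "level (d - 1) w" "euler v - (2 * of_nat (d - 1)) *\<^sub>C (E * v) - w \<in> I"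
        using euler_degree[OF v(2)] by (auto simp: level_mod_def)
      then have sum_in: "(2 * of_nat (d - 1)) *\<^sub>C (E * v) + w \<in> I"
        using ideal_diff[OF ideal_I \<open>euler v \<in> I\<close> w(2)] by (simp add: algebra_simps)
      have "w \<in> J"
        using ideal_diff[OF J(1), of "(2 * of_nat (d - 1)) *\<^sub>C (E * v) + w"
            "(2 * of_nat (d - 1)) *\<^sub>C (E * v)"] sum_in J(2)
          ideal_scaleC[OF J(1) ideal_lmult[OF J(1) v(1)]] by auto
      then have "w \<in> I" using min[of "d - 1"] w(1) 2 by auto
      then have "(2 * of_nat (d - 1)) *\<^sub>C (E * v) \<in> I"
        using ideal_diff[OF ideal_I sum_in] by force
      then show ?thesis
        using ideal_scaleC_iff[OF ideal_I, of "2 * of_nat (d - 1)"] 2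
        by (simp del: of_nat_Suc)
    qed
    have fv: "f * v - v * f \<in> J" "level d (f * v - v * f)" if "v \<in> J" "level d v" for v
      using ideal_commutator[OF J(1) that(1)] level_commutator[OF that(2)] by auto
    have Hv: "H * v \<in> I" if v: "v \<in> J" "level d v" for v
    proof -
      have "E * (f * v - v * f) - (f * (E * v) - (E * v) * f) \<in> I"
        by (intro ideal_diff[OF ideal_I] Ev fv v ideal_lmult[OF ideal_I] ideal_rmult[OF ideal_I])
      then show ?thesis by (simp add: reorder_simps)
    qed
    have "H * (f * u - u * f) - (f * (H * u) - (H * u) * f) \<in> I"
      by (intro ideal_diff[OF ideal_I] Hv fv u ideal_lmult[OF ideal_I] ideal_rmult[OF ideal_I])
    also have "H * (f * u - u * f) - (f * (H * u) - (H * u) * f) = (- 2) *\<^sub>C (F * u)"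
      by (simp add: reorder_simps minus_scaleC flip: numeral_scaleC)
    finally have "F * u \<in> I" using ideal_scaleC_iff[OF ideal_I, of "- 2"] by simp
    then show ?thesis using Ev Hv u by blast
  qed
qed

text \<open>Modulo \<open>I\<close>, the products \<open>F E\<close> and \<open>E F\<close> are \<open>(\<chi> - H\<^sup>2)/4\<close>.\<close>

lemma weyl_generators_bar: "weyl_generators I E F H h 0 [:\<chi> / 4, 0, - (1 / 4):] [:\<chi> / 4, 0, - (1 / 4):]"
proof -
  have eq: "E * F - poly_at [:\<chi> / 4, 0, - (1 / 4):] H = (1 / 4) *\<^sub>C (casimir_bar - \<chi> *\<^sub>C 1)"
    by (simp add: casimir_bar_def poly_at_pCons poly_at_0 mult_scaleC_right minus_scaleC
        numeral_scaleC scaleC_scaleC scaleC_add_right reorder power2_eq_square mult_scaleC_left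
        complex_vector.scale_right_diff_distrib mult.assoc scaleC_one)
  show ?thesis
  proof
    show "E * F - poly_at [:\<chi> / 4, 0, - (1 / 4):] H \<in> I"
      unfolding eq by (rule ideal_scaleC[OF ideal_I casimir_bar_in])
    then show "F * E - poly_at [:\<chi> / 4, 0, - (1 / 4):] H \<in> I" by (simp add: reorder)
  qed (simp_all add: ideal_I reorder numeral_scaleC minus_scaleC)
qed

text \<open>A weight vector in \<open>J\<close> has the form \<open>E\<^sup>k p(H)\<close>.  The commutator with \<open>e\<close> is the derivation
  with \<open>E \<mapsto> 0\<close>, \<open>H \<mapsto> - 2 E\<close> and leads to \<open>- 2 E\<^bsup>k+1\<^esup> p'(H)\<close>.\<close>

lemma level_1_power_in_ideal:
  assumes J: "two_sided_ideal J" "I \<subseteq> J" and u: "u \<in> J" "u \<notin> I" "level 1 u"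
  shows "\<exists>j. E ^ j \<in> J"
proof -
  interpret B: weyl_generators I E F H h 0 "[:\<chi> / 4, 0, - (1 / 4):]" "[:\<chi> / 4, 0, - (1 / 4):]"
    by (rule weyl_generators_bar)
  have "level d v \<Longrightarrow> d = 1 \<Longrightarrow> v \<in> B.graded_forms" for d v
  proof (induction rule: level.induct)
    case (bar d v z)
    have "z * v = v * z"
      using level_0[OF level_commutator_bar[OF bar.hyps]] bar.prems by simp
    then show ?case
      using bar B.graded_forms_mult_x B.graded_forms_mult_y B.graded_forms_mult_z by auto
  qed (auto simp: B.one_in_graded_forms B.graded_forms_add B.graded_forms_scaleC
      B.ideal_in_graded_forms ideal_zero[OF ideal_I] dest!: level_0)
  then obtain k p where p: "p \<noteq> 0" "E ^ k * poly_at p H \<in> J"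
    using B.weight_vector_in_ideal[OF J _ u(1,2)] u(3) by blast
  have eE: "e * E ^ n = E ^ n * e" for n
    by (induction n) (simp_all add: reorder_left flip: mult.assoc, simp add: mult.assoc reorder)
  have eH: "e * poly_at p H - poly_at p H * e = - (2 *\<^sub>C (E * poly_at (pderiv p) H))" for p
  proof (induction p)
    case 0 then show ?case by (simp add: poly_at_0)
  next
    case (pCons a p)
    have "e * (H * poly_at p H) - H * poly_at p H * e
        = H * (e * poly_at p H - poly_at p H * e) - 2 * (E * poly_at p H)"
      by (simp add: algebra_simps reorder_left)
    then show ?case
      by (simp add: pCons.IH poly_at_pCons poly_at_smult poly_at_add pderiv_pCons algebra_simps
          mult_scaleC_right mult_scaleC_left reorder_left numeral_scaleC scaleC_add_right)
  qed
  show ?thesis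
  proof (rule power_in_ideal[OF J(1) _ p])
    fix k and p :: "complex poly"
    assume p: "degree p > 0" "E ^ k * poly_at p H \<in> J"
    have "e * (E ^ k * poly_at p H) - (E ^ k * poly_at p H) * e
        = E ^ k * (e * poly_at p H - poly_at p H * e)"
      by (simp add: algebra_simps eE flip: mult.assoc) 
    then have "(- 2) *\<^sub>C (E ^ Suc k * poly_at (pderiv p) H) \<in> J"
      using ideal_commutator[OF J(1) p(2), of e]
      by (simp add: eH minus_scaleC mult_scaleC_right power_commutes flip: mult.assoc)
    then have "E ^ Suc k * poly_at (pderiv p) H \<in> J"
      using ideal_scaleC_iff[OF J(1), of "- 2"] by simp
    moreover have "pderiv p \<noteq> 0" "degree (pderiv p) < degree p"
      using p(1) by (auto simp: pderiv_eq_0_iff degree_pderiv)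
    ultimately show "\<exists>k' p'. p' \<noteq> 0 \<and> degree p' < degree p \<and> E ^ k' * poly_at p' H \<in> J"
      by blast
  qed
qed

lemma E_power_f: "E ^ n * f - f * E ^ n = of_nat n *\<^sub>C (E ^ (n - 1) * H)"
proof (induction n)
  case (Suc n)
  have HE: "H * E ^ n = E ^ n * H"
    by (induction n) (simp_all add: reorder_left mult.assoc)
  have "E ^ Suc n * f - f * E ^ Suc n = E * (E ^ n * f - f * E ^ n) + (E * f - f * E) * E ^ n"
    by (simp add: algebra_simps)
  also have "\<dots> = of_nat n *\<^sub>C (E * (E ^ (n - 1) * H)) + E ^ n * H"
    by (simp add: Suc comm_Ef HE mult_scaleC_right)
  also have "of_nat n *\<^sub>C (E * (E ^ (n - 1) * H)) = of_nat n *\<^sub>C (E ^ n * H)"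
    by (cases n) (simp_all add: mult.assoc)
  finally show ?case by (simp add: scaleC_add_left)
qed simp

text \<open>
  If \<open>E\<^bsup>j+1\<^esup>\<close> lies in \<open>J\<close>, then so do its commutators with \<open>f\<close>, which produce
  \<open>E\<^sup>j H\<close> and \<open>j E\<^bsup>j-1\<^esup> H\<^sup>2 - 2 E\<^sup>j F\<close>; the Casimir relations turn these into scalar
  multiples of \<open>E\<^sup>j\<close>.
\<close>

lemma E_power_descent:
  assumes J: "two_sided_ideal J" "I \<subseteq> J" and E: "E ^ Suc j \<in> J"
  shows "E ^ j * H \<in> J" and "\<chi> *\<^sub>C E ^ j \<in> J"
    and "\<chi> = 0 \<Longrightarrow> E ^ j * F \<in> J" and "\<chi> = 0 \<Longrightarrow> \<theta> *\<^sub>C E ^ j \<in> J"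
proof -
  note clI = ideal_add[OF J(1)] ideal_diff[OF J(1)] ideal_lmult[OF J(1)] ideal_rmult[OF J(1)]
    ideal_scaleC[OF J(1)]
  have FE: "F * E ^ n = E ^ n * F" for n
    by (induction n) (simp_all add: reorder_left mult.assoc)
  have EE: "E ^ n * (E * u) = E * (E ^ n * u)" for n u
    by (simp add: power_commutes flip: mult.assoc)
  have "of_nat (Suc j) *\<^sub>C (E ^ j * H) \<in> J"
    using E_power_f[of "Suc j"] ideal_commutator[OF J(1) E, of f] ideal_uminus[OF J(1)]
    by (metis diff_Suc_1 minus_diff_eq)
  then show EH: "E ^ j * H \<in> J"
    using ideal_scaleC_iff[OF J(1), of "of_nat (Suc j)"] by (simp del: of_nat_Suc)
  have bar: "a * (casimir_bar - \<chi> *\<^sub>C 1) \<in> J" for a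
    using casimir_bar_in J by (intro ideal_lmult[OF J(1)]) auto
  have "(E ^ j * H) * H + 4 *\<^sub>C (F * E ^ Suc j) - E ^ j * (casimir_bar - \<chi> *\<^sub>C 1) \<in> J"
    by (intro bar EH E clI)
  also have "(E ^ j * H) * H + 4 *\<^sub>C (F * E ^ Suc j) - E ^ j * (casimir_bar - \<chi> *\<^sub>C 1) = \<chi> *\<^sub>C E ^ j"
    by (simp add: casimir_bar_def power2_eq_square algebra_simps numeral_scaleC mult_scaleC_right
        mult_scaleC_left FE EE reorder_left reorder)
  finally show "\<chi> *\<^sub>C E ^ j \<in> J" .
  assume \<chi>: "\<chi> = 0"
  have "E ^ j * H * f - f * (E ^ j * H) \<in> J" by (intro EH clI)
  also have "E ^ j * H * f - f * (E ^ j * H) = E ^ j * (H * f - f * H) + (E ^ j * f - f * E ^ j) * H"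
    by (simp add: algebra_simps)
  also have "\<dots> = of_nat j *\<^sub>C (E ^ (j - 1) * H * H) - 2 *\<^sub>C (E ^ j * F)"
    by (simp add: E_power_f reorder mult_scaleC_left mult_scaleC_right numeral_scaleC)
  finally have 1: "of_nat j *\<^sub>C (E ^ (j - 1) * H * H) - 2 *\<^sub>C (E ^ j * F) \<in> J" .
  have 2: "of_nat j *\<^sub>C (E ^ (j - 1) * casimir_bar) \<in> J"
    using ideal_scaleC[OF J(1) bar[of "E ^ (j - 1)"]] by (simp add: \<chi>)
  have 3: "of_nat j *\<^sub>C (E ^ (j - 1) * casimir_bar)
      = of_nat j *\<^sub>C (E ^ (j - 1) * H * H) + (4 * of_nat j) *\<^sub>C (E ^ j * F)"
    by (cases j) (simp_all add: casimir_bar_def power2_eq_square distrib_left scaleC_add_right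
        numeral_scaleC mult_scaleC_right mult_scaleC_left reorder scaleC_scaleC mult.commute[of 4] mult.assoc EE)
  have "(4 * of_nat j + 2) *\<^sub>C (E ^ j * F) \<in> J"
    using ideal_diff[OF J(1) 2 1] unfolding 3 by (simp add: scaleC_add_left)
  moreover have "4 * of_nat j + 2 \<noteq> (0 :: complex)"
    by (metis of_nat_numeral of_nat_mult of_nat_add of_nat_eq_0_iff add_is_0 zero_neq_numeral)
  ultimately show EF: "E ^ j * F \<in> J" using ideal_scaleC_iff[OF J(1)] by blast
  have "(E ^ j * H) * h + 2 *\<^sub>C (E ^ j * F * e) + 2 *\<^sub>C (E ^ Suc j * f)
      - E ^ j * (casimir - \<theta> *\<^sub>C 1) \<in> J"
    using casimir_in J(2) by (intro EH EF E subsetD[OF J(2) casimir_in] clI)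
  also have "(E ^ j * H) * h + 2 *\<^sub>C (E ^ j * F * e) + 2 *\<^sub>C (E ^ Suc j * f)
      - E ^ j * (casimir - \<theta> *\<^sub>C 1) = \<theta> *\<^sub>C E ^ j"
    by (simp add: casimir_def algebra_simps numeral_scaleC mult_scaleC_right mult_scaleC_left EE)
  finally show "\<theta> *\<^sub>C E ^ j \<in> J" .
qed

text \<open>Both Casimir elements can be written as combinations of \<open>E, H, F\<close> with coefficients on the left.\<close>

lemma bar_annihilated:
  assumes "E * u \<in> I" "H * u \<in> I" "F * u \<in> I"
  shows "\<chi> *\<^sub>C u \<in> I" and "\<theta> *\<^sub>C u \<in> I"
proof -
  note clI = ideal_add[OF ideal_I] ideal_diff[OF ideal_I] ideal_lmult[OF ideal_I]
    ideal_rmult[OF ideal_I] ideal_scaleC[OF ideal_I]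
  have "H * (H * u) + 4 *\<^sub>C (F * (E * u)) - (casimir_bar - \<chi> *\<^sub>C 1) * u \<in> I"
    by (intro assms casimir_bar_in clI)
  then show "\<chi> *\<^sub>C u \<in> I"
    by (simp add: casimir_bar_def power2_eq_square algebra_simps numeral_scaleC mult_scaleC_left)
  have "h * (H * u) + 2 *\<^sub>C (e * (F * u) - H * u) + 2 *\<^sub>C (f * (E * u) + H * u)
      - (casimir - \<theta> *\<^sub>C 1) * u \<in> I"
    by (intro assms casimir_in clI)
  then show "\<theta> *\<^sub>C u \<in> I"
    by (simp add: casimir_def algebra_simps reorder_left numeral_scaleC mult_scaleC_left)
qed

theorem maximal_of_nonzero_character:
  assumes "\<theta> \<noteq> 0 \<or> \<chi> \<noteq> 0" and J: "two_sided_ideal J" "I \<subseteq> J" "1 \<notin> J"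
  shows "J = I"
proof (rule ccontr)
  assume "J \<noteq> I"
  from ideal_dichotomy[OF J(1,2) this] show False
  proof (elim disjE bexE conjE)
    fix u assume "u \<in> J - I" "E * u \<in> I" "H * u \<in> I" "F * u \<in> I"
    then show False using bar_annihilated[of u] assms(1) ideal_scaleC_iff[OF ideal_I] by blast
  next
    fix u assume "u \<in> J - I" "level 1 u"
    then obtain j where "E ^ j \<in> J" using level_1_power_in_ideal[OF J(1,2)] by blast
    then have "1 \<in> J"
    proof (induction j)
      case (Suc j)
      have "E ^ j \<in> J"
        using E_power_descent[OF J(1,2) Suc.prems] assms(1) ideal_scaleC_iff[OF J(1)] by blast
      then show ?case by (rule Suc.IH)
    qed simp
    then show False using J(3) by blast
  qed
qed

end


section \<open>Normal forms modulo the zero central character\<close>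

locale takiff_zero_character = takiff_central_ideal e h f E H F I 0 0
  for e h f E H F :: "'a::complex_algebra_1" and I
begin

definition bar_monomial :: "nat \<Rightarrow> nat \<Rightarrow> nat \<Rightarrow> 'a" where
  "bar_monomial a b \<epsilon> = E ^ a * F ^ b * H ^ \<epsilon>"

definition normal_monomial :: "nat \<Rightarrow> nat \<Rightarrow> nat \<Rightarrow> nat \<Rightarrow> complex poly \<Rightarrow> nat \<Rightarrow> 'a" where
  "normal_monomial a b \<epsilon> i p k = bar_monomial a b \<epsilon> * e ^ i * poly_at p h * f ^ k"

text \<open>
  The Casimir relations are used to eliminate \<open>H\<^sup>2\<close> and \<open>E f\<close>.  The two leading monomials are
  coprime, and the monomials divisible by neither of them are those below.
\<close>

definition normal_indices :: "(nat \<times> nat \<times> nat \<times> nat \<times> nat) set" where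
  "normal_indices = {(a, b, \<epsilon>, i, k). \<epsilon> \<le> 1 \<and> (a = 0 \<or> k = 0)}"

definition normal_forms :: "'a set" where
  "normal_forms = complex_vector.span
     (I \<union> {normal_monomial a b \<epsilon> i p k |a b \<epsilon> i p k. (a, b, \<epsilon>, i, k) \<in> normal_indices})"

lemma normal_forms_add: "u \<in> normal_forms \<Longrightarrow> v \<in> normal_forms \<Longrightarrow> u + v \<in> normal_forms"
  and normal_forms_diff: "u \<in> normal_forms \<Longrightarrow> v \<in> normal_forms \<Longrightarrow> u - v \<in> normal_forms"
  and normal_forms_scaleC: "u \<in> normal_forms \<Longrightarrow> c *\<^sub>C u \<in> normal_forms"
  and ideal_in_normal_forms: "u \<in> I \<Longrightarrow> u \<in> normal_forms"
  unfolding normal_forms_def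
  by (auto intro: complex_vector.span_add complex_vector.span_diff complex_vector.span_scale
      complex_vector.span_base)

lemma normal_formsI: "u - v \<in> I \<Longrightarrow> v \<in> normal_forms \<Longrightarrow> u \<in> normal_forms"
  using normal_forms_add[OF ideal_in_normal_forms, of "u - v" v] by simp

lemma normal_monomial_in:
  "\<epsilon> \<le> 1 \<Longrightarrow> a = 0 \<or> k = 0 \<Longrightarrow> normal_monomial a b \<epsilon> i p k \<in> normal_forms"
  unfolding normal_forms_def normal_indices_def by (rule complex_vector.span_base) blast

lemma H_H: "l * (H * H) * r + 4 *\<^sub>C (l * (E * F) * r) \<in> I"
proof -
  have "l * (casimir_bar - 0 *\<^sub>C 1) * r \<in> I"
    by (intro ideal_lmult[OF ideal_I] ideal_rmult[OF ideal_I] casimir_bar_in)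
  then show ?thesis
    by (simp add: casimir_bar_def power2_eq_square distrib_left distrib_right mult_scaleC_right
        mult_scaleC_left numeral_scaleC reorder mult.assoc)
qed

lemma bar_commute:
  "F ^ b * E = E * F ^ b" "H ^ b * E = E * H ^ b" "H ^ b * F = F * H ^ b"
  by (induction b) (simp_all add: mult.assoc reorder reorder_left)

lemma bar_monomial_E: "bar_monomial a b \<epsilon> * E = bar_monomial (Suc a) b \<epsilon>"
  and bar_monomial_F: "bar_monomial a b \<epsilon> * F = bar_monomial a (Suc b) \<epsilon>"
  and bar_monomial_H: "bar_monomial a b \<epsilon> * H = bar_monomial a b (Suc \<epsilon>)"
proof -
  have "E ^ a * (F ^ b * (H ^ \<epsilon> * E)) = E ^ a * E * F ^ b * H ^ \<epsilon>"
    by (simp add: bar_commute mult.assoc) (simp add: bar_commute flip: mult.assoc)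
  then show "bar_monomial a b \<epsilon> * E = bar_monomial (Suc a) b \<epsilon>"
    unfolding bar_monomial_def power_Suc2 by (simp only: mult.assoc)
  have "E ^ a * (F ^ b * (H ^ \<epsilon> * F)) = E ^ a * (F ^ b * F) * H ^ \<epsilon>"
    by (simp add: bar_commute mult.assoc)
  then show "bar_monomial a b \<epsilon> * F = bar_monomial a (Suc b) \<epsilon>"
    unfolding bar_monomial_def power_Suc2 by (simp only: mult.assoc)
  show "bar_monomial a b \<epsilon> * H = bar_monomial a b (Suc \<epsilon>)"
    unfolding bar_monomial_def power_Suc2 by (simp only: mult.assoc)
qed

text \<open>Replacing \<open>H\<^sup>2\<close> by \<open>- 4 E F\<close> preserves the shape of a monomial without \<open>f\<close>.\<close>

lemma bar_monomial_in: "bar_monomial a b \<epsilon> * e ^ i * poly_at p h \<in> normal_forms"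
proof (induction \<epsilon> arbitrary: a b rule: less_induct)
  case (less \<epsilon>)
  show ?case
  proof (cases "\<epsilon> \<le> 1")
    case True
    then show ?thesis using normal_monomial_in[of \<epsilon> a 0] by (simp add: normal_monomial_def)
  next
    case False
    then obtain \<epsilon>' where \<epsilon>: "\<epsilon> = Suc (Suc \<epsilon>')" by (metis One_nat_def Suc_le_mono le0 not0_implies_Suc)
    let ?r = "e ^ i * poly_at p h"
    have "bar_monomial a b \<epsilon>' * (H * H) * ?r + 4 *\<^sub>C (bar_monomial a b \<epsilon>' * (E * F) * ?r) \<in> I"
      by (rule H_H)
    moreover have "bar_monomial a b \<epsilon>' * (H * H) = bar_monomial a b \<epsilon>"
      "bar_monomial a b \<epsilon>' * (E * F) = bar_monomial (Suc a) (Suc b) \<epsilon>'"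
      by (simp_all add: bar_monomial_E bar_monomial_F bar_monomial_H \<epsilon> flip: mult.assoc)
    moreover have nf: "(- 4) *\<^sub>C (bar_monomial (Suc a) (Suc b) \<epsilon>' * ?r) \<in> normal_forms"
      using less.IH[of \<epsilon>' "Suc a" "Suc b"] \<epsilon>
      by (intro normal_forms_scaleC) (simp add: mult.assoc)
    ultimately show ?thesis
      by (intro normal_formsI[OF _ nf]) (simp add: minus_scaleC flip: mult.assoc)
  qed
qed

lemma f_poly: "f ^ k * poly_at p h = poly_at (pcompose p [:2 * of_nat k, 1:]) h * f ^ k"
proof (induction k arbitrary: p)
  case 0 then show ?case by simp
next
  case (Suc k)
  have hf: "h * f - f * h = (- 2) *\<^sub>C f" by (simp add: reorder minus_scaleC numeral_scaleC)
  have "f * poly_at p h = poly_at (pcompose p [:2, 1:]) h * f" for p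
  proof -
    have "pcompose (pcompose p [:2, 1:]) [:- 2, 1:] = p"
      by (simp add: pcompose_pCons flip: pcompose_assoc)
    then show ?thesis using poly_at_shift[OF hf, of "pcompose p [:2, 1:]"] by simp
  qed
  then have "f ^ Suc k * poly_at p h = f ^ k * poly_at (pcompose p [:2, 1:]) h * f"
    by (simp add: power_Suc2 mult.assoc del: power_Suc)
  also have "\<dots> = poly_at (pcompose (pcompose p [:2, 1:]) [:2 * of_nat k, 1:]) h * f ^ Suc k"
    by (simp add: Suc.IH power_Suc2 mult.assoc del: power_Suc)
  also have "pcompose (pcompose p [:2, 1:]) [:2 * of_nat k, 1:] = pcompose p [:2 * of_nat (Suc k), 1:]"
    by (simp add: pcompose_pCons algebra_simps flip: pcompose_assoc)
  finally show ?case .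
qed

lemma he: "h * e - e * h = 2 *\<^sub>C e" by (simp add: reorder numeral_scaleC)

lemma f_power_e: "f ^ k * e = e * f ^ k - of_nat k *\<^sub>C (poly_at [:of_nat k - 1, 1:] h * f ^ (k - 1))"
proof (induction k)
  case (Suc k)
  have "f ^ Suc k * e = f ^ k * (f * e)" by (simp add: power_Suc2 mult.assoc del: power_Suc)
  also have "\<dots> = f ^ k * e * f - f ^ k * h" by (simp add: reorder right_diff_distrib mult.assoc)
  also have "f ^ k * h = poly_at [:2 * of_nat k, 1:] h * f ^ k"
    using f_poly[of k "[:0, 1:]"]
    by (simp add: poly_at_pCons poly_at_0 scaleC_one pcompose_pCons)
  also have "f ^ k * e * f = e * f ^ Suc k - of_nat k *\<^sub>C (poly_at [:of_nat k - 1, 1:] h * f ^ k)"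
    unfolding Suc.IH
    by (cases k) (simp_all add: left_diff_distrib mult_scaleC_left mult.assoc power_commutes)
  finally have "f ^ Suc k * e = e * f ^ Suc k
      - poly_at (smult (of_nat k) [:of_nat k - 1, 1:] + [:2 * of_nat k, 1:]) h * f ^ k"
    by (simp only: poly_at_add poly_at_smult distrib_right mult_scaleC_left diff_diff_eq)
  also have "smult (of_nat k) [:of_nat k - 1, 1:] + [:2 * of_nat k, 1:]
      = smult (of_nat (Suc k)) [:of_nat (Suc k) - 1, 1 :: complex:]"
    by (simp add: algebra_simps)
  finally show ?case by (simp only: poly_at_smult mult_scaleC_left diff_Suc_1)
qed simp

lemma f_e_power: "f * e ^ i = e ^ i * f - of_nat i *\<^sub>C (e ^ (i - 1) * poly_at [:of_nat i - 1, 1:] h)"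
proof (induction i)
  case (Suc i)
  have "f * e ^ Suc i = (f * e ^ i) * e" by (simp add: power_Suc2 mult.assoc del: power_Suc)
  also have "\<dots> = e ^ i * (f * e) - of_nat i *\<^sub>C (e ^ (i - 1) * (poly_at [:of_nat i - 1, 1:] h * e))"
    by (simp add: Suc.IH left_diff_distrib mult_scaleC_left mult.assoc)
  also have "poly_at [:of_nat i - 1, 1:] h * e = e * poly_at [:of_nat i + 1, 1:] h"
    by (simp add: poly_at_shift[OF he] pcompose_pCons add.commute)
  also have "of_nat i *\<^sub>C (e ^ (i - 1) * (e * poly_at [:of_nat i + 1, 1:] h))
      = of_nat i *\<^sub>C (e ^ i * poly_at [:of_nat i + 1, 1:] h)"
    by (cases i) (simp_all add: power_commutes flip: mult.assoc)
  also have "e ^ i * (f * e) = e ^ Suc i * f - e ^ i * poly_at [:0, 1:] h"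
    by (simp add: reorder right_diff_distrib power_commutes poly_at_pCons poly_at_0 scaleC_one
        flip: mult.assoc)
  finally have "f * e ^ Suc i = e ^ Suc i * f
      - e ^ i * poly_at (smult (of_nat i) [:of_nat i + 1, 1:] + [:0, 1:]) h"
    by (simp only: poly_at_add poly_at_smult distrib_left mult_scaleC_right diff_diff_eq
        add.commute)
  also have "smult (of_nat i) [:of_nat i + 1, 1:] + [:0, 1:]
      = smult (of_nat (Suc i)) [:of_nat (Suc i) - 1, 1 :: complex:]"
    by (simp add: algebra_simps)
  finally show ?case by (simp only: poly_at_smult mult_scaleC_right diff_Suc_1)
qed simp


lemma normal_forms_multI:
  assumes "\<And>a b \<epsilon> i p k. \<epsilon> \<le> 1 \<Longrightarrow> a = 0 \<or> k = 0 \<Longrightarrow> normal_monomial a b \<epsilon> i p k * x \<in> normal_forms"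
    and "u \<in> normal_forms"
  shows "u * x \<in> normal_forms"
  using assms(2) unfolding normal_forms_def
proof (induction rule: complex_vector.span_induct_alt)
  case base show ?case by (simp add: complex_vector.span_zero)
next
  case (step c v w)
  have "v * x \<in> normal_forms"
    using step(1) assms(1) ideal_in_normal_forms ideal_rmult[OF ideal_I]
    by (auto simp: normal_indices_def)
  then show ?case
    using normal_forms_add[OF normal_forms_scaleC] step(2)
    by (simp add: distrib_right mult_scaleC_left normal_forms_def)
qed

lemma normal_forms_mult_h: "u \<in> normal_forms \<Longrightarrow> u * h \<in> normal_forms"
proof (rule normal_forms_multI)
  fix a b \<epsilon> i k :: nat and p :: "complex poly" assume nf: "\<epsilon> \<le> 1" "a = 0 \<or> k = 0"
  have "f ^ k * h = poly_at [:2 * of_nat k, 1:] h * f ^ k"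
    using f_poly[of k "[:0, 1:]"] by (simp add: poly_at_pCons poly_at_0 scaleC_one pcompose_pCons)
  then have "normal_monomial a b \<epsilon> i p k * h = normal_monomial a b \<epsilon> i (p * [:2 * of_nat k, 1:]) k"
    by (simp only: normal_monomial_def poly_at_mult mult.assoc)
  then show "normal_monomial a b \<epsilon> i p k * h \<in> normal_forms"
    using normal_monomial_in[OF nf] by simp
qed

lemma normal_forms_mult_e: "u \<in> normal_forms \<Longrightarrow> u * e \<in> normal_forms"
proof (rule normal_forms_multI)
  fix a b \<epsilon> i k :: nat and p :: "complex poly" assume nf: "\<epsilon> \<le> 1" "a = 0 \<or> k = 0"
  let ?p = "pcompose p [:2, 1:]"
  have "poly_at p h * (f ^ k * e) = e * poly_at ?p h * f ^ k
      - of_nat k *\<^sub>C (poly_at (p * [:of_nat k - 1, 1:]) h * f ^ (k - 1))"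
    by (simp only: f_power_e right_diff_distrib mult_scaleC_right poly_at_mult poly_at_shift[OF he]
        flip: mult.assoc)
  then have "bar_monomial a b \<epsilon> * e ^ i * (poly_at p h * (f ^ k * e))
      = bar_monomial a b \<epsilon> * e ^ i * (e * poly_at ?p h * f ^ k
      - of_nat k *\<^sub>C (poly_at (p * [:of_nat k - 1, 1:]) h * f ^ (k - 1)))"
    by simp
  then have "normal_monomial a b \<epsilon> i p k * e = normal_monomial a b \<epsilon> (Suc i) ?p k
      - of_nat k *\<^sub>C normal_monomial a b \<epsilon> i (p * [:of_nat k - 1, 1:]) (k - 1)"
    by (simp only: normal_monomial_def power_Suc2 mult.assoc right_diff_distrib mult_scaleC_right)
  then show "normal_monomial a b \<epsilon> i p k * e \<in> normal_forms"
    using nf by (simp, intro normal_forms_diff normal_forms_scaleC normal_monomial_in) auto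
qed

text \<open>
  The only case that needs the relation for \<open>E f\<close>: moving \<open>f\<close> to the left until it meets \<open>E\<close> and
  replacing \<open>E f\<close> by \<open>- H h/2 - F e\<close>.
\<close>

lemma bar_commute_sl2:
  "f * (F ^ b * u) = F ^ b * (f * u)" "h * F ^ b = F ^ b * h - (2 * of_nat b) *\<^sub>C F ^ b"
  "e * F ^ b = F ^ b * e + of_nat b *\<^sub>C (F ^ (b - 1) * H)"
proof -
  show "f * (F ^ b * u) = F ^ b * (f * u)"
    by (induction b) (simp_all add: mult.assoc reorder_left)
  show "h * F ^ b = F ^ b * h - (2 * of_nat b) *\<^sub>C F ^ b"
  proof (induction b)
    case (Suc b)
    have "h * F ^ Suc b = F * (h * F ^ b) - 2 *\<^sub>C (F * F ^ b)"
      by (simp add: reorder_left numeral_scaleC)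
    then show ?case
      by (simp add: Suc.IH right_diff_distrib mult_scaleC_right mult.assoc distrib_left
          scaleC_add_left diff_diff_eq add.commute)
  qed simp
  show "e * F ^ b = F ^ b * e + of_nat b *\<^sub>C (F ^ (b - 1) * H)"
  proof (induction b)
    case (Suc b)
    have HF: "H * F ^ b = F ^ b * H" by (induction b) (simp_all add: reorder_left mult.assoc)
    have "e * F ^ Suc b = F * (e * F ^ b) + H * F ^ b" by (simp add: reorder_left)
    also have "\<dots> = F * F ^ b * e + of_nat b *\<^sub>C (F * (F ^ (b - 1) * H)) + F ^ b * H"
      by (simp add: Suc.IH HF distrib_left mult_scaleC_right mult.assoc)
    also have "of_nat b *\<^sub>C (F * (F ^ (b - 1) * H)) = of_nat b *\<^sub>C (F ^ b * H)"
      by (cases b) (simp_all add: mult.assoc)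
    finally show ?case by (simp add: scaleC_add_left algebra_simps)
  qed simp
qed

lemma normal_forms_E_f:
  assumes "\<epsilon> \<le> 1"
  shows "E ^ a * (E * (F ^ b * H ^ \<epsilon> * e ^ i) * f) * poly_at p h \<in> normal_forms"
proof -
  let ?r = "F ^ b * H ^ \<epsilon> * e ^ i"
  \<comment> \<open>quantified over \<open>a\<close> and \<open>p\<close>, so that powers of \<open>E\<close> on the left and polynomials in \<open>h\<close> on the
    right can be ignored\<close>
  let ?ok = "\<lambda>v. \<forall>a p. E ^ a * v * poly_at p h \<in> normal_forms"
  have ok_add: "?ok v \<Longrightarrow> ?ok w \<Longrightarrow> ?ok (v + w)" for v w
    using normal_forms_add by (simp add: distrib_left distrib_right)
  have ok_scale: "?ok v \<Longrightarrow> ?ok (c *\<^sub>C v)" for v c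
    using normal_forms_scaleC by (simp add: mult_scaleC_left mult_scaleC_right)
  have ok_ideal: "?ok v" if "v \<in> I" for v
    using that by (simp add: ideal_in_normal_forms ideal_rmult[OF ideal_I] ideal_lmult[OF ideal_I])
  have ok_mono: "?ok (E ^ a' * F ^ b * H ^ \<epsilon> * e ^ i * poly_at q h)" for a' b \<epsilon> i q
  proof (intro allI)
    fix a p
    have "E ^ a * (E ^ a' * F ^ b * H ^ \<epsilon> * e ^ i * poly_at q h) * poly_at p h
        = bar_monomial (a + a') b \<epsilon> * e ^ i * poly_at (q * p) h"
      by (simp only: bar_monomial_def power_add poly_at_mult mult.assoc)
    then show "E ^ a * (E ^ a' * F ^ b * H ^ \<epsilon> * e ^ i * poly_at q h) * poly_at p h \<in> normal_forms"
      using bar_monomial_in by simp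
  qed
  have ok_bar: "?ok (E ^ a' * F ^ b * H ^ \<epsilon> * e ^ i)" for a' b \<epsilon> i
    using ok_mono[of a' b \<epsilon> i 1] by (simp add: poly_at_1)
  have ok_h: "?ok (E ^ a' * F ^ b * H ^ \<epsilon> * e ^ i * h)" for a' b \<epsilon> i
    using ok_mono[of a' b \<epsilon> i "[:0, 1:]"] by (simp add: poly_at_pCons poly_at_0 scaleC_one)
  have he_power: "h * e ^ n = e ^ n * h + (2 * of_nat n) *\<^sub>C e ^ n" for n
  proof (induction n)
    case (Suc n)
    have "h * e ^ Suc n = e * (h * e ^ n) + 2 *\<^sub>C (e * e ^ n)"
      by (simp add: reorder_left numeral_scaleC)
    then show ?case
      by (simp add: Suc.IH distrib_left mult_scaleC_right mult.assoc scaleC_add_left add.commute)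
  qed simp
  have \<epsilon>: "\<epsilon> = 0 \<or> \<epsilon> = 1" using assms by auto
  have fr: "?r * f = f * ?r + (- (2 * of_nat \<epsilon>)) *\<^sub>C (E ^ 0 * F ^ Suc b * H ^ 0 * e ^ i)
      + of_nat i *\<^sub>C (E ^ 0 * F ^ b * H ^ \<epsilon> * e ^ (i - 1) * poly_at [:of_nat i - 1, 1:] h)"
  proof -
    have "f * ?r = F ^ b * (f * (H ^ \<epsilon> * e ^ i))"
      by (simp add: mult.assoc bar_commute_sl2)
    also have "f * (H ^ \<epsilon> * e ^ i) = H ^ \<epsilon> * (f * e ^ i) + (2 * of_nat \<epsilon>) *\<^sub>C (F * e ^ i)"
      using \<epsilon> by (auto simp: reorder_left numeral_scaleC)
    moreover have "F ^ b * (F * u) = F * (F ^ b * u)" for u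
      by (simp add: power_commutes flip: mult.assoc)
    ultimately show ?thesis
      by (simp add: f_e_power algebra_simps mult_scaleC_right minus_scaleC)
  qed
  have rel: "E * (f * ?r) = (1 / 2) *\<^sub>C ((casimir - 0 *\<^sub>C 1) * ?r)
      + (- (1 / 2)) *\<^sub>C (H * (h * ?r)) + (- 1) *\<^sub>C (F * (e * ?r))"
    by (simp add: casimir_def distrib_right numeral_scaleC mult_scaleC_left scaleC_add_right
        scaleC_scaleC minus_scaleC scaleC_one mult.assoc)
  have ok_H: "?ok (H * (h * ?r))"
  proof -
    have hH: "h * (H ^ \<epsilon> * e ^ i) = H ^ \<epsilon> * (e ^ i * h + (2 * of_nat i) *\<^sub>C e ^ i)"
      using \<epsilon> by (auto simp: reorder_left he_power)
    have HF: "H * (F ^ b * u) = F ^ b * (H * u)" for u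
      by (induction b) (simp_all add: reorder_left mult.assoc)
    have "h * ?r = h * F ^ b * (H ^ \<epsilon> * e ^ i)" by (simp add: mult.assoc)
    also have "\<dots> = F ^ b * (h * (H ^ \<epsilon> * e ^ i)) - (2 * of_nat b) *\<^sub>C (F ^ b * (H ^ \<epsilon> * e ^ i))"
      by (simp add: bar_commute_sl2 left_diff_distrib mult_scaleC_left mult.assoc)
    finally have "H * (h * ?r) = E ^ 0 * F ^ b * H ^ Suc \<epsilon> * e ^ i * h
        + (2 * of_nat i - 2 * of_nat b) *\<^sub>C (E ^ 0 * F ^ b * H ^ Suc \<epsilon> * e ^ i)"
      by (simp add: hH HF distrib_left right_diff_distrib mult_scaleC_right mult.assoc
          complex_vector.scale_left_diff_distrib)
    then show ?thesis by (simp only:) (intro ok_add ok_scale ok_h ok_bar)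
  qed
  have ok_F: "?ok (F * (e * ?r))"
  proof -
    have eH: "e * (H ^ \<epsilon> * e ^ i) = H ^ \<epsilon> * e ^ Suc i - (2 * of_nat \<epsilon>) *\<^sub>C (E * e ^ i)"
      using \<epsilon> by (auto simp: reorder_left numeral_scaleC)
    have FE: "F ^ n * (E * u) = E * (F ^ n * u)" for n u
      by (induction n) (simp_all add: reorder_left mult.assoc)
    have "e * ?r = e * F ^ b * (H ^ \<epsilon> * e ^ i)" by (simp add: mult.assoc)
    also have "\<dots> = F ^ b * (e * (H ^ \<epsilon> * e ^ i)) + of_nat b *\<^sub>C (F ^ (b - 1) * H * (H ^ \<epsilon> * e ^ i))"
      by (simp add: bar_commute_sl2 distrib_right mult_scaleC_left mult.assoc)
    finally have "F * (e * ?r) = E ^ 0 * F ^ Suc b * H ^ \<epsilon> * e ^ Suc i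
        + (- (2 * of_nat \<epsilon>)) *\<^sub>C (E ^ 1 * F ^ Suc b * H ^ 0 * e ^ i)
        + of_nat b *\<^sub>C (E ^ 0 * F ^ Suc (b - 1) * H ^ Suc \<epsilon> * e ^ i)"
      by (simp add: eH FE reorder_left distrib_left right_diff_distrib mult_scaleC_right mult.assoc
          minus_scaleC)
    then show ?thesis by (simp only:) (intro ok_add ok_scale ok_bar)
  qed
  have "?ok (E * (f * ?r))"
    unfolding rel by (rule ok_add[OF ok_add[OF ok_scale[OF ok_ideal[OF ideal_rmult[OF ideal_I
      casimir_in]]] ok_scale[OF ok_H]] ok_scale[OF ok_F]])
  moreover have "E * (?r * f) = E * (f * ?r)
      + (- (2 * of_nat \<epsilon>)) *\<^sub>C (E ^ 1 * F ^ Suc b * H ^ 0 * e ^ i)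
      + of_nat i *\<^sub>C (E ^ 1 * F ^ b * H ^ \<epsilon> * e ^ (i - 1) * poly_at [:of_nat i - 1, 1:] h)"
    unfolding fr
    by (simp add: distrib_left right_diff_distrib mult_scaleC_right mult.assoc minus_scaleC)
  ultimately have "?ok (E * (?r * f))"
    by (simp only:) (intro ok_add ok_scale ok_bar ok_mono)
  then show ?thesis by (simp add: mult.assoc)
qed

lemma normal_forms_mult_f: "u \<in> normal_forms \<Longrightarrow> u * f \<in> normal_forms"
proof (rule normal_forms_multI)
  fix a b \<epsilon> i k :: nat and p :: "complex poly" assume nf: "\<epsilon> \<le> 1" "a = 0 \<or> k = 0"
  show "normal_monomial a b \<epsilon> i p k * f \<in> normal_forms"
  proof (cases a)
    case 0
    then show ?thesis
      using normal_monomial_in[of \<epsilon> 0 "Suc k"] nf(1)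
      by (simp add: normal_monomial_def mult.assoc power_commutes)
  next
    case (Suc a')
    let ?p = "pcompose p [:- 2, 1:]"
    have hf: "h * f - f * h = (- 2) *\<^sub>C f" by (simp add: reorder minus_scaleC numeral_scaleC)
    have "normal_monomial a b \<epsilon> i p k * f = E ^ a' * E * F ^ b * H ^ \<epsilon> * e ^ i * (poly_at p h * f)"
      using nf(2) Suc by (simp add: normal_monomial_def bar_monomial_def mult.assoc power_commutes)
    also have "\<dots> = E ^ a' * (E * (F ^ b * H ^ \<epsilon> * e ^ i) * f) * poly_at ?p h"
      by (simp only: poly_at_shift[OF hf] mult.assoc)
    finally show ?thesis using normal_forms_E_f[OF nf(1)] by simp
  qed
qed

text \<open>The levels are built by factors \<open>E, H, F\<close> on the left and \<open>e, h, f\<close> on the right.  The latter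
  preserve the span of the normal monomials; the former are absorbed by proving the claim for all
  products with a monomial in \<open>E, F, H\<close> on the left.\<close>

theorem normal_forms_exhaust: "u \<in> normal_forms"
proof -
  have "level d u \<Longrightarrow> bar_monomial a b \<epsilon> * u \<in> normal_forms" for d a b \<epsilon>
  proof (induction arbitrary: a b \<epsilon> rule: level.induct)
    case (zero d)
    show ?case using ideal_in_normal_forms[OF ideal_zero[OF ideal_I]] by simp
  next
    case (one d)
    show ?case using bar_monomial_in[of a b \<epsilon> 0 1] by (simp add: poly_at_1)
  next
    case (add d u v)
    then show ?case by (simp add: distrib_left normal_forms_add)
  next
    case (scale d u c)
    then show ?case by (simp add: mult_scaleC_right normal_forms_scaleC)
  next
    case (bar d u z)
    then show ?case
      using bar_monomial_E bar_monomial_F bar_monomial_H by (auto simp flip: mult.assoc)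
  next
    case (right d u x)
    then show ?case
      using normal_forms_mult_e normal_forms_mult_f normal_forms_mult_h by (auto simp flip: mult.assoc)
  next
    case (weaken d u)
    then show ?case by blast
  qed
  from this[of _ 0 0 0] show ?thesis
    using level_exhausts[of u] by (auto simp: bar_monomial_def)
qed

lemma normal_form_decomposition:
  "\<exists>K p. finite K \<and> K \<subseteq> normal_indices \<and>
    u - (\<Sum>(a, b, \<epsilon>, i, k)\<in>K. normal_monomial a b \<epsilon> i (p (a, b, \<epsilon>, i, k)) k) \<in> I"
  using normal_forms_exhaust[of u] unfolding normal_forms_def
proof (induction rule: complex_vector.span_induct_alt)
  case base
  show ?case by (rule exI[of _ "{}"]) (simp add: ideal_zero[OF ideal_I])
next
  case (step c v w)
  define M where "M = (\<lambda>p (a, b, \<epsilon>, i, k). normal_monomial a b \<epsilon> i (p (a, b, \<epsilon>, i, k)) k)"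
  obtain K p where K: "finite K" "K \<subseteq> normal_indices" and w: "w - sum (M p) K \<in> I"
    using step(2) by (auto simp: M_def)
  have M_add: "M (\<lambda>t. p t + q t) t = M p t + M q t" for p q t
    by (auto simp: M_def normal_monomial_def poly_at_add distrib_left distrib_right split: prod.split)
  have "\<exists>K p. finite K \<and> K \<subseteq> normal_indices \<and> c *\<^sub>C v + w - sum (M p) K \<in> I"
  proof (cases "v \<in> I")
    case True
    have "c *\<^sub>C v + (w - sum (M p) K) \<in> I"
      by (intro ideal_add[OF ideal_I] ideal_scaleC[OF ideal_I] True w)
    then show ?thesis
      using K by (auto simp: add_diff_eq)
  next
    case False
    then obtain a b \<epsilon> i r k where v: "v = normal_monomial a b \<epsilon> i r k"
      and m: "(a, b, \<epsilon>, i, k) \<in> normal_indices" using step(1) by blast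
    let ?m = "(a, b, \<epsilon>, i, k)"
    define p' where "p' = (\<lambda>k. if k \<in> K then p k else 0)"
    define r' where "r' = (\<lambda>t. if t = ?m then smult c r else 0)"
    have "sum (M p) K = sum (M p') (insert ?m K)"
      using K by (intro sum.mono_neutral_cong_left)
        (auto simp: M_def p'_def normal_monomial_def poly_at_0)
    moreover have "c *\<^sub>C v = sum (M r') (insert ?m K)"
    proof -
      have "sum (M r') (insert ?m K) = (\<Sum>t\<in>insert ?m K. if t = ?m then c *\<^sub>C v else 0)"
      proof (intro sum.cong refl)
        fix t
        show "M r' t = (if t = ?m then c *\<^sub>C v else 0)"
        proof (cases "t = ?m")
          case True
          then show ?thesis
            by (simp add: M_def r'_def v normal_monomial_def poly_at_smult mult_scaleC_right
                mult_scaleC_left)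
        next
          case False
          then have "r' t = 0" by (simp add: r'_def)
          then have "M r' t = 0"
            by (cases t) (simp add: M_def normal_monomial_def poly_at_0)
          then show ?thesis using False by (simp only: if_False)
        qed
      qed
      then show ?thesis using K by simp
    qed
    moreover have "sum (M (\<lambda>t. r' t + p' t)) S = sum (M r') S + sum (M p') S" for S
      unfolding sum.distrib[symmetric] by (rule sum.cong[OF refl M_add])
    ultimately have eq: "c *\<^sub>C v + w - sum (M (\<lambda>t. r' t + p' t)) (insert ?m K) = w - sum (M p) K"
      by simp
    show ?thesis
      by (rule exI[of _ "insert ?m K"], rule exI[of _ "\<lambda>t. r' t + p' t"])
        (unfold eq, use K m w in simp)
  qed
  then show ?case by (simp add: M_def)
qed

end


section \<open>The enveloping algebra of the Takiff algebra\<close>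

lemma abs_uea_single:
  "abs_uea (Poly_Mapping.single (Word ws) c) = c *\<^sub>C prod_list (map uea_gen ws)"
proof (induction ws)
  case Nil
  show ?case by (simp add: one_uea.abs_eq scaleC_uea.abs_eq free_scale_def zero_word_def)
next
  case (Cons x ws)
  have "Poly_Mapping.single (Word (x # ws)) c = free_gen x * Poly_Mapping.single (Word ws) c"
    by (simp add: free_gen_def mult_single plus_word_def)
  then show ?case
    by (simp add: Cons mult_scaleC_right uea_gen.abs_eq flip: times_uea.abs_eq)
qed

lemma uea_words_induct:
  assumes add: "\<And>u v. P u \<Longrightarrow> P v \<Longrightarrow> P (u + v)" and scale: "\<And>c u. P u \<Longrightarrow> P (c *\<^sub>C u)"
    and words: "\<And>ws. P (prod_list (map uea_gen ws))"
  shows "P u"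
proof (induction u rule: uea.abs_induct)
  case (1 p)
  have "P (abs_uea (sum f S))"
    if "\<And>i. i \<in> S \<Longrightarrow> \<exists>w c. f i = Poly_Mapping.single w c" for f :: "_ \<Rightarrow> _ free_algebra" and S
    using that
  proof (induction S rule: infinite_finite_induct)
    case (insert i S)
    obtain w c where "f i = Poly_Mapping.single w c" using insert.prems by blast
    then have "P (abs_uea (f i))" by (cases w) (simp add: abs_uea_single scale words)
    then show ?case using insert by (simp add: add flip: plus_uea.abs_eq)
  qed (use scale[OF words[of "[]"], of 0] in \<open>simp_all add: zero_uea.abs_eq\<close>)
  from this[of "Poly_Mapping.keys p" "\<lambda>w. Poly_Mapping.single w (Poly_Mapping.lookup p w)"]
  show ?case unfolding poly_mapping_sum_single by blast
qed

lemma uea_induct_left [case_names one add scale gen]: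
  assumes "P 1" "\<And>u v. P u \<Longrightarrow> P v \<Longrightarrow> P (u + v)" "\<And>c u. P u \<Longrightarrow> P (c *\<^sub>C u)"
    and "\<And>x u. P u \<Longrightarrow> P (uea_gen x * u)"
  shows "P u"
proof (rule uea_words_induct[of P])
  show "P (prod_list (map uea_gen ws))" for ws
    by (induction ws) (simp_all add: assms)
qed (use assms in auto)

lemma uea_induct_right [case_names one add scale gen]:
  assumes "P 1" "\<And>u v. P u \<Longrightarrow> P v \<Longrightarrow> P (u + v)" "\<And>c u. P u \<Longrightarrow> P (c *\<^sub>C u)"
    and "\<And>x u. P u \<Longrightarrow> P (u * uea_gen x)"
  shows "P u"
proof (rule uea_words_induct[of P])
  show "P (prod_list (map uea_gen ws))" for ws
    by (induction ws rule: rev_induct) (simp_all add: assms)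
qed (use assms in auto)

lemma uea_gen_takiff:
  "uea_gen (Takiff x y) =
     coeff_e x *\<^sub>C \<iota> sl2_e + coeff_h x *\<^sub>C \<iota> sl2_h + coeff_f x *\<^sub>C \<iota> sl2_f
   + coeff_e y *\<^sub>C \<iota>\<^sub>t sl2_e + coeff_h y *\<^sub>C \<iota>\<^sub>t sl2_h + coeff_f y *\<^sub>C \<iota>\<^sub>t sl2_f"
  unfolding uea_gen_add[symmetric] uea_gen_scaleC[symmetric]
  by (simp add: takiff_simps sl2_simps sl2_e_def sl2_h_def sl2_f_def)

global_interpretation takiff: takiff_algebra
  "\<iota> sl2_e" "\<iota> sl2_h" "\<iota> sl2_f" "\<iota>\<^sub>t sl2_e" "\<iota>\<^sub>t sl2_h" "\<iota>\<^sub>t sl2_f"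
proof
  note br = takiff_simps sl2_simps sl2_e_def sl2_h_def sl2_f_def
  have minus: "- uea_gen x = uea_gen (- x)" for x :: takiff_sl2
    using uea_gen_scaleC[of "- 1" x] by (simp add: minus_scaleC scaleC_one)
  show "\<iota> sl2_e * \<iota> sl2_f - \<iota> sl2_f * \<iota> sl2_e = \<iota> sl2_h"
    "\<iota> sl2_h * \<iota> sl2_e - \<iota> sl2_e * \<iota> sl2_h = 2 * \<iota> sl2_e"
    "\<iota> sl2_h * \<iota> sl2_f - \<iota> sl2_f * \<iota> sl2_h = - (2 * \<iota> sl2_f)"
    "\<iota> sl2_e * \<iota>\<^sub>t sl2_f - \<iota>\<^sub>t sl2_f * \<iota> sl2_e = \<iota>\<^sub>t sl2_h"
    "\<iota>\<^sub>t sl2_e * \<iota> sl2_f - \<iota> sl2_f * \<iota>\<^sub>t sl2_e = \<iota>\<^sub>t sl2_h"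
    "\<iota> sl2_h * \<iota>\<^sub>t sl2_e - \<iota>\<^sub>t sl2_e * \<iota> sl2_h = 2 * \<iota>\<^sub>t sl2_e"
    "\<iota> sl2_h * \<iota>\<^sub>t sl2_f - \<iota>\<^sub>t sl2_f * \<iota> sl2_h = - (2 * \<iota>\<^sub>t sl2_f)"
    "\<iota>\<^sub>t sl2_h * \<iota> sl2_e - \<iota> sl2_e * \<iota>\<^sub>t sl2_h = 2 * \<iota>\<^sub>t sl2_e"
    "\<iota>\<^sub>t sl2_h * \<iota> sl2_f - \<iota> sl2_f * \<iota>\<^sub>t sl2_h = - (2 * \<iota>\<^sub>t sl2_f)"
    by (simp_all add: numeral_scaleC minus br flip: uea_gen_bracket uea_gen_scaleC)
  have comm: "a * b = b * a" if "lie_bracket x y = 0" "a = uea_gen x" "b = uea_gen y"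
    for x y :: takiff_sl2 and a b
    using uea_gen_bracket[of x y] uea_gen_scaleC[of 0 0] that
    by (metis right_minus_eq complex_vector.scale_zero_left)
  show "\<iota> sl2_e * \<iota>\<^sub>t sl2_e = \<iota>\<^sub>t sl2_e * \<iota> sl2_e"
    "\<iota> sl2_h * \<iota>\<^sub>t sl2_h = \<iota>\<^sub>t sl2_h * \<iota> sl2_h"
    "\<iota> sl2_f * \<iota>\<^sub>t sl2_f = \<iota>\<^sub>t sl2_f * \<iota> sl2_f"
    "\<iota>\<^sub>t sl2_f * \<iota>\<^sub>t sl2_e = \<iota>\<^sub>t sl2_e * \<iota>\<^sub>t sl2_f"
    "\<iota>\<^sub>t sl2_h * \<iota>\<^sub>t sl2_e = \<iota>\<^sub>t sl2_e * \<iota>\<^sub>t sl2_h"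
    "\<iota>\<^sub>t sl2_h * \<iota>\<^sub>t sl2_f = \<iota>\<^sub>t sl2_f * \<iota>\<^sub>t sl2_h"
    by (rule comm[OF _ refl refl], simp add: br)+
next
  fix P :: "takiff_sl2 uea \<Rightarrow> bool" and u
  assume P: "P 1" "\<And>u v. P u \<Longrightarrow> P v \<Longrightarrow> P (u + v)" "\<And>c u. P u \<Longrightarrow> P (c *\<^sub>C u)"
    "\<And>u g. P u \<Longrightarrow> g \<in> {\<iota> sl2_e, \<iota> sl2_h, \<iota> sl2_f, \<iota>\<^sub>t sl2_e, \<iota>\<^sub>t sl2_h, \<iota>\<^sub>t sl2_f} \<Longrightarrow> P (u * g)"
  show "P u"
  proof (induction u rule: uea_induct_right)
    case (gen x u)
    obtain a b where x: "x = Takiff a b" by (cases x)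
    show ?case
      unfolding x uea_gen_takiff[of a b] distrib_left mult_scaleC_right
      by (intro P(2) P(3) P(4)[OF gen]) simp_all
  qed (fact P)+
qed

lemma takiff_casimir: "takiff.casimir = takiff_C" "takiff.casimir_bar = takiff_C_bar"
  by (simp_all add: takiff.casimir_def takiff.casimir_bar_def takiff_C_def takiff_C_bar_def)

global_interpretation character: takiff_central_ideal
  "\<iota> sl2_e" "\<iota> sl2_h" "\<iota> sl2_f" "\<iota>\<^sub>t sl2_e" "\<iota>\<^sub>t sl2_h" "\<iota>\<^sub>t sl2_f" "ideal_I \<chi> \<theta>" \<theta> \<chi>
  for \<chi> \<theta>
proof
  show "two_sided_ideal (ideal_I \<chi> \<theta>)"
    unfolding ideal_I_def by (rule two_sided_ideal_ideal_generated)
  show "takiff.casimir - \<theta> *\<^sub>C 1 \<in> ideal_I \<chi> \<theta>" "takiff.casimir_bar - \<chi> *\<^sub>C 1 \<in> ideal_I \<chi> \<theta>"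
    unfolding ideal_I_def takiff_casimir using ideal_generated_superset by blast+
qed

lemma (in left_module) two_sided_ideal_annihilator: "two_sided_ideal (annihilator act V)"
  unfolding two_sided_ideal_def annihilator_def
  by (auto simp: act_zero_left act_add_left act_mult act_zero_right act_closed)

lemma (in left_module) one_notin_annihilator: "V \<noteq> {0} \<Longrightarrow> 1 \<notin> annihilator act V"
  unfolding annihilator_def using act_one zero_closed by force


global_interpretation zero_character: takiff_zero_character
  "\<iota> sl2_e" "\<iota> sl2_h" "\<iota> sl2_f" "\<iota>\<^sub>t sl2_e" "\<iota>\<^sub>t sl2_h" "\<iota>\<^sub>t sl2_f" "ideal_I 0 0"
  by unfold_locales


section \<open>A faithful representation of the quotient by the zero central character\<close>

text \<open>
  On (formal) Laurent series in \<open>x, y\<close> let \<open>e = x \<partial>\<^sub>y\<close>, \<open>h = x \<partial>\<^sub>x - y \<partial>\<^sub>y\<close>, \<open>f = y \<partial>\<^sub>x\<close>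
  and let \<open>E, H, F\<close> be multiplication by \<open>x\<^sup>2\<close>, \<open>- 2 x y\<close>, \<open>- y\<^sup>2\<close>.  The coefficient of
  \<open>x\<^sup>m y\<^sup>n\<close> in \<open>v\<close> is \<open>v m n\<close>.
\<close>

definition laurent_act :: "takiff_sl2 \<Rightarrow> (int \<Rightarrow> int \<Rightarrow> complex) \<Rightarrow> int \<Rightarrow> int \<Rightarrow> complex" where
  "laurent_act X v = (\<lambda>m n.
     coeff_e (part_1 X) * (of_int n + 1) * v (m - 1) (n + 1)
   + coeff_h (part_1 X) * (of_int m - of_int n) * v m n
   + coeff_f (part_1 X) * (of_int m + 1) * v (m + 1) (n - 1)
   + coeff_e (part_t X) * v (m - 2) n - 2 * coeff_h (part_t X) * v (m - 1) (n - 1)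
   - coeff_f (part_t X) * v m (n - 2))"

abbreviation laurent_scale :: "complex \<Rightarrow> (int \<Rightarrow> int \<Rightarrow> complex) \<Rightarrow> int \<Rightarrow> int \<Rightarrow> complex" where
  "laurent_scale c v \<equiv> \<lambda>m n. c * v m n"

global_interpretation laurent: lie_module laurent_scale laurent_act UNIV
proof -
  interpret vector_space laurent_scale
    by unfold_locales (simp_all add: fun_eq_iff algebra_simps)
  show "lie_module laurent_scale laurent_act UNIV"
    by unfold_locales
      (simp_all add: laurent_act_def takiff_simps sl2_simps fun_eq_iff algebra_simps)
qed

abbreviation laurent :: "takiff_sl2 uea \<Rightarrow> (int \<Rightarrow> int \<Rightarrow> complex) \<Rightarrow> int \<Rightarrow> int \<Rightarrow> complex" where
  "laurent \<equiv> uea_act laurent_scale laurent_act"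

lemmas laurent_simps = laurent.uea.act_add_left[OF UNIV_I] laurent.uea.act_diff_left[OF UNIV_I]
  laurent.uea.act_mult[OF UNIV_I] laurent.uea.act_one[OF UNIV_I]
  laurent.uea.act_zero_left[OF UNIV_I] laurent.uea_act_scaleC[OF UNIV_I]
  laurent.uea.act_add_right[OF UNIV_I UNIV_I] laurent.uea.act_zero_right

lemma laurent_gens:
  "laurent (\<iota> sl2_e) v = (\<lambda>m n. (of_int n + 1) * v (m - 1) (n + 1))"
  "laurent (\<iota> sl2_h) v = (\<lambda>m n. (of_int m - of_int n) * v m n)"
  "laurent (\<iota> sl2_f) v = (\<lambda>m n. (of_int m + 1) * v (m + 1) (n - 1))"
  "laurent (\<iota>\<^sub>t sl2_e) v = (\<lambda>m n. v (m - 2) n)"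
  "laurent (\<iota>\<^sub>t sl2_h) v = (\<lambda>m n. - 2 * v (m - 1) (n - 1))"
  "laurent (\<iota>\<^sub>t sl2_f) v = (\<lambda>m n. - v m (n - 2))"
  by (simp_all add: laurent.uea_act_gen laurent_act_def sl2_simps sl2_e_def sl2_h_def sl2_f_def)

lemma laurent_casimirs: "laurent takiff_C v = 0" "laurent takiff_C_bar v = 0"
  by (simp_all add: takiff_C_def takiff_C_bar_def power2_eq_square numeral_scaleC
      mult_scaleC_left laurent_simps laurent_gens fun_eq_iff algebra_simps)

lemma ideal_I_le_annihilator_laurent: "ideal_I 0 0 \<subseteq> annihilator laurent UNIV"
  unfolding ideal_I_def
  by (rule ideal_generated_minimal[OF laurent.uea.two_sided_ideal_annihilator])
    (auto simp: annihilator_def laurent_casimirs)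

definition laurent_monomial :: "complex \<Rightarrow> int \<Rightarrow> int \<Rightarrow> int \<Rightarrow> int \<Rightarrow> complex" where
  "laurent_monomial c m n = (\<lambda>m' n'. if m' = m \<and> n' = n then c else 0)"

lemma laurent_monomial_gens:
  "laurent (\<iota> sl2_e) (laurent_monomial c m n) = laurent_monomial (of_int n * c) (m + 1) (n - 1)"
  "laurent (\<iota> sl2_h) (laurent_monomial c m n) = laurent_monomial (of_int (m - n) * c) m n"
  "laurent (\<iota> sl2_f) (laurent_monomial c m n) = laurent_monomial (of_int m * c) (m - 1) (n + 1)"
  "laurent (\<iota>\<^sub>t sl2_e) (laurent_monomial c m n) = laurent_monomial c (m + 2) n"
  "laurent (\<iota>\<^sub>t sl2_h) (laurent_monomial c m n) = laurent_monomial (- 2 * c) (m + 1) (n + 1)"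
  "laurent (\<iota>\<^sub>t sl2_f) (laurent_monomial c m n) = laurent_monomial (- c) m (n + 2)"
  by (auto simp: laurent_gens laurent_monomial_def fun_eq_iff)

lemma laurent_monomial_poly:
  "laurent (poly_at p (\<iota> sl2_h)) (laurent_monomial c m n)
     = laurent_monomial (poly p (of_int (m - n)) * c) m n"
proof (induction p)
  case 0
  show ?case by (simp add: poly_at_0 laurent_simps laurent_monomial_def fun_eq_iff)
next
  case (pCons a p)
  then show ?case
    by (simp add: poly_at_pCons laurent_simps laurent_monomial_gens)
      (auto simp: laurent_monomial_def fun_eq_iff algebra_simps)
qed

lemma laurent_monomial_powers:
  "laurent (\<iota> sl2_e ^ k) (laurent_monomial c m n)
     = laurent_monomial ((\<Prod>j<k. of_int n - of_nat j) * c) (m + int k) (n - int k)"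
  "laurent (\<iota> sl2_f ^ k) (laurent_monomial c m n)
     = laurent_monomial ((\<Prod>j<k. of_int m - of_nat j) * c) (m - int k) (n + int k)"
  "laurent (\<iota>\<^sub>t sl2_e ^ k) (laurent_monomial c m n) = laurent_monomial c (m + 2 * int k) n"
  "laurent (\<iota>\<^sub>t sl2_h ^ k) (laurent_monomial c m n)
     = laurent_monomial ((- 2) ^ k * c) (m + int k) (n + int k)"
  "laurent (\<iota>\<^sub>t sl2_f ^ k) (laurent_monomial c m n)
     = laurent_monomial ((- 1) ^ k * c) m (n + 2 * int k)"
  by (induction k) (simp_all add: laurent_simps laurent_monomial_gens algebra_simps)

text \<open>On \<open>x\<^bsup>n+t\<^esup> y\<^sup>n\<close> with \<open>t\<close> fixed, a normal monomial acts with a shift of exponents and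
  a coefficient that is a polynomial of degree \<open>i + k\<close> in \<open>n\<close>.\<close>

definition action_poly :: "complex \<Rightarrow> nat \<Rightarrow> nat \<Rightarrow> complex poly" where
  "action_poly t i k = (\<Prod>j<i. [:of_nat k - of_nat j, 1:]) * (\<Prod>j<k. [:t - of_nat j, 1:])"

lemma action_poly: "lead_coeff (action_poly t i k) = 1" "degree (action_poly t i k) = i + k"
proof -
  have *: "degree (\<Prod>j<k. [:a j, 1:]) = k" "lead_coeff (\<Prod>j<k. [:a j, 1:]) = 1"
    for k and a :: "nat \<Rightarrow> complex"
    by (simp add: degree_prod_eq_sum_degree, simp only: lead_coeff_prod, simp)
  show "lead_coeff (action_poly t i k) = 1"
    unfolding action_poly_def lead_coeff_mult *(2) by simp
  have "(\<Prod>j<k. [:a j, 1:]) \<noteq> 0" for k and a :: "nat \<Rightarrow> complex" by simp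
  then show "degree (action_poly t i k) = i + k"
    unfolding action_poly_def by (simp add: degree_mult_eq *(1))
qed

definition shift :: "nat \<times> nat \<times> nat \<times> nat \<times> nat \<Rightarrow> int \<times> int" where
  "shift = (\<lambda>(a, b, \<epsilon>, i, k).
     (2 * int a + int \<epsilon> + int i - int k, 2 * int b + int \<epsilon> - int i + int k))"

lemma laurent_normal_monomial:
  "laurent (zero_character.normal_monomial a b \<epsilon> i p k) (laurent_monomial 1 (n + t) n)
     = laurent_monomial
         ((- 1) ^ b * (- 2) ^ \<epsilon> * poly p (of_int t - 2 * of_nat k) * poly (action_poly (of_int t) i k) (of_int n))
         (n + t + fst (shift (a, b, \<epsilon>, i, k))) (n + snd (shift (a, b, \<epsilon>, i, k)))"
  unfolding zero_character.normal_monomial_def zero_character.bar_monomial_def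
  by (simp add: laurent_simps laurent_monomial_powers laurent_monomial_poly shift_def)
    (simp add: action_poly_def poly_prod algebra_simps)

text \<open>The first component of the shift is at least \<open>i + k\<close> if and only if \<open>k = 0\<close>, which separates
  the cases \<open>k = 0\<close> and \<open>a = 0\<close>.  In the former, \<open>i\<close> is known and then \<open>2 a + \<epsilon>\<close>; in the latter,
  \<open>2 i + \<epsilon>\<close> is known.\<close>

lemma normal_indices_determined:
  assumes "(a, b, \<epsilon>, i, k) \<in> zero_character.normal_indices"
    and "(a', b', \<epsilon>', i', k') \<in> zero_character.normal_indices"
    and "shift (a, b, \<epsilon>, i, k) = shift (a', b', \<epsilon>', i', k')" "i + k = i' + k'"
  shows "(a, b, \<epsilon>, i, k) = (a', b', \<epsilon>', i', k')"
proof -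
  have le: "\<epsilon> \<le> 1" "\<epsilon>' \<le> 1" and zero: "a = 0 \<or> k = 0" "a' = 0 \<or> k' = 0"
    and eq: "2 * int a + int \<epsilon> + int i - int k = 2 * int a' + int \<epsilon>' + int i' - int k'"
      "2 * int b + int \<epsilon> - int i + int k = 2 * int b' + int \<epsilon>' - int i' + int k'"
      "int i + int k = int i' + int k'"
    using assms unfolding zero_character.normal_indices_def shift_def by auto
  have parity: "x = y \<and> \<epsilon> = \<epsilon>'" if "2 * int x + int \<epsilon> = 2 * int y + int \<epsilon>'" for x y
    using le that by presburger
  consider "k = 0" "k' = 0" | "k = 0" "k' > 0" | "k > 0" "k' = 0" | "k > 0" "k' > 0" by blast
  then have "a = a' \<and> \<epsilon> = \<epsilon>' \<and> i = i' \<and> k = k'"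
  proof cases
    case 1 then show ?thesis using eq parity[of a a'] by simp
  next
    case 2
    then have "int i = int i' + int k'" "a' = 0" using eq zero by auto
    then have "2 * int a + int \<epsilon> + 2 * int k' = int \<epsilon>'" using eq(1) 2 by simp
    then show ?thesis using le 2 by linarith
  next
    case 3
    then have "int i' = int i + int k" "a = 0" using eq zero by auto
    then have "2 * int a' + int \<epsilon>' + 2 * int k = int \<epsilon>" using eq(1) 3 by simp
    then show ?thesis using le 3 by linarith
  next
    case 4
    then have a: "a = 0" "a' = 0" using zero by auto
    then have "2 * int i + int \<epsilon> = 2 * int i' + int \<epsilon>'" using eq by simp
    then show ?thesis using a eq parity[of i i'] by simp
  qed
  then show ?thesis using eq(2) by simp
qed

text \<open>Among the terms of a normal form with a given shift, take the one of highest degree.  For a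
  suitable difference \<open>d\<close> of exponents it contributes a leading coefficient that no other term
  can cancel, so the coefficient polynomial is not zero at all integers \<open>n\<close>.\<close>

theorem annihilator_laurent: "annihilator laurent UNIV = ideal_I 0 0"
proof
  show "ideal_I 0 0 \<subseteq> annihilator laurent UNIV" by (rule ideal_I_le_annihilator_laurent)
  show "annihilator laurent UNIV \<subseteq> ideal_I 0 0"
  proof
    fix u assume u: "u \<in> annihilator laurent UNIV"
    define M where "M = (\<lambda>p (a, b, \<epsilon>, i, k).
      zero_character.normal_monomial a b \<epsilon> i (p (a, b, \<epsilon>, i, k)) k)"
    obtain K p where K: "finite K" "K \<subseteq> zero_character.normal_indices"
      and p: "u - sum (M p) K \<in> ideal_I 0 0"
      using zero_character.normal_form_decomposition[of u] unfolding M_def by blast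
    have M0: "M p t = 0" if "p t = 0" for t
      using that by (cases t) (simp add: M_def zero_character.normal_monomial_def poly_at_0)
    have "p t = 0" if "t \<in> K" for t
    proof (rule ccontr)
      assume "p t \<noteq> 0"
      define deg where "deg = (\<lambda>(a :: nat, b :: nat, \<epsilon> :: nat, i, k). i + k :: nat)"
      define G where "G = {s \<in> K. p s \<noteq> 0 \<and> shift s = shift t}"
      have "finite G" "t \<in> G" using K that \<open>p t \<noteq> 0\<close> by (auto simp: G_def)
      then obtain s where s: "s \<in> G" "deg s = Max (deg ` G)"
        using Max_in[of "deg ` G"] by (metis empty_iff finite_imageI imageE image_is_empty)
      then have max: "deg r \<le> deg s" if "r \<in> G" for r
        using that \<open>finite G\<close> by simp
      obtain a b \<epsilon> i k where s_eq: "s = (a, b, \<epsilon>, i, k)" by (cases s)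
      have "finite {z. poly (p s) z = 0}" using s by (intro poly_roots_finite) (simp add: G_def)
      moreover have "infinite (range (\<lambda>t. of_int t - 2 * of_nat k :: complex))"
        by (simp add: finite_image_iff inj_on_def infinite_UNIV_int)
      ultimately obtain d where d: "poly (p s) (of_int d - 2 * of_nat k) \<noteq> 0"
        by (metis (mono_tags, lifting) finite_subset image_subset_iff mem_Collect_eq)
      define c where "c = (\<lambda>(a :: nat, b, \<epsilon>, i :: nat, k).
        (- 1) ^ b * (- 2) ^ \<epsilon> * poly (p (a, b, \<epsilon>, i, k)) (of_int d - 2 * of_nat k) :: complex)"
      define Q where "Q = (\<lambda>(a :: nat, b :: nat, \<epsilon> :: nat, i, k). action_poly (of_int d) i k)"
      have M_at: "laurent (M p r) (laurent_monomial 1 (n + d) n)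
          = laurent_monomial (c r * poly (Q r) (of_int n)) (n + d + fst (shift r)) (n + snd (shift r))"
        for r n
        by (cases r) (simp add: M_def c_def Q_def laurent_normal_monomial)
      define S where "S = (\<Sum>r\<in>G. smult (c r) (Q r))"
      have "poly S (of_int n) = 0" for n
      proof -
        have "sum (M p) K \<in> annihilator laurent UNIV"
          using ideal_diff[OF laurent.uea.two_sided_ideal_annihilator u
              subsetD[OF ideal_I_le_annihilator_laurent p]] by simp
        then have "laurent (sum (M p) K) (laurent_monomial 1 (n + d) n)
            (n + d + fst (shift t)) (n + snd (shift t)) = 0"
          by (simp add: annihilator_def)
        moreover have "laurent (sum g A) v x y = (\<Sum>r\<in>A. laurent (g r) v x y)"
          for g :: "nat \<times> nat \<times> nat \<times> nat \<times> nat \<Rightarrow> takiff_sl2 uea" and A v x y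
          by (induction A rule: infinite_finite_induct) (simp_all add: laurent_simps)
        ultimately have "0 = (\<Sum>r\<in>K. laurent (M p r) (laurent_monomial 1 (n + d) n)
            (n + d + fst (shift t)) (n + snd (shift t)))" by simp
        also have "\<dots> = (\<Sum>r\<in>G. c r * poly (Q r) (of_int n))"
        proof (rule sum.mono_neutral_cong_right[OF K(1)])
          show "G \<subseteq> K" by (auto simp: G_def)
          show "\<forall>r\<in>K - G. laurent (M p r) (laurent_monomial 1 (n + d) n)
            (n + d + fst (shift t)) (n + snd (shift t)) = 0"
          proof
            fix r assume "r \<in> K - G"
            then consider "p r = 0" | "shift r \<noteq> shift t" by (auto simp: G_def)
            then show "laurent (M p r) (laurent_monomial 1 (n + d) n)
              (n + d + fst (shift t)) (n + snd (shift t)) = 0"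
            proof cases
              case 1 then show ?thesis by (simp add: M0 laurent_simps)
            next
              case 2
              then show ?thesis unfolding M_at by (auto simp: laurent_monomial_def prod_eq_iff)
            qed
          qed
          show "laurent (M p r) (laurent_monomial 1 (n + d) n)
            (n + d + fst (shift t)) (n + snd (shift t)) = c r * poly (Q r) (of_int n)" if "r \<in> G" for r
            using that unfolding M_at by (simp add: laurent_monomial_def G_def)
        qed
        finally show ?thesis by (simp add: S_def poly_sum)
      qed
      then have "range of_int \<subseteq> {z. poly S z = 0}" by auto
      moreover have "infinite (range (of_int :: int \<Rightarrow> complex))"
        by (simp add: finite_image_iff inj_on_def infinite_UNIV_int)
      ultimately have "S = 0" using poly_roots_finite[of S] finite_subset by blast
      have "coeff S (deg s) = (\<Sum>r\<in>G. if r = s then c s else 0)"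
        unfolding S_def coeff_sum
      proof (rule sum.cong[OF refl])
        fix r assume r: "r \<in> G"
        obtain a' b' \<epsilon>' i' k' where r_eq: "r = (a', b', \<epsilon>', i', k')" by (cases r)
        show "coeff (smult (c r) (Q r)) (deg s) = (if r = s then c s else 0)"
        proof (cases "r = s")
          case True
          then show ?thesis using action_poly[of "of_int d" i k] by (simp add: Q_def deg_def s_eq)
        next
          case False
          have "deg r \<noteq> deg s"
          proof
            assume "deg r = deg s"
            moreover have "r \<in> zero_character.normal_indices" "s \<in> zero_character.normal_indices"
              "shift r = shift s"
              using r s(1) K(2) by (auto simp: G_def)
            ultimately have "r = s"
              unfolding r_eq s_eq by (intro normal_indices_determined) (simp_all add: deg_def)
            then show False using False by blast
          qed
          then have "degree (Q r) < deg s"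
            using max[OF r] action_poly[of "of_int d" i' k'] by (simp add: Q_def deg_def r_eq)
          then show ?thesis using False by (simp add: coeff_eq_0)
        qed
      qed
      also have "\<dots> = c s" using \<open>finite G\<close> s by simp
      finally show False using \<open>S = 0\<close> d by (simp add: c_def s_eq)
    qed
    then have "sum (M p) K = 0" using M0 by simp
    then show "u \<in> ideal_I 0 0" using p by simp
  qed
qed

text \<open>\<open>E\<close> acts on Laurent series by an invertible operator, so it is not a zero divisor modulo
  \<open>I(0, 0)\<close>, and the first alternative for an ideal above \<open>I(0, 0)\<close> is impossible.\<close>

theorem above_ideal_I_00:
  assumes J: "two_sided_ideal J" "ideal_I 0 0 \<subseteq> J" "J \<noteq> ideal_I 0 0"
  shows "\<exists>j. \<iota>\<^sub>t sl2_e ^ j \<in> J"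
proof -
  from character.ideal_dichotomy[OF J] show ?thesis
  proof (elim disjE bexE conjE)
    fix u assume u: "u \<in> J - ideal_I 0 0" "\<iota>\<^sub>t sl2_e * u \<in> ideal_I 0 0"
    have "laurent u v = 0" for v
    proof -
      have "laurent (\<iota>\<^sub>t sl2_e) (laurent u v) = 0"
        using u(2) by (simp add: laurent_simps annihilator_def flip: annihilator_laurent)
      then have "laurent u v (m + 2 - 2) n = 0" for m n
        unfolding laurent_gens by (metis zero_fun_apply)
      then show ?thesis by (simp add: fun_eq_iff)
    qed
    then have "u \<in> ideal_I 0 0" by (simp add: annihilator_def flip: annihilator_laurent)
    then show ?thesis using u by blast
  next
    fix u assume "u \<in> J - ideal_I 0 0" "takiff.level 1 u"
    then show ?thesis using character.level_1_power_in_ideal[OF J(1,2)] by blast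
  qed
qed


section \<open>Primitivity of the ideal of the zero central character\<close>

lemma poly_difference:
  fixes p :: "complex poly"
  assumes "degree p > 0" "s \<noteq> 0"
  shows "pcompose p [:s, 1:] - p \<noteq> 0" "degree (pcompose p [:s, 1:] - p) < degree p"
proof -
  show nz: "pcompose p [:s, 1:] - p \<noteq> 0"
  proof
    assume "pcompose p [:s, 1:] - p = 0"
    then have shift: "poly p (s + z) = poly p z" for z
      by (metis eq_iff_diff_eq_0 poly_pcompose poly_pCons poly_0 mult.right_neutral
          add.right_neutral mult_zero_right)
    have "poly p (of_nat n * s) = poly p 0" for n
      by (induction n) (simp_all add: distrib_right shift)
    then have "range (\<lambda>n. of_nat n * s) \<subseteq> {z. poly (p - [:poly p 0:]) z = 0}" by auto
    moreover have "infinite (range (\<lambda>n. of_nat n * s))"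
      using assms(2) by (simp add: finite_image_iff inj_on_def)
    ultimately have "p - [:poly p 0:] = 0"
      using poly_roots_finite finite_subset by blast
    then show False using assms(1) by (metis degree_pCons_0 eq_iff_diff_eq_0 less_irrefl)
  qed
  have deg: "degree (pcompose p [:s, 1:]) = degree p" by (simp add: degree_pcompose)
  have "coeff (pcompose p [:s, 1:]) (degree p) = lead_coeff p"
    using lead_coeff_comp[of "[:s, 1:]" p] deg by simp
  then have "coeff (pcompose p [:s, 1:] - p) (degree p) = 0" by simp
  moreover have "degree (pcompose p [:s, 1:] - p) \<le> degree p" by (rule degree_diff_le) (simp_all add: deg)
  ultimately show "degree (pcompose p [:s, 1:] - p) < degree p"
    using nz by (metis le_neq_implies_less leading_coeff_neq_0)
qed

text \<open>
  The simple module is generated by \<open>\<Sum>\<^sub>m x\<^sup>m\<close>, a delta function at \<open>x = 1\<close>.  The rows (fixed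
  exponent \<open>n\<close> of \<open>y\<close>) of its elements are polynomials in \<open>m\<close>, and only finitely many rows
  with \<open>n \<ge> 0\<close> are non-zero.
\<close>

definition delta :: "int \<Rightarrow> int \<Rightarrow> complex" where
  "delta = (\<lambda>m n. if n = 0 then 1 else 0)"

definition delta_module :: "(int \<Rightarrow> int \<Rightarrow> complex) set" where
  "delta_module = range (\<lambda>u. laurent u delta)"

definition polynomial_rows :: "int \<Rightarrow> (int \<Rightarrow> complex poly) \<Rightarrow> bool" where
  "polynomial_rows N p \<longleftrightarrow> (\<forall>n. n < 0 \<or> n > N \<longrightarrow> p n = 0)"

definition of_rows :: "(int \<Rightarrow> complex poly) \<Rightarrow> int \<Rightarrow> int \<Rightarrow> complex" where
  "of_rows p = (\<lambda>m n. poly (p n) (of_int m))"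

lemma laurent_rows:
  assumes "polynomial_rows N p"
  shows "\<exists>q. polynomial_rows (N + 2) q \<and> laurent (uea_gen X) (of_rows p) = of_rows q"
proof -
  define q where "q = (\<lambda>n.
      smult (coeff_e (part_1 X) * (of_int n + 1)) (pcompose (p (n + 1)) [:- 1, 1:])
    + smult (coeff_h (part_1 X)) ([:- of_int n, 1:] * p n)
    + smult (coeff_f (part_1 X)) ([:1, 1:] * pcompose (p (n - 1)) [:1, 1:])
    + smult (coeff_e (part_t X)) (pcompose (p n) [:- 2, 1:])
    - smult (2 * coeff_h (part_t X)) (pcompose (p (n - 1)) [:- 1, 1:])
    - smult (coeff_f (part_t X)) (p (n - 2)))"
  have zero: "of_int n + 1 = (0 :: complex) \<or> p (n + 1) = 0" if "n < 0" for n
    using assms that unfolding polynomial_rows_def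
    by (cases "n = - 1") auto
  have "polynomial_rows (N + 2) q"
    unfolding polynomial_rows_def
  proof (intro allI impI)
    fix n assume n: "n < 0 \<or> n > N + 2"
    then have "p n = 0" "p (n - 1) = 0" "p (n - 2) = 0" "of_int n + 1 = (0 :: complex) \<or> p (n + 1) = 0"
      using assms zero[of n] unfolding polynomial_rows_def by auto
    then show "q n = 0" by (auto simp: q_def)
  qed
  moreover have "laurent (uea_gen X) (of_rows p) = of_rows q"
    by (simp add: laurent.uea_act_gen laurent_act_def of_rows_def q_def poly_pcompose fun_eq_iff
        algebra_simps)
  ultimately show ?thesis by blast
qed

lemma delta_module_rows:
  assumes "v \<in> delta_module"
  obtains N p where "polynomial_rows N p" "v = of_rows p"
proof -
  have "\<exists>N p. polynomial_rows N p \<and> laurent u delta = of_rows p" for u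
  proof (induction u rule: uea_induct_left)
    case one
    show ?case
      by (rule exI[of _ 0], rule exI[of _ "\<lambda>n. if n = 0 then 1 else 0"])
        (auto simp: polynomial_rows_def of_rows_def delta_def laurent_simps fun_eq_iff)
  next
    case (add u v)
    then obtain N p N' p' where "polynomial_rows N p" "laurent u delta = of_rows p"
      "polynomial_rows N' p'" "laurent v delta = of_rows p'" by blast
    then show ?case
      by (intro exI[of _ "max N N'"] exI[of _ "\<lambda>n. p n + p' n"])
        (simp add: laurent_simps polynomial_rows_def of_rows_def fun_eq_iff)
  next
    case (scale c u)
    then obtain N p where "polynomial_rows N p" "laurent u delta = of_rows p" by blast
    then show ?case
      by (intro exI[of _ N] exI[of _ "\<lambda>n. smult c (p n)"])
        (simp add: laurent_simps polynomial_rows_def of_rows_def fun_eq_iff)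
  next
    case (gen X u)
    then obtain N p where "polynomial_rows N p" "laurent u delta = of_rows p" by blast
    then show ?case using laurent_rows[of N p X] by (auto simp: laurent_simps)
  qed
  then show ?thesis using assms that unfolding delta_module_def by blast
qed

text \<open>Lowering rows with \<open>e\<close> and degrees with \<open>E - 1\<close> leads from any non-zero element back to
  the generator.\<close>

lemma delta_in_orbit:
  assumes "polynomial_rows (int N) p" "p (int N) \<noteq> 0"
  shows "\<exists>u. laurent u (of_rows p) = delta"
  using assms
proof (induction N arbitrary: p)
  case 0
  have row: "n = 0" if "p n \<noteq> 0" for n
    using that 0(1) unfolding polynomial_rows_def by force
  have "\<exists>u. laurent u (of_rows (\<lambda>n. if n = 0 then r else 0)) = delta" if "r \<noteq> 0" for r
    using that
  proof (induction "degree r" arbitrary: r rule: less_induct)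
    case less
    show ?case
    proof (cases "degree r = 0")
      case True
      then obtain c where c: "r = [:c:]" by (metis degree_eq_zeroE)
      then show ?thesis using less.prems
        by (intro exI[of _ "(1 / c) *\<^sub>C 1"])
          (auto simp: laurent_simps of_rows_def delta_def fun_eq_iff)
    next
      case False
      let ?r = "pcompose r [:- 2, 1:] - r"
      have "degree r > 0" "(- 2 :: complex) \<noteq> 0" using False by simp_all
      then obtain u where u: "laurent u (of_rows (\<lambda>n. if n = 0 then ?r else 0)) = delta"
        using less.hyps[of ?r] poly_difference[of r "- 2"] by blast
      have "laurent (\<iota>\<^sub>t sl2_e - 1) (of_rows (\<lambda>n. if n = 0 then r else 0))
          = of_rows (\<lambda>n. if n = 0 then ?r else 0)"
        by (auto simp: laurent_simps laurent_gens of_rows_def fun_eq_iff poly_pcompose)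
      then show ?thesis using u
        by (intro exI[of _ "u * (\<iota>\<^sub>t sl2_e - 1)"]) (simp add: laurent.uea.act_mult[OF UNIV_I])
    qed
  qed
  then have "\<exists>u. laurent u (of_rows (\<lambda>n. if n = 0 then p 0 else 0)) = delta"
    using 0(2) by simp
  moreover have "(\<lambda>n. if n = 0 then p 0 else 0) = p" using row by (auto simp: fun_eq_iff)
  ultimately show ?case by simp
next
  case (Suc N)
  define q where "q = (\<lambda>n. smult (of_int n + 1) (pcompose (p (n + 1)) [:- 1, 1:]))"
  have eq: "laurent (\<iota> sl2_e) (of_rows p) = of_rows q"
    by (simp add: laurent_gens of_rows_def q_def poly_pcompose fun_eq_iff)
  have "q n = 0" if "n < 0 \<or> n > int N" for n
    using that Suc.prems(1) unfolding polynomial_rows_def q_def by (cases "n = - 1") auto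
  then have "polynomial_rows (int N) q" by (simp add: polynomial_rows_def)
  moreover have "q (int N) \<noteq> 0"
  proof -
    have "of_int (int N) + 1 \<noteq> (0 :: complex)"
      by (metis of_int_of_nat_eq of_nat_Suc add.commute of_nat_eq_0_iff nat.distinct(1))
    moreover have "p (int N + 1) \<noteq> 0" using Suc.prems(2) by (simp add: add.commute)
    ultimately show ?thesis using pcompose_eq_0[of "p (int N + 1)" "[:- 1, 1:]"]
      by (auto simp: q_def)
  qed
  ultimately obtain u where "laurent u (of_rows q) = delta" using Suc.IH by blast
  then show ?case by (intro exI[of _ "u * \<iota> sl2_e"]) (simp add: laurent_simps eq)
qed

lemma delta_in_submodule:
  assumes "v \<in> delta_module" "v \<noteq> 0"
  shows "\<exists>u. laurent u v = delta"
proof -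
  obtain N p where p: "polynomial_rows N p" "v = of_rows p" using assms(1) by (rule delta_module_rows)
  define S where "S = {n. p n \<noteq> 0}"
  have "S \<subseteq> {0..N}" using p(1) by (force simp: S_def polynomial_rows_def not_less)
  then have fin: "finite S" by (rule finite_subset) simp
  have "S \<noteq> {}" using assms(2) p(2) by (force simp: S_def of_rows_def fun_eq_iff)
  with fin have "Max S \<in> S" by (rule Max_in)
  then obtain n where n: "Max S = int n" using \<open>S \<subseteq> {0..N}\<close>
    by (metis atLeastAtMost_iff subsetD nonneg_int_cases)
  have "polynomial_rows (int n) p"
    using fin p(1) Max_ge[OF fin] n unfolding polynomial_rows_def S_def by fastforce
  moreover have "p (int n) \<noteq> 0" using \<open>Max S \<in> S\<close> n by (simp add: S_def)
  ultimately show ?thesis using delta_in_orbit p(2) by blast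
qed

lemma simple_delta_module: "simple_left_module laurent delta_module"
proof -
  have delta: "delta \<in> delta_module"
    unfolding delta_module_def by (rule range_eqI[of _ _ 1]) (simp add: laurent_simps)
  show ?thesis
  proof
    show "0 \<in> delta_module"
      unfolding delta_module_def by (rule range_eqI[of _ _ 0]) (simp add: laurent_simps)
    show "v + w \<in> delta_module" if "v \<in> delta_module" "w \<in> delta_module" for v w
      using that by (auto simp: delta_module_def simp flip: laurent.uea.act_add_left[OF UNIV_I])
    show "- v \<in> delta_module" if "v \<in> delta_module" for v
    proof -
      obtain u where "v = laurent u delta" using \<open>v \<in> delta_module\<close> by (auto simp: delta_module_def)
      then have "- v = laurent (0 - u) delta" unfolding laurent.uea.act_diff_left[OF UNIV_I]
        by (simp add: laurent_simps)
      then show ?thesis by (auto simp: delta_module_def)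
    qed
    show "laurent u v \<in> delta_module" if "v \<in> delta_module" for u v
      using that by (auto simp: delta_module_def simp flip: laurent.uea.act_mult[OF UNIV_I])
    show "delta_module \<noteq> {0}"
    proof
      assume "delta_module = {0}"
      then have "delta = 0" using delta by blast
      then have "delta 0 0 = 0" by (metis zero_fun_apply)
      then show False by (simp add: delta_def)
    qed
    show "W = {0} \<or> W = delta_module"
      if W: "W \<subseteq> delta_module" "0 \<in> W" "\<And>u v. v \<in> W \<Longrightarrow> laurent u v \<in> W" for W
    proof (cases "W = {0}")
      case False
      then obtain v where "v \<in> W" "v \<noteq> 0" using W(2) by blast
      then have "delta \<in> W" using W delta_in_submodule by (metis subsetD)
      then have "delta_module \<subseteq> W" using W(3) unfolding delta_module_def by blast
      then show ?thesis using W(1) by blast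
    qed simp
  qed (simp_all add: laurent_simps)
qed

theorem primitive_ideal_I_00: "primitive_ideal (ideal_I 0 0)"
proof -
  interpret simple_left_module laurent delta_module by (rule simple_delta_module)
  let ?A = "annihilator laurent delta_module"
  have "?A = ideal_I 0 0"
  proof (rule ccontr)
    assume "?A \<noteq> ideal_I 0 0"
    moreover have "ideal_I 0 0 \<subseteq> ?A"
      using annihilator_laurent by (auto simp: annihilator_def)
    ultimately obtain j where j: "\<iota>\<^sub>t sl2_e ^ j \<in> ?A"
      using above_ideal_I_00[OF two_sided_ideal_annihilator] by blast
    have "laurent (\<iota>\<^sub>t sl2_e ^ j) delta = delta"
      by (induction j) (simp_all add: laurent_simps laurent_gens delta_def)
    moreover have "delta \<in> delta_module"
      unfolding delta_module_def by (rule range_eqI[of _ _ 1]) (simp add: laurent_simps)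
    ultimately have "delta = 0" using j by (auto simp: annihilator_def)
    then show False by (metis delta_def zero_fun_apply zero_neq_one)
  qed
  then show ?thesis using primitive_ideal_annihilator[OF simple_delta_module] by simp
qed

section \<open>Central elements act on simple modules by scalars\<close>

lemma (in vector_space) countable_independent:
  assumes "independent S" "S \<subseteq> span B" "countable B"
  shows "countable S"
proof -
  have cover: "S \<subseteq> (\<Union>T\<in>{T. finite T \<and> T \<subseteq> B}. S \<inter> span T)"
  proof
    fix x assume "x \<in> S"
    then have "x \<in> span B" using assms(2) by blast
    then obtain T r where T: "finite T" "T \<subseteq> B" "x = (\<Sum>a\<in>T. r a *s a)"
      unfolding span_explicit by blast
    have "x \<in> span T" unfolding T(3) by (intro span_sum span_scale span_base)
    then show "x \<in> (\<Union>T\<in>{T. finite T \<and> T \<subseteq> B}. S \<inter> span T)" using T(1,2) \<open>x \<in> S\<close> by blast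
  qed
  moreover have "countable (S \<inter> span T)" if "finite T" for T
    using independent_span_bound[OF that independent_mono[OF assms(1), of "S \<inter> span T"]]
    by (meson Int_lower1 Int_lower2 countable_finite)
  moreover have "countable {T. finite T \<and> T \<subseteq> B}"
    by (rule countable_Collect_finite_subset[OF assms(3)])
  ultimately have "countable (\<Union>T\<in>{T. finite T \<and> T \<subseteq> B}. S \<inter> span T)"
    by (intro countable_UN) auto
  with cover show ?thesis by (rule countable_subset)
qed

text \<open>
  If no \<open>c - \<lambda>\<close> kills the module, then all are injective, hence so are all non-zero polynomials in
  \<open>c\<close>; by simplicity there are \<open>u\<^sub>\<lambda>\<close> with \<open>u\<^sub>\<lambda> (c - \<lambda>) v = v\<close>.  These are uncountably many
  elements, so they satisfy a linear relation, which clears denominators to a non-zero polynomial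
  in \<open>c\<close> that annihilates \<open>v\<close>.
\<close>

theorem central_acts_by_scalar:
  fixes act :: "'a::complex_algebra_1 \<Rightarrow> 'v::ab_group_add \<Rightarrow> 'v" and c :: 'a and B :: "'a set"
  assumes "simple_left_module act V" and B: "countable B" "complex_vector.span B = UNIV"
    and central: "\<And>u. c * u = u * c"
  shows "\<exists>r. \<forall>v\<in>V. act (c - r *\<^sub>C 1) v = 0"
proof (rule ccontr)
  interpret simple_left_module act V by fact
  assume none: "\<nexists>r. \<forall>v\<in>V. act (c - r *\<^sub>C 1) v = 0"
  let ?d = "\<lambda>r. c - r *\<^sub>C 1"
  have d_central: "?d r * u = u * ?d r" for r u
    by (simp add: central algebra_simps mult_scaleC_left mult_scaleC_right)
  have inj: "v = 0" if "v \<in> V" "act (?d r) v = 0" for r v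
  proof -
    have "{v \<in> V. act (?d r) v = 0} = {0} \<or> {v \<in> V. act (?d r) v = 0} = V"
    proof (rule simple)
      fix u v assume "v \<in> {v \<in> V. act (?d r) v = 0}"
      then show "act u v \<in> {v \<in> V. act (?d r) v = 0}"
        using d_central[of r u] by (simp add: act_closed act_zero_right flip: act_mult)
          (simp add: act_mult act_zero_right)
    qed (auto simp: zero_closed act_zero_right add_closed act_add_right)
    then show ?thesis using none that by blast
  qed
  have scalar_inj: "v = 0" if "v \<in> V" "act (r *\<^sub>C 1) v = 0" "r \<noteq> 0" for r v
  proof -
    have "((1 / r) *\<^sub>C 1) * (r *\<^sub>C 1) = (1 :: 'a)"
      using that(3) by (simp add: mult_scaleC_left scaleC_scaleC scaleC_one)
    then have "act ((1 / r) *\<^sub>C 1) (act (r *\<^sub>C 1) v) = act 1 v"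
      by (simp only: flip: act_mult[OF that(1)])
    then show ?thesis using that by (simp add: act_zero_right act_one)
  qed
  have poly_inj: "v = 0" if "v \<in> V" "act (poly_at q c) v = 0" "q \<noteq> 0" for q v
    using that
  proof (induction "degree q" arbitrary: q v)
    case 0
    then obtain a where "q = [:a:]" by (metis degree_eq_zeroE)
    then show ?case using 0 scalar_inj[of v a] by (simp add: poly_at_const)
  next
    case (Suc n)
    then obtain r where "poly q r = 0"
      using fundamental_theorem_of_algebra[of q] by (metis constant_degree nat.distinct(1))
    then obtain q' where q': "q = [:- r, 1:] * q'" by (metis dvdE poly_eq_0_iff_dvd)
    have d: "poly_at [:- r, 1:] c = ?d r"
      by (simp add: poly_at_pCons poly_at_0 minus_scaleC scaleC_one)
    have "act (?d r) (act (poly_at q' c) v) = 0"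
      using Suc.prems(2) unfolding q' poly_at_mult act_mult[OF Suc.prems(1)] d .
    then have "act (poly_at q' c) v = 0" using inj Suc.prems act_closed by blast
    moreover have "q' \<noteq> 0" using Suc.prems(3) q' by auto
    moreover from this have "degree q' = n"
      using Suc.hyps(2) degree_mult_eq[of "[:- r, 1:]" q'] q' by simp
    ultimately show ?case using Suc.hyps(1) Suc.prems(1) by blast
  qed
  obtain v where v: "v \<in> V" "v \<noteq> 0" using nonzero zero_closed by blast
  have "\<exists>u. act u (act (?d r) v) = v" for r
  proof -
    let ?w = "act (?d r) v"
    have w: "?w \<in> V" "?w \<noteq> 0" using v inj act_closed by blast+
    have "range (\<lambda>u. act u ?w) = {0} \<or> range (\<lambda>u. act u ?w) = V"
    proof (rule simple)
      show "range (\<lambda>u. act u ?w) \<subseteq> V" using w act_closed by blast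
      show "0 \<in> range (\<lambda>u. act u ?w)" using act_zero_left[OF w(1)] by (metis rangeI)
    qed (auto simp flip: act_add_left[OF w(1)] act_mult[OF w(1)])
    moreover have "?w \<in> range (\<lambda>u. act u ?w)" using act_one[OF w(1)] by (metis rangeI)
    ultimately show ?thesis using w(2) v(1) by (metis (no_types, lifting) imageE singletonD)
  qed
  then obtain u where u: "\<And>r. act (u r) (act (?d r) v) = v" by metis
  have "inj u"
  proof (rule injI, rule ccontr)
    fix r s assume eq: "u r = u s" "r \<noteq> s"
    have "act (u r) (act (?d r) v) = act (u r) (act (?d s) v)" using u eq by metis
    then have "act (u r * ?d r - u r * ?d s) v = 0" using v by (simp add: act_diff_left act_mult)
    also have "u r * ?d r - u r * ?d s = ((s - r) *\<^sub>C 1) * u r"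
      by (simp add: algebra_simps mult_scaleC_left mult_scaleC_right
          complex_vector.scale_left_diff_distrib)
    finally have "act (u r) v = 0"
      using scalar_inj[of "act (u r) v" "s - r"] eq v by (simp add: act_mult act_closed)
    moreover have "act (u r) (act (?d r) v) = act (?d r) (act (u r) v)"
      using d_central[of r "u r"] v by (simp flip: act_mult)
    ultimately show False using u v act_zero_right by simp
  qed
  then have "\<not> countable (range u)"
    using uncountable_UNIV_complex countable_image_inj_eq by blast
  then have "complex_vector.dependent (range u)"
    using complex_vector.countable_independent[of "range u" B] B by auto
  then obtain T a t where T: "finite T" "T \<subseteq> range u" and t: "t \<in> T" "a t \<noteq> 0"
    and rel: "(\<Sum>t\<in>T. a t *\<^sub>C t) = 0"
    unfolding complex_vector.dependent_explicit by blast
  define R where "R = u -` T"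
  have R: "finite R" "T = u ` R"
    using T \<open>inj u\<close> by (auto simp: R_def finite_vimageI)
  define b where "b = (\<lambda>r. a (u r))"
  have rel': "(\<Sum>r\<in>R. b r *\<^sub>C u r) = 0"
    using rel unfolding R(2) b_def by (simp add: sum.reindex[OF inj_on_subset[OF \<open>inj u\<close>]])
  obtain s where s: "s \<in> R" "b s \<noteq> 0" using t R(2) by (auto simp: b_def)
  define P where "P = (\<lambda>S. \<Prod>r\<in>S. [:- r, 1:] :: complex poly)"
  define q where "q = (\<Sum>r\<in>R. smult (b r) (P (R - {r})))"
  have "poly q s = (\<Sum>r\<in>R. if r = s then b s * poly (P (R - {s})) s else 0)"
    unfolding q_def poly_sum
  proof (rule sum.cong[OF refl])
    fix r assume "r \<in> R"
    show "poly (smult (b r) (P (R - {r}))) s = (if r = s then b s * poly (P (R - {s})) s else 0)"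
      using R(1) s(1) by (auto simp: P_def poly_prod)
  qed
  then have "poly q s \<noteq> 0" using R(1) s by (simp add: P_def poly_prod)
  then have "q \<noteq> 0" by auto
  have act_sum: "act (sum g S) w = (\<Sum>r\<in>S. act (g r) w)" if "w \<in> V" for g :: "complex \<Rightarrow> 'a" and S w
    using that by (induction S rule: infinite_finite_induct) (simp_all add: act_zero_left act_add_left)
  have poly_central: "poly_at p c * w = w * poly_at p c" for p w
    using poly_at_commute[OF central[symmetric]] by simp
  have uP: "act (u r * poly_at (P R) c) v = act (poly_at (P (R - {r})) c) v" if "r \<in> R" for r
  proof -
    have PR: "P R = P (R - {r}) * [:- r, 1:]"
      unfolding P_def prod.remove[OF R(1) that] by (rule mult.commute)
    have d: "poly_at [:- r, 1:] c = ?d r"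
      by (simp add: poly_at_pCons poly_at_0 minus_scaleC scaleC_one)
    have "u r * poly_at (P R) c = poly_at (P (R - {r})) c * (u r * ?d r)"
      unfolding PR poly_at_mult d by (simp only: poly_central[of _ "u r"] flip: mult.assoc)
    then show ?thesis using u v by (simp add: act_mult act_closed)
  qed
  have poly_at_sum: "poly_at (sum g S) c = (\<Sum>r\<in>S. poly_at (g r) c)"
    for g :: "complex \<Rightarrow> complex poly" and S
    by (induction S rule: infinite_finite_induct) (simp_all add: poly_at_0 poly_at_add)
  have "act (poly_at q c) v = (\<Sum>r\<in>R. act (b r *\<^sub>C 1) (act (poly_at (P (R - {r})) c) v))"
    using v by (simp add: q_def poly_at_sum act_sum poly_at_smult mult_scaleC_left flip: act_mult)
  also have "\<dots> = (\<Sum>r\<in>R. act ((b r *\<^sub>C u r) * poly_at (P R) c) v)"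
  proof (rule sum.cong[OF refl])
    fix r assume "r \<in> R"
    show "act (b r *\<^sub>C 1) (act (poly_at (P (R - {r})) c) v)
        = act ((b r *\<^sub>C u r) * poly_at (P R) c) v"
      using v by (simp add: mult_scaleC_left flip: uP[OF \<open>r \<in> R\<close>] act_mult)
  qed
  also have "\<dots> = act ((\<Sum>r\<in>R. b r *\<^sub>C u r) * poly_at (P R) c) v"
    using v by (simp add: sum_distrib_right act_sum)
  also have "\<dots> = 0" using v by (simp add: rel' act_zero_left)
  finally show False using poly_inj[OF v(1)] v(2) \<open>q \<noteq> 0\<close> by blast
qed


section \<open>Highest weight vectors of \<open>sl2\<close>-modules\<close>

locale sl2_module = lie_module scale \<rho> V
  for scale :: "complex \<Rightarrow> 'v::ab_group_add \<Rightarrow> 'v" and \<rho> :: "sl2 \<Rightarrow> 'v \<Rightarrow> 'v" and V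
begin

abbreviation "e \<equiv> \<rho> sl2_e"
abbreviation "h \<equiv> \<rho> sl2_h"
abbreviation "f \<equiv> \<rho> sl2_f"

lemma sl2_relations:
  assumes "v \<in> V"
  shows "e (f v) = f (e v) + h v" "h (e v) = e (h v) + scale 2 (e v)"
    and "h (f v) = f (h v) + scale (- 2) (f v)"
proof -
  have "- (2 *\<^sub>C sl2_f) = (- 2) *\<^sub>C sl2_f" by (simp add: minus_scaleC)
  then show "h (f v) = f (h v) + scale (- 2) (f v)"
    using \<rho>_bracket[OF assms, of sl2_h sl2_f] \<rho>_scale_left[OF assms]
    by (simp only: sl2_brackets) (metis diff_add_cancel add.commute)
  show "e (f v) = f (e v) + h v" "h (e v) = e (h v) + scale 2 (e v)"
    using \<rho>_bracket[OF assms, of sl2_e sl2_f] \<rho>_bracket[OF assms, of sl2_h sl2_e]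
      \<rho>_scale_left[OF assms]
    by (simp_all add: sl2_brackets)
qed

lemma \<rho>_zero: "\<rho> x 0 = 0"
  using \<rho>_scale_right[OF subspace_0[OF subspace_V], of x 0] by simp

lemma funpow_closed: "v \<in> V \<Longrightarrow> (\<rho> x ^^ k) v \<in> V"
  by (induction k) (auto intro: \<rho>_closed)

lemma funpow_scale: "v \<in> V \<Longrightarrow> (\<rho> x ^^ k) (scale c v) = scale c ((\<rho> x ^^ k) v)"
  by (induction k) (simp_all add: \<rho>_scale_right funpow_closed)

lemma uea_act_power: "v \<in> V \<Longrightarrow> uea_act scale \<rho> (uea_gen x ^ k) v = (\<rho> x ^^ k) v"
  by (induction k) (simp_all add: uea.act_one uea.act_mult uea_act_gen funpow_closed)

definition highest_weight :: "complex \<Rightarrow> 'v \<Rightarrow> bool" where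
  "highest_weight \<kappa> w \<longleftrightarrow> w \<in> V \<and> e w = 0 \<and> h w = scale \<kappa> w"

lemma h_f_power:
  assumes "highest_weight \<kappa> w"
  shows "h ((f ^^ i) w) = scale (\<kappa> - 2 * of_nat i) ((f ^^ i) w)"
proof (induction i)
  case 0 then show ?case using assms by (simp add: highest_weight_def)
next
  case (Suc i)
  have V: "(f ^^ i) w \<in> V" using assms by (simp add: highest_weight_def funpow_closed)
  have "h ((f ^^ Suc i) w) = scale (\<kappa> - 2 * of_nat i + - 2) ((f ^^ Suc i) w)"
    by (simp only: funpow.simps comp_apply sl2_relations(3)[OF V] Suc.IH \<rho>_scale_right[OF V]
        scale_left_distrib)
  also have "\<kappa> - 2 * of_nat i + - 2 = \<kappa> - 2 * of_nat (Suc i)" by simp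
  finally show ?case .
qed

lemma e_f_power:
  assumes "highest_weight \<kappa> w"
  shows "e ((f ^^ Suc i) w) = scale (of_nat (Suc i) * (\<kappa> - of_nat i)) ((f ^^ i) w)"
proof (induction i)
  case 0 then show ?case using assms by (simp add: highest_weight_def sl2_relations \<rho>_zero)
next
  case (Suc i)
  have V: "(f ^^ i) w \<in> V" "(f ^^ Suc i) w \<in> V"
    using assms funpow_closed[of w i sl2_f] funpow_closed[of w "Suc i" sl2_f]
    by (auto simp: highest_weight_def)
  have "e ((f ^^ Suc (Suc i)) w) = f (e ((f ^^ Suc i) w)) + h ((f ^^ Suc i) w)"
    using V by (simp add: sl2_relations(1))
  also have "\<dots> = scale (of_nat (Suc i) * (\<kappa> - of_nat i) + (\<kappa> - 2 * of_nat (Suc i))) ((f ^^ Suc i) w)"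
    using V by (simp only: Suc.IH h_f_power[OF assms] \<rho>_scale_right[OF V(1)] scale_left_distrib) simp
  also have "of_nat (Suc i) * (\<kappa> - of_nat i) + (\<kappa> - 2 * of_nat (Suc i))
      = of_nat (Suc (Suc i)) * (\<kappa> - of_nat (Suc i))"
    by (simp add: algebra_simps)
  finally show ?case .
qed

lemma e_power_f_power:
  assumes "highest_weight \<kappa> w"
  shows "(e ^^ i) ((f ^^ i) w) = scale (\<Prod>k<i. of_nat (Suc k) * (\<kappa> - of_nat k)) w"
proof (induction i)
  case (Suc i)
  have V: "(f ^^ i) w \<in> V" using assms by (simp add: highest_weight_def funpow_closed)
  have "(e ^^ Suc i) ((f ^^ Suc i) w) = (e ^^ i) (e ((f ^^ Suc i) w))"
    by (simp only: funpow_Suc_right comp_apply)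
  also have "\<dots> = scale (of_nat (Suc i) * (\<kappa> - of_nat i)) ((e ^^ i) ((f ^^ i) w))"
    by (simp only: e_f_power[OF assms] funpow_scale[OF V])
  finally show ?case by (simp add: Suc.IH mult.commute del: of_nat_Suc)
qed simp

text \<open>If \<open>e\<^sup>j = 0\<close>, the scalar in the preceding formula vanishes for \<open>i = j\<close>.\<close>

lemma nilpotent_weight:
  assumes nil: "\<And>v. v \<in> V \<Longrightarrow> (e ^^ j) v = 0" and w: "highest_weight \<kappa> w" "w \<noteq> 0"
  shows "\<exists>n. \<kappa> = of_nat n"
proof -
  have "(f ^^ j) w \<in> V" using w(1) by (simp add: highest_weight_def funpow_closed)
  then have "scale (\<Prod>k<j. of_nat (Suc k) * (\<kappa> - of_nat k)) w = 0"
    using nil e_power_f_power[OF w(1), of j] by simp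
  then obtain k where "of_nat (Suc k) * (\<kappa> - of_nat k) = 0"
    using w(2) scale_eq_0_iff by (auto simp del: of_nat_Suc)
  then have "\<kappa> = of_nat k" by (simp del: of_nat_Suc)
  then show ?thesis by blast
qed

text \<open>If it were non-zero, \<open>f\<^bsup>n+1\<^esup> w\<close> would have highest weight \<open>- n - 2\<close>, which is not a natural
  number.\<close>

lemma f_power_highest_weight:
  assumes nil: "\<And>v. v \<in> V \<Longrightarrow> (e ^^ j) v = 0" and w: "highest_weight (of_nat n) w"
  shows "(f ^^ Suc n) w = 0"
proof (rule ccontr)
  assume nz: "(f ^^ Suc n) w \<noteq> 0"
  have "(f ^^ Suc n) w \<in> V" using w funpow_closed[of w "Suc n" sl2_f] by (simp add: highest_weight_def)
  then have "highest_weight (of_nat n - 2 * of_nat (Suc n)) ((f ^^ Suc n) w)"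
    using e_f_power[OF w, of n] h_f_power[OF w, of "Suc n"] unfolding highest_weight_def by simp
  then obtain m where m: "of_nat n - 2 * of_nat (Suc n) = (of_nat m :: complex)"
    using nilpotent_weight[OF nil _ nz] by blast
  have "of_nat (m + n + 2) = of_nat m - (of_nat n - 2 * of_nat (Suc n) :: complex)" by simp
  also have "\<dots> = 0" unfolding m by simp
  finally show False unfolding of_nat_eq_0_iff by simp
qed

text \<open>On the kernel of \<open>e\<close> the Casimir element is \<open>(h + 1)\<^sup>2\<close>, so \<open>h\<close> has an eigenvector there.\<close>

lemma ex_highest_weight:
  assumes nil: "\<And>v. v \<in> V \<Longrightarrow> (e ^^ j) v = 0" and "V \<noteq> {0}"
    and casimir: "\<And>v. v \<in> V \<Longrightarrow> e v = 0 \<Longrightarrow> h (h v) + scale 2 (h v) + v = scale (s\<^sup>2) v"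
  shows "\<exists>n w. highest_weight (of_nat n) w \<and> w \<noteq> 0"
proof -
  have "\<exists>v\<in>V. v \<noteq> 0 \<and> e v = 0"
    using nil
  proof (induction j)
    case 0
    then show ?case using assms(2) subspace_0[OF subspace_V] by auto
  next
    case (Suc j)
    show ?case
    proof (cases "\<forall>v\<in>V. (e ^^ j) v = 0")
      case True then show ?thesis using Suc.IH by blast
    next
      case False then show ?thesis using Suc.prems funpow_closed by fastforce
    qed
  qed
  then obtain v where v: "v \<in> V" "v \<noteq> 0" "e v = 0" by blast
  define w where "w = h v + scale (1 + s) v"
  have hv: "h v \<in> V" "e (h v) = 0"
    using v sl2_relations(2)[of v] by (simp_all add: \<rho>_closed \<rho>_zero)
  have "\<exists>\<kappa> w. highest_weight \<kappa> w \<and> w \<noteq> 0"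
  proof (cases "w = 0")
    case True
    then have "h v = scale (- (1 + s)) v"
      unfolding w_def by (metis add_eq_0_iff2 scale_minus_left)
    then show ?thesis using v unfolding highest_weight_def by blast
  next
    case False
    have sv: "scale (1 + s) v \<in> V" using v(1) by (rule subspace_scale[OF subspace_V])
    have "w \<in> V" unfolding w_def by (rule subspace_add[OF subspace_V hv(1) sv])
    moreover have "e w = 0"
      unfolding w_def \<rho>_add_right[OF hv(1) sv] \<rho>_scale_right[OF v(1)] by (simp add: hv v)
    moreover have "h w = scale (s - 1) w"
    proof -
      have "h (h v) = scale (s\<^sup>2) v - v - scale 2 (h v)"
        using casimir[OF v(1,3)] by (simp add: algebra_simps)
      then have "h w = scale (s\<^sup>2) v - v - scale 2 (h v) + scale (1 + s) (h v)"
        unfolding w_def \<rho>_add_right[OF hv(1) sv] \<rho>_scale_right[OF v(1)] by simp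
      also have "\<dots> = scale (s\<^sup>2 - 1) v + scale (s - 1) (h v)"
        by (simp add: scale_left_diff_distrib scale_left_distrib algebra_simps)
          (metis scale_left_distrib one_add_one scale_one)
      also have "\<dots> = scale (s - 1) w"
        by (simp add: w_def scale_right_distrib power2_eq_square algebra_simps)
      finally show ?thesis .
    qed
    ultimately show ?thesis using False unfolding highest_weight_def by blast
  qed
  then show ?thesis using nilpotent_weight[OF nil] by blast
qed

end

text \<open>The annihilator in \<open>U(sl2)\<close> of the highest weight vector of \<open>L(n)\<close>.\<close>

definition highest_weight_ideal :: "nat \<Rightarrow> sl2 uea set" where
  "highest_weight_ideal n =
     {a * uea_gen sl2_e + b * (uea_gen sl2_h - of_nat n *\<^sub>C 1) + c * uea_gen sl2_f ^ Suc n |a b c. True}"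

lemma highest_weight_ideal_add:
  assumes "u \<in> highest_weight_ideal n" "v \<in> highest_weight_ideal n"
  shows "u + v \<in> highest_weight_ideal n"
proof -
  obtain a b c a' b' c' where
    "u = a * uea_gen sl2_e + b * (uea_gen sl2_h - of_nat n *\<^sub>C 1) + c * uea_gen sl2_f ^ Suc n"
    "v = a' * uea_gen sl2_e + b' * (uea_gen sl2_h - of_nat n *\<^sub>C 1) + c' * uea_gen sl2_f ^ Suc n"
    using assms unfolding highest_weight_ideal_def by blast
  then have "u + v = (a + a') * uea_gen sl2_e + (b + b') * (uea_gen sl2_h - of_nat n *\<^sub>C 1)
      + (c + c') * uea_gen sl2_f ^ Suc n"
    by (simp only: distrib_right add.assoc add.left_commute)
  then show ?thesis unfolding highest_weight_ideal_def by blast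
qed

lemma highest_weight_ideal_lmult:
  assumes "u \<in> highest_weight_ideal n"
  shows "r * u \<in> highest_weight_ideal n"
proof -
  obtain a b c where
    "u = a * uea_gen sl2_e + b * (uea_gen sl2_h - of_nat n *\<^sub>C 1) + c * uea_gen sl2_f ^ Suc n"
    using assms unfolding highest_weight_ideal_def by blast
  then have "r * u = (r * a) * uea_gen sl2_e + (r * b) * (uea_gen sl2_h - of_nat n *\<^sub>C 1)
      + (r * c) * uea_gen sl2_f ^ Suc n"
    by (simp only: distrib_left mult.assoc)
  then show ?thesis unfolding highest_weight_ideal_def by blast
qed

lemma highest_weight_ideal_generators:
  "uea_gen sl2_e \<in> highest_weight_ideal n" "uea_gen sl2_h - of_nat n *\<^sub>C 1 \<in> highest_weight_ideal n"
  "uea_gen sl2_f ^ Suc n \<in> highest_weight_ideal n" "0 \<in> highest_weight_ideal n"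
proof -
  have I: "a * uea_gen sl2_e + b * (uea_gen sl2_h - of_nat n *\<^sub>C 1) + c * uea_gen sl2_f ^ Suc n
      \<in> highest_weight_ideal n" for a b c
    unfolding highest_weight_ideal_def by blast
  show "uea_gen sl2_e \<in> highest_weight_ideal n" "uea_gen sl2_h - of_nat n *\<^sub>C 1 \<in> highest_weight_ideal n"
    "uea_gen sl2_f ^ Suc n \<in> highest_weight_ideal n" "0 \<in> highest_weight_ideal n"
    using I[of 1 0 0] I[of 0 1 0] I[of 0 0 1] I[of 0 0 0] by simp_all
qed

lemma uea_sl2_relations:
  "uea_gen sl2_e * uea_gen sl2_f = uea_gen sl2_f * uea_gen sl2_e + uea_gen sl2_h"
  "uea_gen sl2_h * uea_gen sl2_e = uea_gen sl2_e * uea_gen sl2_h + 2 *\<^sub>C uea_gen sl2_e"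
  "uea_gen sl2_h * uea_gen sl2_f = uea_gen sl2_f * uea_gen sl2_h - 2 *\<^sub>C uea_gen sl2_f"
proof -
  have minus: "uea_gen (- x) = - uea_gen x" for x :: sl2
    using uea_gen_scaleC[of "- 1" x] by (simp add: minus_scaleC scaleC_one)
  show "uea_gen sl2_e * uea_gen sl2_f = uea_gen sl2_f * uea_gen sl2_e + uea_gen sl2_h"
    "uea_gen sl2_h * uea_gen sl2_e = uea_gen sl2_e * uea_gen sl2_h + 2 *\<^sub>C uea_gen sl2_e"
    "uea_gen sl2_h * uea_gen sl2_f = uea_gen sl2_f * uea_gen sl2_h - 2 *\<^sub>C uea_gen sl2_f"
    using uea_gen_bracket[of sl2_e sl2_f] uea_gen_bracket[of sl2_h sl2_e]
      uea_gen_bracket[of sl2_h sl2_f]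
    by (simp_all add: sl2_brackets uea_gen_scaleC minus algebra_simps)
qed

lemma uea_sl2_powers:
  "uea_gen sl2_h * uea_gen sl2_f ^ i
     = uea_gen sl2_f ^ i * uea_gen sl2_h - (2 * of_nat i) *\<^sub>C uea_gen sl2_f ^ i"
  "uea_gen sl2_e * uea_gen sl2_f ^ i = uea_gen sl2_f ^ i * uea_gen sl2_e
     + of_nat i *\<^sub>C (uea_gen sl2_f ^ (i - 1) * (uea_gen sl2_h - (of_nat i - 1) *\<^sub>C 1))"
proof -
  let ?e = "uea_gen sl2_e" and ?h = "uea_gen sl2_h" and ?f = "uea_gen sl2_f"
  show h: "?h * ?f ^ i = ?f ^ i * ?h - (2 * of_nat i) *\<^sub>C ?f ^ i" for i
  proof (induction i)
    case (Suc i)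
    have "?h * ?f ^ Suc i = ?f * (?h * ?f ^ i) - 2 *\<^sub>C ?f ^ Suc i"
      by (simp add: uea_sl2_relations left_diff_distrib mult_scaleC_left flip: mult.assoc)
    then show ?case
      by (simp add: Suc.IH right_diff_distrib mult_scaleC_right scaleC_add_left distrib_left
          mult.assoc diff_diff_eq add.commute)
  qed simp
  show "?e * ?f ^ i = ?f ^ i * ?e + of_nat i *\<^sub>C (?f ^ (i - 1) * (?h - (of_nat i - 1) *\<^sub>C 1))"
  proof (induction i)
    case (Suc i)
    have "?e * ?f ^ Suc i = ?f * (?e * ?f ^ i) + ?h * ?f ^ i"
      by (simp add: uea_sl2_relations distrib_right flip: mult.assoc)
    also have "\<dots> = ?f ^ Suc i * ?e
        + of_nat i *\<^sub>C (?f * ?f ^ (i - 1) * (?h - (of_nat i - 1) *\<^sub>C 1)) + ?h * ?f ^ i"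
      by (simp add: Suc.IH distrib_left mult_scaleC_right mult.assoc)
    also have "of_nat i *\<^sub>C (?f * ?f ^ (i - 1) * (?h - (of_nat i - 1) *\<^sub>C 1))
        = of_nat i *\<^sub>C (?f ^ i * (?h - (of_nat i - 1) *\<^sub>C 1))"
      by (cases i) simp_all
    also have "\<dots> = of_nat i *\<^sub>C (?f ^ i * ?h) - (of_nat i * (of_nat i - 1)) *\<^sub>C ?f ^ i"
      by (simp add: right_diff_distrib mult_scaleC_right scaleC_scaleC
          complex_vector.scale_right_diff_distrib)
    also have "?h * ?f ^ i = ?f ^ i * ?h - (2 * of_nat i) *\<^sub>C ?f ^ i" by (rule h)
    finally have "?e * ?f ^ Suc i = ?f ^ Suc i * ?e + (of_nat i + 1) *\<^sub>C (?f ^ i * ?h)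
        - (of_nat i * (of_nat i - 1) + 2 * of_nat i) *\<^sub>C ?f ^ i"
      by (simp only: scaleC_add_left scaleC_one) (simp add: algebra_simps)
    also have "of_nat i * (of_nat i - 1) + 2 * of_nat i = (of_nat i + 1) * (of_nat i :: complex)"
      by (simp add: algebra_simps)
    finally show ?case
      by (simp add: right_diff_distrib mult_scaleC_right scaleC_scaleC add.commute
          complex_vector.scale_right_diff_distrib add_diff_eq)
  qed simp
qed

lemma highest_weight_ideal_complement:
  "\<exists>a. u - (\<Sum>i\<le>n. a i *\<^sub>C uea_gen sl2_f ^ i) \<in> highest_weight_ideal n"
proof -
  let ?e = "uea_gen sl2_e" and ?h = "uea_gen sl2_h" and ?f = "uea_gen sl2_f"
  let ?N = "highest_weight_ideal n"
  define S where "S = {u. \<exists>a. u - (\<Sum>i\<le>n. a i *\<^sub>C ?f ^ i) \<in> ?N}"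
  have S_I: "u \<in> S" if "u - (\<Sum>i\<le>n. a i *\<^sub>C ?f ^ i) \<in> ?N" for u a
    using that unfolding S_def by blast
  note N_add = highest_weight_ideal_add and N_lmult = highest_weight_ideal_lmult
  have N_scale: "c *\<^sub>C u \<in> ?N" if "u \<in> ?N" for c u
    using N_lmult[OF that, of "c *\<^sub>C 1"] by (simp add: mult_scaleC_left)
  have S_add: "u + v \<in> S" if uv: "u \<in> S" "v \<in> S" for u v
  proof -
    obtain a b where "u - (\<Sum>i\<le>n. a i *\<^sub>C ?f ^ i) \<in> ?N" "v - (\<Sum>i\<le>n. b i *\<^sub>C ?f ^ i) \<in> ?N"
      using uv unfolding S_def by blast
    then have "u - (\<Sum>i\<le>n. a i *\<^sub>C ?f ^ i) + (v - (\<Sum>i\<le>n. b i *\<^sub>C ?f ^ i)) \<in> ?N" by (rule N_add)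
    also have "u - (\<Sum>i\<le>n. a i *\<^sub>C ?f ^ i) + (v - (\<Sum>i\<le>n. b i *\<^sub>C ?f ^ i))
        = u + v - (\<Sum>i\<le>n. (a i + b i) *\<^sub>C ?f ^ i)"
      by (simp add: scaleC_add_left sum.distrib)
    finally show ?thesis by (rule S_I)
  qed
  have S_scale: "c *\<^sub>C u \<in> S" if u: "u \<in> S" for c u
  proof -
    obtain a where "u - (\<Sum>i\<le>n. a i *\<^sub>C ?f ^ i) \<in> ?N" using u unfolding S_def by blast
    then have "c *\<^sub>C (u - (\<Sum>i\<le>n. a i *\<^sub>C ?f ^ i)) \<in> ?N" by (rule N_scale)
    also have "c *\<^sub>C (u - (\<Sum>i\<le>n. a i *\<^sub>C ?f ^ i)) = c *\<^sub>C u - (\<Sum>i\<le>n. (c * a i) *\<^sub>C ?f ^ i)"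
      by (simp add: complex_vector.scale_right_diff_distrib complex_vector.scale_sum_right scaleC_scaleC)
    finally show ?thesis by (rule S_I)
  qed
  have S_diff: "u - v \<in> S" if "u \<in> S" "v \<in> S" for u v
    using S_add[OF that(1) S_scale[OF that(2), of "- 1"]] by (simp add: minus_scaleC scaleC_one)
  have N_S: "u \<in> S" if "u \<in> ?N" for u
    using that by (intro S_I[of u "\<lambda>_. 0"]) simp
  have S_sum: "sum g A \<in> S" if "\<And>i. i \<in> A \<Longrightarrow> g i \<in> S" for g :: "nat \<Rightarrow> _" and A
    using that
    by (induction A rule: infinite_finite_induct)
      (auto intro: S_add N_S highest_weight_ideal_generators)
  have f_S: "?f ^ i \<in> S" if "i \<le> Suc n" for i
  proof (cases "i = Suc n")
    case True then show ?thesis using highest_weight_ideal_generators(3) N_S by simp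
  next
    case False
    then have "i \<le> n" using that by simp
    moreover have "(\<Sum>k\<le>n. (if k = i then 1 else 0) *\<^sub>C ?f ^ k) = (\<Sum>k\<le>n. if k = i then ?f ^ i else 0)"
      by (intro sum.cong) (auto simp: scaleC_one)
    ultimately have "?f ^ i - (\<Sum>k\<le>n. (if k = i then 1 else 0) *\<^sub>C ?f ^ k) = 0" by simp
    then show ?thesis
      using highest_weight_ideal_generators(4)
      by (intro S_I[of _ "\<lambda>k. if k = i then 1 else 0"]) (simp only:)
  qed
  have fh_S: "?f ^ i * ?h \<in> S" if "i \<le> n" for i
  proof -
    have "?f ^ i * (?h - of_nat n *\<^sub>C 1) + of_nat n *\<^sub>C ?f ^ i \<in> S"
      by (intro S_add S_scale f_S N_S N_lmult highest_weight_ideal_generators) (use that in simp)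
    then show ?thesis by (simp add: right_diff_distrib mult_scaleC_right)
  qed
  have gen_S: "uea_gen x * ?f ^ i \<in> S" if "i \<le> n" for x i
  proof -
    have "?e * ?f ^ i \<in> S"
    proof -
      have "?f ^ i * ?e + of_nat i *\<^sub>C (?f ^ (i - 1) * ?h - (of_nat i - 1) *\<^sub>C ?f ^ (i - 1)) \<in> S"
        by (intro S_add S_scale S_diff f_S fh_S N_S[OF N_lmult[OF highest_weight_ideal_generators(1)]])
          (use that in simp_all)
      then show ?thesis
        by (simp only: uea_sl2_powers(2) right_diff_distrib mult_scaleC_right mult_1_right)
    qed
    moreover have "?h * ?f ^ i \<in> S"
    proof -
      have "?f ^ i * ?h + (- (2 * of_nat i)) *\<^sub>C ?f ^ i \<in> S"
        by (intro S_add S_scale f_S fh_S) (use that in simp_all)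
      then show ?thesis by (simp add: uea_sl2_powers minus_scaleC)
    qed
    moreover have "?f * ?f ^ i \<in> S" using f_S[of "Suc i"] that by simp
    ultimately have "coeff_e x *\<^sub>C (?e * ?f ^ i) + coeff_h x *\<^sub>C (?h * ?f ^ i) + coeff_f x *\<^sub>C (?f * ?f ^ i) \<in> S"
      by (intro S_add S_scale)
    then show ?thesis
      by (subst sl2_basis) (simp add: uea_gen_add uea_gen_scaleC distrib_right mult_scaleC_left)
  qed
  have "u \<in> S"
  proof (induction u rule: uea_induct_left)
    case one show ?case using f_S[of 0] by simp
  next
    case (gen x u)
    then obtain a where a: "u - (\<Sum>i\<le>n. a i *\<^sub>C ?f ^ i) \<in> ?N" by (auto simp: S_def)
    have "uea_gen x * (u - (\<Sum>i\<le>n. a i *\<^sub>C ?f ^ i)) + (\<Sum>i\<le>n. a i *\<^sub>C (uea_gen x * ?f ^ i)) \<in> S"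
      by (intro S_add S_sum S_scale gen_S N_S N_lmult a) simp
    then show ?case
      by (simp add: right_diff_distrib sum_distrib_left mult_scaleC_right)
  qed (auto intro: S_add S_scale)
  then show ?thesis by (simp add: S_def)
qed

context sl2_module
begin

text \<open>Modulo this left ideal every element is a combination of \<open>1, f, \<dots>, f\<^sup>n\<close>.  If such a combination
  kills \<open>w\<close>, then applying \<open>e\<^sup>i\<close> for its highest term \<open>f\<^sup>i\<close> gives a non-zero multiple of the
  coefficient.\<close>

lemma annihilator_highest_weight_vector:
  assumes w: "highest_weight (of_nat n) w" "w \<noteq> 0" "(f ^^ Suc n) w = 0"
  shows "uea_act scale \<rho> u w = 0 \<longleftrightarrow> u \<in> highest_weight_ideal n"
proof -
  have V: "w \<in> V" using w(1) by (simp add: highest_weight_def)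
  have N: "uea_act scale \<rho> v w = 0" if v: "v \<in> highest_weight_ideal n" for v
  proof -
    obtain a b c where v: "v = a * uea_gen sl2_e + b * (uea_gen sl2_h - of_nat n *\<^sub>C 1)
        + c * uea_gen sl2_f ^ Suc n"
      using v unfolding highest_weight_ideal_def by blast
    have "uea_act scale \<rho> (uea_gen sl2_e) w = 0"
      "uea_act scale \<rho> (uea_gen sl2_h - of_nat n *\<^sub>C 1) w = 0"
      "uea_act scale \<rho> (uea_gen sl2_f ^ Suc n) w = 0"
      using w V uea_act_power[OF V, of sl2_f "Suc n"]
      by (simp_all add: highest_weight_def uea_act_gen uea.act_diff_left uea_act_scaleC uea.act_one)
    then show ?thesis
      using V by (simp only: v uea.act_add_left uea.act_mult uea.act_zero_right) simp
  qed
  show ?thesis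
  proof
    assume u: "uea_act scale \<rho> u w = 0"
    obtain a where a: "u - (\<Sum>i\<le>n. a i *\<^sub>C uea_gen sl2_f ^ i) \<in> highest_weight_ideal n"
      using highest_weight_ideal_complement by blast
    have act_sum: "uea_act scale \<rho> (sum g A) w = (\<Sum>i\<in>A. uea_act scale \<rho> (g i) w)"
      for g :: "nat \<Rightarrow> _" and A
      by (induction A rule: infinite_finite_induct)
        (simp_all add: uea.act_zero_left uea.act_add_left V)
    have "uea_act scale \<rho> (\<Sum>i\<le>n. a i *\<^sub>C uea_gen sl2_f ^ i) w = 0"
      using N[OF a] u V by (simp add: uea.act_diff_left)
    then have zero: "(\<Sum>i\<le>n. scale (a i) ((f ^^ i) w)) = 0"
      using V by (simp add: act_sum uea_act_scaleC uea_act_power)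
    have "a i = 0" if "i \<le> n" for i
      using that
    proof (induction "n - i" arbitrary: i rule: less_induct)
      case less
      have "(\<Sum>k\<le>n. scale (a k) ((f ^^ k) w)) = (\<Sum>k\<le>i. scale (a k) ((f ^^ k) w))"
        using less by (intro sum.mono_neutral_right) auto
      then have "0 = uea_act scale \<rho> (uea_gen sl2_e ^ i) (\<Sum>k\<le>i. scale (a k) ((f ^^ k) w))"
        using zero by (simp add: uea.act_zero_right)
      also have "\<dots> = uea_act scale \<rho> (uea_gen sl2_e ^ i * (\<Sum>k\<le>i. a k *\<^sub>C uea_gen sl2_f ^ k)) w"
        using V by (simp add: uea.act_mult act_sum uea_act_scaleC uea_act_power)
      also have "\<dots> = (\<Sum>k\<le>i. scale (a k) ((e ^^ i) ((f ^^ k) w)))"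
        using V by (simp add: sum_distrib_left act_sum mult_scaleC_right uea_act_scaleC
            uea.act_mult uea_act_power funpow_closed)
      also have "\<dots> = (\<Sum>k\<le>i. if k = i then scale (a i) ((e ^^ i) ((f ^^ i) w)) else 0)"
      proof (rule sum.cong[OF refl])
        fix k assume "k \<in> {..i}"
        show "scale (a k) ((e ^^ i) ((f ^^ k) w))
            = (if k = i then scale (a i) ((e ^^ i) ((f ^^ i) w)) else 0)"
        proof (cases "k = i")
          case False
          then obtain l where i: "i = Suc l + k" using \<open>k \<in> {..i}\<close>
            by (metis add.commute atMost_iff less_imp_Suc_add le_neq_implies_less add_Suc_right)
          have "(e ^^ m) 0 = 0" for m by (induction m) (simp_all add: \<rho>_zero)
          moreover have "e w = 0" using w(1) by (simp add: highest_weight_def)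
          ultimately have "(e ^^ i) ((f ^^ k) w) = 0"
            by (simp only: i funpow_add comp_apply e_power_f_power[OF w(1)] funpow_Suc_right
                \<rho>_scale_right[OF V] scale_zero_right)
          then show ?thesis using False by simp
        qed simp
      qed
      also have "\<dots> = scale (a i * (\<Prod>k<i. of_nat (Suc k) * (of_nat n - of_nat k))) w"
        by (simp add: e_power_f_power[OF w(1)] del: of_nat_Suc)
      finally have "a i * (\<Prod>k<i. of_nat (Suc k) * (of_nat n - of_nat k)) = (0 :: complex)"
        using w(2) by (metis scale_eq_0_iff)
      moreover have "(\<Prod>k<i. of_nat (Suc k) * (of_nat n - of_nat k)) \<noteq> (0 :: complex)"
        using less.prems by (auto simp del: of_nat_Suc)
      ultimately show ?case by simp
    qed
    then have "(\<Sum>i\<le>n. a i *\<^sub>C uea_gen sl2_f ^ i) = 0" by simp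
    then show "u \<in> highest_weight_ideal n" using a by simp
  qed (rule N)
qed

text \<open>A simple module is generated by its highest weight vector, so its annihilator depends only on
  the highest weight.\<close>

lemma annihilator_highest_weight:
  assumes "simple_lie_module scale \<rho> V"
    and w: "highest_weight (of_nat n) w" "w \<noteq> 0" "(f ^^ Suc n) w = 0"
  shows "annihilator (uea_act scale \<rho>) V = {u. \<forall>r. u * r \<in> highest_weight_ideal n}"
proof -
  interpret simple_lie_module scale \<rho> V by fact
  interpret U: simple_left_module "uea_act scale \<rho>" V by (rule simple_uea_module)
  have V: "w \<in> V" using w(1) by (simp add: highest_weight_def)
  have "range (\<lambda>r. uea_act scale \<rho> r w) = {0} \<or> range (\<lambda>r. uea_act scale \<rho> r w) = V"
  proof (rule U.simple)
    show "range (\<lambda>r. uea_act scale \<rho> r w) \<subseteq> V" using V uea.act_closed by blast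
    show "0 \<in> range (\<lambda>r. uea_act scale \<rho> r w)" using uea.act_zero_left[OF V] by (metis rangeI)
  qed (auto simp flip: uea.act_add_left[OF V] uea.act_mult[OF V])
  moreover have "w \<in> range (\<lambda>r. uea_act scale \<rho> r w)" using uea.act_one[OF V] by (metis rangeI)
  ultimately have "V = range (\<lambda>r. uea_act scale \<rho> r w)" using w(2) by blast
  then have "u \<in> annihilator (uea_act scale \<rho>) V \<longleftrightarrow> (\<forall>r. uea_act scale \<rho> (u * r) w = 0)" for u
    unfolding annihilator_def using uea.act_mult[OF V] by auto
  then show ?thesis using annihilator_highest_weight_vector[OF w] by auto
qed

end

lemma ann_L: "ann_L n = {u. \<forall>r. u * r \<in> highest_weight_ideal n}"
proof -
  interpret L: simple_lie_module smult "L_act n" "L_carrier n" by (rule simple_lie_module_L)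
  interpret L: sl2_module smult "L_act n" "L_carrier n" ..
  have nil: "(L_act n sl2_e ^^ Suc n) p = 0" if "p \<in> L_carrier n" for p
  proof -
    have "(pderiv ^^ Suc k) p = 0" if "degree p \<le> k" for k and p :: "complex poly"
      using that
    proof (induction k arbitrary: p)
      case 0 then show ?case by (simp add: pderiv_eq_0_iff)
    next
      case (Suc k)
      have "(pderiv ^^ Suc k) (pderiv p) = 0"
        using Suc.prems by (intro Suc.IH) (simp add: degree_pderiv)
      then show ?case by (simp only: funpow_Suc_right[of "Suc k"] comp_apply)
    qed
    moreover have "L_act n sl2_e = pderiv" by (rule ext) (rule L_act_basis)
    ultimately show ?thesis using that by (simp add: L_carrier_def)
  qed
  have w: "L.highest_weight (of_nat n) 1"
    unfolding L.highest_weight_def by (simp add: L_highest_weight L_carrier_def)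
  show ?thesis
    unfolding ann_L_def
    by (rule L.annihilator_highest_weight[OF simple_lie_module_L w _ L.f_power_highest_weight[OF nil w]])
      simp_all
qed


section \<open>The annihilators of simple modules\<close>

lemma sl2_casimir_central: "sl2_casimir * u = u * sl2_casimir"
proof -
  let ?e = "uea_gen sl2_e" and ?h = "uea_gen sl2_h" and ?f = "uea_gen sl2_f"
  have left: "?e * (?f * v) = ?f * (?e * v) + ?h * v" "?h * (?e * v) = ?e * (?h * v) + 2 *\<^sub>C (?e * v)"
    "?h * (?f * v) = ?f * (?h * v) - 2 *\<^sub>C (?f * v)" for v
    by (simp_all only: uea_sl2_relations distrib_right left_diff_distrib mult_scaleC_left
        flip: mult.assoc)
  note simps = sl2_casimir_def power2_eq_square distrib_left distrib_right left_diff_distrib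
    right_diff_distrib mult.assoc uea_sl2_relations left
  have two: "2 *\<^sub>C v = v + v" "4 * v = v + v + v + v" for v :: "sl2 uea"
    using scaleC_add_left[of 1 1 v] scaleC_add_left[of 2 2 v]
    by (simp_all add: scaleC_one numeral_scaleC)
  have gens: "sl2_casimir * ?e = ?e * sl2_casimir" "sl2_casimir * ?h = ?h * sl2_casimir"
    "sl2_casimir * ?f = ?f * sl2_casimir"
    by (simp_all add: simps two algebra_simps)
  have gen: "sl2_casimir * uea_gen x = uea_gen x * sl2_casimir" for x
    by (subst (1 2) sl2_basis)
      (simp add: uea_gen_add uea_gen_scaleC distrib_left distrib_right mult_scaleC_left
        mult_scaleC_right gens)
  show ?thesis
  proof (induction u rule: uea_induct_left)
    case (gen x u)
    then show ?case using \<open>\<And>x. sl2_casimir * uea_gen x = uea_gen x * sl2_casimir\<close>[of x]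
      by (metis mult.assoc)
  qed (simp_all add: distrib_left distrib_right mult_scaleC_left mult_scaleC_right)
qed

lemma countable_span_uea_sl2:
  "\<exists>B. countable B \<and> complex_vector.span B = (UNIV :: sl2 uea set)"
proof -
  let ?G = "{uea_gen sl2_e, uea_gen sl2_h, uea_gen sl2_f}"
  let ?B = "prod_list ` lists ?G"
  have "u \<in> complex_vector.span ?B" for u
  proof (induction u rule: uea_induct_left)
    case one
    show ?case by (rule complex_vector.span_base) (auto intro: image_eqI[of _ _ "[]"])
  next
    case (gen x u)
    have mult: "g * u \<in> complex_vector.span ?B" if g: "g \<in> ?G" for g
      using gen
    proof (induction rule: complex_vector.span_induct_alt)
      case base show ?case by (simp add: complex_vector.span_zero)
    next
      case (step c b v)
      then obtain l where "l \<in> lists ?G" "b = prod_list l" by blast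
      then have "g * b = prod_list (g # l)" "g # l \<in> lists ?G" using g by auto
      then have "g * b \<in> complex_vector.span ?B" by (intro complex_vector.span_base) blast
      then show ?case
        using step(2) by (simp add: distrib_left mult_scaleC_right complex_vector.span_add
            complex_vector.span_scale)
    qed
    have "coeff_e x *\<^sub>C (uea_gen sl2_e * u) + coeff_h x *\<^sub>C (uea_gen sl2_h * u)
        + coeff_f x *\<^sub>C (uea_gen sl2_f * u) \<in> complex_vector.span ?B"
      by (intro complex_vector.span_add complex_vector.span_scale mult) simp_all
    then show ?case
      by (subst sl2_basis) (simp add: uea_gen_add uea_gen_scaleC distrib_right mult_scaleC_left)
  qed (auto intro: complex_vector.span_add complex_vector.span_scale)
  moreover have "countable ?B" by (intro countable_image countable_lists) (simp add: countable_finite)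
  ultimately show ?thesis by blast
qed

lemma uea_act_incl:
  assumes "lie_module scale \<rho> V" "lie_module scale (\<lambda>x. \<rho> (Takiff x 0)) V" "v \<in> V"
  shows "uea_act scale \<rho> (uea_incl u) v = uea_act scale (\<lambda>x. \<rho> (Takiff x 0)) u v"
proof -
  interpret T: lie_module scale \<rho> V by fact
  interpret S: lie_module scale "\<lambda>x. \<rho> (Takiff x 0)" V by fact
  show ?thesis
    using assms(3)
    by (induction u rule: uea_induct_left)
      (simp_all add: uea_incl_hom T.uea.act_one S.uea.act_one T.uea.act_add_left S.uea.act_add_left
        T.uea_act_scaleC S.uea_act_scaleC T.uea.act_mult S.uea.act_mult T.uea_act_gen S.uea_act_gen
        S.uea.act_closed)
qed

text \<open>As an algebra, \<open>U(g \<otimes> D)\<close> modulo \<open>g \<otimes> t\<close> is a quotient of \<open>U(g)\<close>.\<close>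

lemma uea_incl_complement:
  fixes a :: "'g::complex_lie_algebra takiff uea"
  shows "\<exists>u. a - uea_incl u \<in> ideal_generated (range \<iota>\<^sub>t)"
proof -
  let ?N = "ideal_generated (range \<iota>\<^sub>t :: 'g takiff uea set)"
  note N = two_sided_ideal_ideal_generated[of "range \<iota>\<^sub>t :: 'g takiff uea set"]
  show ?thesis
  proof (induction a rule: uea_induct_left)
    case one
    show ?case using ideal_zero[OF N] by (intro exI[of _ 1]) (simp add: uea_incl_hom)
  next
    case (add a b)
    then obtain u v where "a - uea_incl u \<in> ?N" "b - uea_incl v \<in> ?N" by blast
    then have "(a - uea_incl u) + (b - uea_incl v) \<in> ?N" by (rule ideal_add[OF N])
    then show ?case by (intro exI[of _ "u + v"]) (simp add: uea_incl_hom algebra_simps)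
  next
    case (scale c a)
    then obtain u where "a - uea_incl u \<in> ?N" by blast
    then have "c *\<^sub>C (a - uea_incl u) \<in> ?N" by (rule ideal_scaleC[OF N])
    then show ?case
      by (intro exI[of _ "c *\<^sub>C u"])
        (simp add: uea_incl_hom complex_vector.scale_right_diff_distrib)
  next
    case (gen X a)
    then obtain u where u: "a - uea_incl u \<in> ?N" by blast
    obtain x y where X: "X = Takiff x y" by (cases X)
    have X_sum: "uea_gen X = \<iota> x + \<iota>\<^sub>t y"
      unfolding X by (simp add: takiff_simps flip: uea_gen_add)
    have t: "\<iota>\<^sub>t y \<in> ?N" by (rule subsetD[OF ideal_generated_superset rangeI])
    have "\<iota> x * (a - uea_incl u) + \<iota>\<^sub>t y * a \<in> ?N"
      by (rule ideal_add[OF N ideal_lmult[OF N u] ideal_rmult[OF N t]])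
    also have "\<iota> x * (a - uea_incl u) + \<iota>\<^sub>t y * a = uea_gen X * a - uea_incl (uea_gen x * u)"
      by (simp add: X_sum uea_incl_hom algebra_simps)
    finally show ?case by blast
  qed
qed

text \<open>Modulo \<open>\<II>(\<mu>)\<close>, the relations \<open>4 f e = (\<mu> + 1)\<^sup>2 - (h + 1)\<^sup>2\<close> and
  \<open>4 e f = (\<mu> + 1)\<^sup>2 - (h - 1)\<^sup>2\<close> hold.\<close>

lemma weyl_generators_sl2:
  "weyl_generators (ideal_fI \<mu>) (\<iota> sl2_e) (\<iota> sl2_f) (\<iota> sl2_h) (\<iota> sl2_h) 2
     [:((\<mu> + 1)\<^sup>2 - 1) / 4, 1 / 2, - (1 / 4):] [:((\<mu> + 1)\<^sup>2 - 1) / 4, - (1 / 2), - (1 / 4):]"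
proof -
  let ?e = "\<iota> sl2_e" and ?h = "\<iota> sl2_h" and ?f = "\<iota> sl2_f"
  have I: "two_sided_ideal (ideal_fI \<mu>)"
    unfolding ideal_fI_def by (rule two_sided_ideal_ideal_generated)
  define d where "d = uea_incl sl2_casimir - (\<mu> + 1)\<^sup>2 *\<^sub>C 1"
  have d: "d \<in> ideal_fI \<mu>"
    unfolding ideal_fI_def d_def by (rule subsetD[OF ideal_generated_superset]) simp
  have "uea_incl sl2_casimir = (?h + 1) * (?h + 1) + 4 *\<^sub>C (?f * ?e)"
    unfolding sl2_casimir_def power2_eq_square mult.assoc numeral_scaleC uea_incl_hom
    by (simp add: mult_scaleC_left)
  then have d_eq: "d = ?h * ?h + 2 *\<^sub>C ?h + 1 + 4 *\<^sub>C (?f * ?e) - (\<mu> + 1)\<^sup>2 *\<^sub>C 1"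
    using scaleC_add_left[of 1 1 ?h] by (simp add: d_def distrib_left distrib_right scaleC_one)
  have fe: "?f * ?e - poly_at [:((\<mu> + 1)\<^sup>2 - 1) / 4, - (1 / 2), - (1 / 4):] ?h = (1 / 4) *\<^sub>C d"
    by (simp add: d_eq poly_at_pCons poly_at_0 scaleC_add_right scaleC_scaleC minus_scaleC scaleC_one
        mult_scaleC_right complex_vector.scale_right_diff_distrib diff_divide_distrib
        complex_vector.scale_left_diff_distrib right_diff_distrib)
  have "?e * ?f - poly_at [:((\<mu> + 1)\<^sup>2 - 1) / 4, 1 / 2, - (1 / 4):] ?h
      = ?f * ?e - poly_at [:((\<mu> + 1)\<^sup>2 - 1) / 4, - (1 / 2), - (1 / 4):] ?h"
  proof -
    have "poly_at [:((\<mu> + 1)\<^sup>2 - 1) / 4, 1 / 2, - (1 / 4):] ?h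
        = poly_at ([:((\<mu> + 1)\<^sup>2 - 1) / 4, - (1 / 2), - (1 / 4):] + [:0, 1:]) ?h" by simp
    also have "\<dots> = poly_at [:((\<mu> + 1)\<^sup>2 - 1) / 4, - (1 / 2), - (1 / 4):] ?h + ?h"
      unfolding poly_at_add by (simp add: poly_at_pCons poly_at_0 scaleC_one)
    finally show ?thesis using takiff.comm_ef by (simp add: algebra_simps)
  qed
  then have ef: "?e * ?f - poly_at [:((\<mu> + 1)\<^sup>2 - 1) / 4, 1 / 2, - (1 / 4):] ?h = (1 / 4) *\<^sub>C d"
    using fe by simp
  show ?thesis
  proof
    show "?e * ?f - poly_at [:((\<mu> + 1)\<^sup>2 - 1) / 4, 1 / 2, - (1 / 4):] ?h \<in> ideal_fI \<mu>"
      unfolding ef by (rule ideal_scaleC[OF I d])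
    show "?f * ?e - poly_at [:((\<mu> + 1)\<^sup>2 - 1) / 4, - (1 / 2), - (1 / 4):] ?h \<in> ideal_fI \<mu>"
      unfolding fe by (rule ideal_scaleC[OF I d])
  qed (use I takiff.comm_he takiff.comm_hf in \<open>simp_all add: numeral_scaleC minus_scaleC\<close>)
qed

lemma above_ideal_fI:
  assumes J: "two_sided_ideal J" "ideal_fI \<mu> \<subseteq> J" "J \<noteq> ideal_fI \<mu>"
  shows "\<exists>j. \<iota> sl2_e ^ j \<in> J"
proof -
  let ?e = "\<iota> sl2_e" and ?h = "\<iota> sl2_h" and ?f = "\<iota> sl2_f"
  interpret W: weyl_generators "ideal_fI \<mu>" ?e ?f ?h ?h 2
    "[:((\<mu> + 1)\<^sup>2 - 1) / 4, 1 / 2, - (1 / 4):]" "[:((\<mu> + 1)\<^sup>2 - 1) / 4, - (1 / 2), - (1 / 4):]"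
    by (rule weyl_generators_sl2)
  have t: "\<iota>\<^sub>t x \<in> ideal_fI \<mu>" for x
    unfolding ideal_fI_def by (rule subsetD[OF ideal_generated_superset]) simp
  obtain u where u: "u \<in> J" "u \<notin> ideal_fI \<mu>" using J by blast
  have "u \<in> W.graded_forms"
  proof (induction u rule: takiff.generated)
    case (4 u g)
    then show ?case
      using W.graded_forms_mult_x W.graded_forms_mult_y W.graded_forms_mult_z
        W.ideal_in_graded_forms ideal_lmult[OF W.ideal_I t] by auto
  qed (auto intro: W.one_in_graded_forms W.graded_forms_add W.graded_forms_scaleC)
  then obtain k p where p: "p \<noteq> 0" "?e ^ k * poly_at p ?h \<in> J"
    using W.weight_vector_in_ideal[OF J(1,2) _ u] by blast
  show ?thesis
  proof (rule power_in_ideal[OF J(1) _ p])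
    fix k and p :: "complex poly"
    assume p: "degree p > 0" "?e ^ k * poly_at p ?h \<in> J"
    let ?q = "pcompose p [:2, 1:] - p"
    have "?e ^ k * poly_at p ?h * ?e - ?e * (?e ^ k * poly_at p ?h) \<in> J"
      by (rule ideal_diff[OF J(1) ideal_rmult[OF J(1) p(2)] ideal_lmult[OF J(1) p(2)]])
    also have "?e ^ k * poly_at p ?h * ?e - ?e * (?e ^ k * poly_at p ?h)
        = ?e ^ Suc k * poly_at (pcompose p [:2, 1:]) ?h - ?e ^ Suc k * poly_at p ?h"
      using poly_at_shift[OF W.zx, of p] by (simp add: mult.assoc) (simp add: power_commutes flip: mult.assoc)
    also have "\<dots> = ?e ^ Suc k * poly_at ?q ?h" by (simp only: poly_at_diff right_diff_distrib)
    finally have "?e ^ Suc k * poly_at ?q ?h \<in> J" .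
    moreover have "?q \<noteq> 0" "degree ?q < degree p" using poly_difference[of p 2] p(1) by auto
    ultimately show "\<exists>k' p'. p' \<noteq> 0 \<and> degree p' < degree p \<and> ?e ^ k' * poly_at p' ?h \<in> J"
      by blast
  qed
qed

lemma casimirs_in_annihilator:
  assumes "lie_module scale \<rho> V"
    and "\<forall>v\<in>V. uea_act scale \<rho> takiff_C v = scale \<theta> v"
    and "\<forall>v\<in>V. uea_act scale \<rho> takiff_C_bar v = scale \<chi> v"
  shows "ideal_I \<chi> \<theta> \<subseteq> annihilator (uea_act scale \<rho>) V"
proof -
  interpret lie_module scale \<rho> V by fact
  show ?thesis
    unfolding ideal_I_def
    by (rule ideal_generated_minimal[OF uea.two_sided_ideal_annihilator])
      (use assms(2,3) in \<open>auto simp: annihilator_def uea.act_diff_left uea_act_scaleC uea.act_one\<close>)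
qed

text \<open>On \<open>x\<^sup>m y\<^sup>n\<close> the Casimir element of \<open>sl2\<close> acts by \<open>(m + n + 1)\<^sup>2\<close>, which is not constant.\<close>

lemma casimir_notin_ideal_I_00: "uea_incl sl2_casimir - r *\<^sub>C 1 \<notin> ideal_I 0 0"
proof
  assume "uea_incl sl2_casimir - r *\<^sub>C 1 \<in> ideal_I 0 0"
  then have "laurent (uea_incl sl2_casimir - r *\<^sub>C 1) (laurent_monomial 1 m 0) m 0 = 0" for m
    unfolding annihilator_laurent[symmetric] annihilator_def by simp
  moreover have "uea_incl sl2_casimir = (\<iota> sl2_h + 1) * (\<iota> sl2_h + 1) + 4 *\<^sub>C (\<iota> sl2_f * \<iota> sl2_e)"
    unfolding sl2_casimir_def power2_eq_square mult.assoc numeral_scaleC uea_incl_hom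
    by (simp add: mult_scaleC_left)
  ultimately have "(of_int m + 1)\<^sup>2 = r" for m
    by (simp add: laurent_simps laurent_monomial_gens)
      (simp add: laurent_monomial_def power2_eq_square algebra_simps)
  from this[of 0] this[of 1] show False by simp
qed

text \<open>
  By the descent for powers of \<open>E\<close>, some \<open>E\<^sup>j V \<noteq> 0\<close> is killed by \<open>E, H, F\<close>; the vectors with this
  property form a submodule.
\<close>

lemma bar_acts_by_zero:
  assumes "simple_lie_module scale \<rho> V"
    and I: "ideal_I 0 0 \<subseteq> annihilator (uea_act scale \<rho>) V"
    and E: "\<iota>\<^sub>t sl2_e ^ j \<in> annihilator (uea_act scale \<rho>) V"
  shows "range \<iota>\<^sub>t \<subseteq> annihilator (uea_act scale \<rho>) V"
proof -
  interpret simple_lie_module scale \<rho> V by fact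
  let ?A = "annihilator (uea_act scale \<rho>) V"
  let ?E = "\<iota>\<^sub>t sl2_e" and ?H = "\<iota>\<^sub>t sl2_h" and ?F = "\<iota>\<^sub>t sl2_f"
  have A: "two_sided_ideal ?A" by (rule uea.two_sided_ideal_annihilator)
  define W where "W = {v \<in> V. \<forall>x. \<rho> (Takiff 0 x) v = 0}"
  have "\<exists>k. ?E ^ Suc k \<in> ?A \<and> ?E ^ k \<notin> ?A"
    using E
  proof (induction j)
    case 0 then show ?case using uea.one_notin_annihilator[OF nonzero] by simp
  qed blast
  then obtain k where k: "?E ^ Suc k \<in> ?A" "?E ^ k \<notin> ?A" by blast
  then obtain v where v: "v \<in> V" "uea_act scale \<rho> (?E ^ k) v \<noteq> 0" by (auto simp: annihilator_def)
  let ?w = "uea_act scale \<rho> (?E ^ k) v"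
  have w: "?w \<in> V" using v(1) by (rule uea.act_closed)
  have "?E ^ k * ?H \<in> ?A" "?E ^ k * ?F \<in> ?A"
    using character.E_power_descent(1,3)[OF A I k(1)] by simp_all
  then have zero: "uea_act scale \<rho> (g * ?E ^ k) v = 0" if "g \<in> {?E, ?H, ?F}" for g
  proof -
    have "g * ?E = ?E * g" using that takiff.comm_EH takiff.comm_EF by auto
    then have "g * ?E ^ k = ?E ^ k * g" by (metis power_commuting_commutes)
    then have "g * ?E ^ k \<in> ?A"
      using that k(1) \<open>?E ^ k * ?H \<in> ?A\<close> \<open>?E ^ k * ?F \<in> ?A\<close> by (auto simp: power_commutes)
    then show ?thesis using v(1) by (simp add: annihilator_def)
  qed
  have "?w \<in> W"
  proof -
    have "\<rho> (Takiff 0 x) ?w = 0" for x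
    proof -
      have "\<iota>\<^sub>t x = coeff_e x *\<^sub>C ?E + coeff_h x *\<^sub>C ?H + coeff_f x *\<^sub>C ?F"
        using uea_gen_takiff[of 0 x] by (simp add: sl2_simps)
      then have "\<iota>\<^sub>t x * ?E ^ k = coeff_e x *\<^sub>C (?E * ?E ^ k) + coeff_h x *\<^sub>C (?H * ?E ^ k)
          + coeff_f x *\<^sub>C (?F * ?E ^ k)"
        by (simp only: distrib_right mult_scaleC_left)
      then have "uea_act scale \<rho> (\<iota>\<^sub>t x * ?E ^ k) v = 0"
        using v(1) zero by (simp add: uea.act_add_left uea_act_scaleC)
      then show ?thesis using v(1) w by (simp add: uea.act_mult uea_act_gen)
    qed
    then show ?thesis using w by (simp add: W_def)
  qed
  moreover have "W = {0} \<or> W = V"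
  proof (rule simple)
    have \<rho>_0: "\<rho> X 0 = 0" for X
      using \<rho>_scale_right[OF subspace_0[OF subspace_V], of X 0] by simp
    show "subspace W"
      by (rule subspaceI)
        (auto simp: W_def \<rho>_0 \<rho>_add_right \<rho>_scale_right subspace_0[OF subspace_V]
          subspace_add[OF subspace_V] subspace_scale[OF subspace_V])
    show "\<rho> X v \<in> W" if "v \<in> W" for X v
    proof -
      obtain a b where X: "X = Takiff a b" by (cases X)
      have V: "v \<in> V" and W: "\<And>x. \<rho> (Takiff 0 x) v = 0" using that by (simp_all add: W_def)
      have "\<rho> (Takiff 0 x) (\<rho> X v) = 0" for x
      proof -
        have "lie_bracket (Takiff 0 x) X = Takiff 0 (lie_bracket x a)"
          unfolding X by (simp add: takiff_simps sl2_simps)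
        then show ?thesis using \<rho>_bracket[OF V, of "Takiff 0 x" X] W by (simp add: \<rho>_0)
      qed
      then show ?thesis using V by (simp add: W_def \<rho>_closed)
    qed
  qed (auto simp: W_def)
  ultimately have "W = V" using v(2) by blast
  then have "\<rho> (Takiff 0 x) v = 0" if "v \<in> V" for x v
    using that unfolding W_def by blast
  then show ?thesis by (auto simp: annihilator_def uea_act_gen)
qed

text \<open>Once \<open>E, H, F\<close> act by zero, the annihilator contains the ideal of \<open>\<mu>\<close>.  If it is larger, \<open>e\<close> acts
  nilpotently, and a highest weight vector identifies the annihilator in \<open>U(sl2)\<close> as that of
  \<open>L(n)\<close>.\<close>

theorem annihilator_zero_character:
  assumes T: "simple_lie_module scale \<rho> V"
    and C: "\<forall>v\<in>V. uea_act scale \<rho> takiff_C v = scale 0 v"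
    and C_bar: "\<forall>v\<in>V. uea_act scale \<rho> takiff_C_bar v = scale 0 v"
    and S: "simple_lie_module scale (\<lambda>x. \<rho> (Takiff x 0)) V"
  shows "(\<exists>\<mu>. annihilator (uea_act scale \<rho>) V = ideal_fI \<mu>) \<or>
    (\<exists>n. annihilator (uea_act scale \<rho>) V = ideal_fF n)"
proof -
  interpret T: simple_lie_module scale \<rho> V by fact
  let ?\<sigma> = "\<lambda>x. \<rho> (Takiff x 0)"
  interpret S: simple_lie_module scale ?\<sigma> V by fact
  interpret S: sl2_module scale ?\<sigma> V ..
  let ?A = "annihilator (uea_act scale \<rho>) V"
  note A = T.uea.two_sided_ideal_annihilator
  note incl = uea_act_incl[OF T.lie_module_axioms S.lie_module_axioms]
  have I: "ideal_I 0 0 \<subseteq> ?A"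
    by (rule casimirs_in_annihilator[OF T.lie_module_axioms C C_bar])
  obtain B :: "sl2 uea set" where B: "countable B" "complex_vector.span B = UNIV"
    using countable_span_uea_sl2 by blast
  obtain r where r: "\<And>v. v \<in> V \<Longrightarrow> uea_act scale ?\<sigma> (sl2_casimir - r *\<^sub>C 1) v = 0"
    using central_acts_by_scalar[OF S.simple_uea_module B sl2_casimir_central] by blast
  have incl_diff: "uea_incl (sl2_casimir - c *\<^sub>C 1) = uea_incl sl2_casimir - c *\<^sub>C 1" for c
  proof -
    have "uea_incl (sl2_casimir - c *\<^sub>C 1 + c *\<^sub>C 1) = uea_incl (sl2_casimir - c *\<^sub>C 1) + c *\<^sub>C 1"
      unfolding uea_incl_hom ..
    then show ?thesis by simp
  qed
  have casimir: "uea_incl sl2_casimir - r *\<^sub>C 1 \<in> ?A"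
    using r incl by (simp add: annihilator_def flip: incl_diff)
  then have "?A \<noteq> ideal_I 0 0" using casimir_notin_ideal_I_00 by blast
  then obtain j where "\<iota>\<^sub>t sl2_e ^ j \<in> ?A" using above_ideal_I_00[OF A I] by blast
  then have bar: "range \<iota>\<^sub>t \<subseteq> ?A" by (rule bar_acts_by_zero[OF T I])
  define \<mu> where "\<mu> = csqrt r - 1"
  have \<mu>: "(\<mu> + 1)\<^sup>2 = r" by (simp add: \<mu>_def)
  have fI: "ideal_fI \<mu> \<subseteq> ?A"
    unfolding ideal_fI_def \<mu> by (rule ideal_generated_minimal[OF A]) (use casimir bar in blast)
  show ?thesis
  proof (cases "?A = ideal_fI \<mu>")
    case False
    then obtain j where j: "\<iota> sl2_e ^ j \<in> ?A" using above_ideal_fI[OF A fI] by blast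
    have nil: "(S.e ^^ j) v = 0" if "v \<in> V" for v
    proof -
      have "uea_incl (uea_gen sl2_e ^ j) = \<iota> sl2_e ^ j"
        by (induction j) (simp_all add: uea_incl_hom)
      then show ?thesis
        using j that incl[of v "uea_gen sl2_e ^ j"] S.uea_act_power[OF that, of sl2_e j]
        by (simp add: annihilator_def)
    qed
    have "\<exists>n w. S.highest_weight (of_nat n) w \<and> w \<noteq> 0"
    proof (rule S.ex_highest_weight[OF nil T.nonzero, of "\<mu> + 1"])
      fix v assume v: "v \<in> V" "S.e v = 0"
      have eq: "sl2_casimir = uea_gen sl2_h * uea_gen sl2_h + 2 *\<^sub>C uea_gen sl2_h + 1
          + 4 *\<^sub>C (uea_gen sl2_f * uea_gen sl2_e)"
        using scaleC_add_left[of 1 1 "uea_gen sl2_h"]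
        by (simp add: sl2_casimir_def power2_eq_square distrib_left distrib_right scaleC_one
            numeral_scaleC mult_scaleC_left mult.assoc)
      have "uea_act scale ?\<sigma> sl2_casimir v = S.h (S.h v) + scale 2 (S.h v) + v"
        unfolding eq using v by (simp add: S.uea.act_add_left S.uea.act_mult S.uea_act_gen S.uea_act_scaleC
            S.uea.act_one S.\<rho>_closed S.uea.act_zero_right)
      then show "S.h (S.h v) + scale 2 (S.h v) + v = scale ((\<mu> + 1)\<^sup>2) v"
        using r[OF v(1)] v(1)
        by (simp add: S.uea.act_diff_left S.uea_act_scaleC S.uea.act_one \<mu>)
    qed
    then obtain n w where w: "S.highest_weight (of_nat n) w" "w \<noteq> 0" by blast
    have ann: "annihilator (uea_act scale ?\<sigma>) V = ann_L n"
      unfolding ann_L by (rule S.annihilator_highest_weight[OF S w S.f_power_highest_weight[OF nil w(1)]])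
    have fF: "two_sided_ideal (ideal_fF n)"
      unfolding ideal_fF_def by (rule two_sided_ideal_ideal_generated)
    have incl_A: "uea_incl u \<in> ?A \<longleftrightarrow> u \<in> ann_L n" for u
      unfolding ann[symmetric] annihilator_def using incl by simp
    have "?A = ideal_fF n"
    proof
      show "ideal_fF n \<subseteq> ?A"
        unfolding ideal_fF_def by (rule ideal_generated_minimal[OF A]) (use incl_A bar in blast)
      show "?A \<subseteq> ideal_fF n"
      proof
        fix a assume a: "a \<in> ?A"
        obtain u where u: "a - uea_incl u \<in> ideal_generated (range \<iota>\<^sub>t)"
          using uea_incl_complement by blast
        then have "a - uea_incl u \<in> ?A" using ideal_generated_minimal[OF A bar] by blast
        then have "u \<in> ann_L n" using a incl_A ideal_cong[OF A] by blast
        then have "uea_incl u \<in> ideal_fF n"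
          unfolding ideal_fF_def by (intro subsetD[OF ideal_generated_superset]) simp
        moreover have "range \<iota>\<^sub>t \<subseteq> ideal_fF n"
          unfolding ideal_fF_def
          by (rule order_trans[OF _ ideal_generated_superset]) blast
        then have "a - uea_incl u \<in> ideal_fF n" using u ideal_generated_minimal[OF fF] by blast
        ultimately show "a \<in> ideal_fF n" using ideal_cong[OF fF] by blast
      qed
    qed
    then show ?thesis by blast
  qed blast
qed

theorem theorem4p2:
  fixes scale :: "complex \<Rightarrow> 'v::ab_group_add \<Rightarrow> 'v"
    and \<rho> :: "sl2 takiff \<Rightarrow> 'v \<Rightarrow> 'v"
    and V :: "'v set"
    and \<theta> \<chi> :: complex
  shows
    "(simple_lie_module scale \<rho> V \<and>
      (\<forall>v\<in>V. uea_act scale \<rho> takiff_C v = scale \<theta> v) \<and>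
      (\<forall>v\<in>V. uea_act scale \<rho> takiff_C_bar v = scale \<chi> v) \<longrightarrow>
        (\<theta> \<noteq> 0 \<or> \<chi> \<noteq> 0 \<longrightarrow>
          annihilator (uea_act scale \<rho>) V = ideal_I \<chi> \<theta>) \<and>
        (\<theta> = 0 \<and> \<chi> = 0 \<and> simple_lie_module scale (\<lambda>x. \<rho> (Takiff x 0)) V \<longrightarrow>
          (\<exists>\<mu>. annihilator (uea_act scale \<rho>) V = ideal_fI \<mu>) \<or>
          (\<exists>n. annihilator (uea_act scale \<rho>) V = ideal_fF n)))
     \<and> primitive_ideal (ideal_I 0 0)"
proof (intro conjI impI primitive_ideal_I_00; elim conjE)
  assume T: "simple_lie_module scale \<rho> V"
    and C: "\<forall>v\<in>V. uea_act scale \<rho> takiff_C v = scale \<theta> v"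
      "\<forall>v\<in>V. uea_act scale \<rho> takiff_C_bar v = scale \<chi> v"
  then interpret simple_lie_module scale \<rho> V by simp
  assume "\<theta> \<noteq> 0 \<or> \<chi> \<noteq> 0"
  then show "annihilator (uea_act scale \<rho>) V = ideal_I \<chi> \<theta>"
    by (rule character.maximal_of_nonzero_character[OF _ uea.two_sided_ideal_annihilator
          casimirs_in_annihilator[OF lie_module_axioms C] uea.one_notin_annihilator[OF nonzero]])
next
  assume "simple_lie_module scale \<rho> V"
    and "\<forall>v\<in>V. uea_act scale \<rho> takiff_C v = scale \<theta> v"
      "\<forall>v\<in>V. uea_act scale \<rho> takiff_C_bar v = scale \<chi> v"
    and "\<theta> = 0" "\<chi> = 0" "simple_lie_module scale (\<lambda>x. \<rho> (Takiff x 0)) V"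
  then show "(\<exists>\<mu>. annihilator (uea_act scale \<rho>) V = ideal_fI \<mu>) \<or>
      (\<exists>n. annihilator (uea_act scale \<rho>) V = ideal_fF n)"
    using annihilator_zero_character by blast
qed

end
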